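(* There exist a universal constant $c>0$ and a $\delta>0$ such that the following holds. Let $0<T\le\infty$ and let $u(x,t)\in L^\infty(0,T;H^{1/2}(\mathbb{T}^3))$ be a solution of the Navier-Stokes system on $\mathbb{T}^3$ with $\|u(t)\|_{H^{1/2}(\mathbb{T}^3)}<\delta$ for all $t\in(0,T)$. Put $$\sqrt{L_0}=\sup_{t\in(0,T)}\|u(t)\|_{H^{1/2}(\mathbb{T}^3)}.$$ Then for any $\rho>0$ there is a $K$, depending only on $\|u\|_{L^\infty(0,T;H^{1/2}(\mathbb{T}^3))}$ and $\rho$, such that if $\mathbf{k}\in\mathbb{Z}^3$, $|\mathbf{k}|\ge K$ and $t\in(0,T)$, $t>\rho$, then $$|u_{\mathbf{k}}(t)|\le\frac{\big(2(4+\sqrt2)L_0\big)/\big(1-2c\sqrt{L_0}\big)}{|\mathbf{k}|^2}.$$ Therefore, if $L_0$ is small enough (smaller than some universal positive constant), $u$ is regular on $(0,T)$, i.e. $C^\infty$ on $\mathbb{T}^3\times(0,T)$.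
   Context: $\mathbb{T}^3=[0,1]^3$ with periodic boundary conditions. The Navier-Stokes system is $$u_t-\Delta u+u\cdot\nabla u+\nabla p=0,\qquad u(x,0)=\psi,\quad \operatorname{div}u=0,$$ for real vector fields $u$ with three components. The Fourier expansion of $u(\cdot,t)$ is $\sum_{\mathbf{k}\in\mathbb{Z}^3}u_{\mathbf{k}}(t)\exp(2\pi i\langle x,\mathbf{k}\rangle)$, and $|u_{\mathbf{k}}|$ is the Euclidean norm of $u_{\mathbf{k}}\in\mathbb{C}^3$. The $H^{1/2}$ norm is taken in the homogeneous form $\|w\|_{H^{1/2}(\mathbb{T}^3)}=\big(\sum_{\mathbf{k}\neq0}|\mathbf{k}|\,|w_{\mathbf{k}}|^2\big)^{1/2}$. A solution on $[0,T)$ means a divergence-free, weakly continuous function $u:[0,T)\to L^2(\mathbb{T}^3)$ such that for all divergence-free $\varphi\in C^\infty(\mathbb{T}^3\times[0,T))$ and all $t\in[0,T)$, $$\langle u(t),\varphi(t)\rangle+\int_0^t\Big(-\langle u(\tau),\partial_\tau\varphi(\tau)\rangle+\langle\nabla u(\tau),\nabla\varphi(\tau)\rangle+\langle u\cdot\nabla u,\varphi\rangle\Big)d\tau=\langle\psi,\varphi(0)\rangle,$$ where the pairings are understood in the sense of distributions in $x$, i.e. $\langle\nabla u,\nabla\varphi\rangle=-\langle u,\Delta\varphi\rangle$ and $\langle u\cdot\nabla u,\varphi\rangle=-\langle u\otimes u,\nabla\varphi\rangle$. *)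

theory Defs
  imports "HOL-Analysis.Analysis" "HOL-Probability.Essential_Supremum"
begin

text \<open>
  The torus is modelled by the unit cube with Lebesgue measure. Elements of \<open>L\<^sup>2\<close> are represented by
  functions on \<open>\<real>\<^sup>3\<close> of which only the values on the cube matter; periodicity is required of smooth
  functions (test functions and regular solutions), which live on all of \<open>\<real>\<^sup>3\<close>. Time-dependent
  fields are curried: \<open>u t x\<close> stands for \<open>u(x,t)\<close>.
\<close>

definition torus :: "(real^3) measure" where
  "torus = lebesgue_on (cbox 0 1)"

definition L2_torus :: "(real^3 \<Rightarrow> real^3) set" where
  "L2_torus = {w. w \<in> borel_measurable torus \<and> integrable torus (\<lambda>x. (norm (w x))\<^sup>2)}"

definition pairing :: "(real^3 \<Rightarrow> real^3) \<Rightarrow> (real^3 \<Rightarrow> real^3) \<Rightarrow> real" where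
  "pairing v w = (LINT x|torus. v x \<bullet> w x)"

definition ivec :: "int^3 \<Rightarrow> real^3" where
  "ivec k = (\<chi> i. real_of_int (k $ i))"

definition periodic :: "(real^3 \<Rightarrow> 'b) \<Rightarrow> bool" where
  "periodic f \<longleftrightarrow> (\<forall>x k. f (x + ivec k) = f x)"

definition fourier :: "(real^3 \<Rightarrow> real^3) \<Rightarrow> int^3 \<Rightarrow> complex^3" where
  "fourier w k = (\<chi> j. LINT x|torus.
     complex_of_real (w x $ j) * exp (- (2 * complex_of_real pi * \<i> * complex_of_real (x \<bullet> ivec k))))"

text \<open>
  An infinite sum that does not converge has the value 0, so \<open>Hhalf_norm w\<close> is
  meaningful only for \<open>w\<close> in \<open>Hhalf\<close>.
\<close>

definition Hhalf :: "(real^3 \<Rightarrow> real^3) set" where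
  "Hhalf = {w \<in> L2_torus. (\<lambda>k. norm (ivec k) * (norm (fourier w k))\<^sup>2) summable_on (UNIV - {0})}"

definition Hhalf_norm :: "(real^3 \<Rightarrow> real^3) \<Rightarrow> real" where
  "Hhalf_norm w = sqrt (\<Sum>\<^sub>\<infinity>k\<in>UNIV - {0}. norm (ivec k) * (norm (fourier w k))\<^sup>2)"

text \<open>The final time \<open>T\<close> may be infinite.\<close>

definition open_times :: "ereal \<Rightarrow> real set" where
  "open_times T = {t. 0 < t \<and> ereal t < T}"

definition halfopen_times :: "ereal \<Rightarrow> real set" where
  "halfopen_times T = {t. 0 \<le> t \<and> ereal t < T}"

definition Linf_Hhalf_norm :: "ereal \<Rightarrow> (real \<Rightarrow> real^3 \<Rightarrow> real^3) \<Rightarrow> ereal" where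
  "Linf_Hhalf_norm T u = esssup (lebesgue_on (open_times T)) (\<lambda>t. ereal (Hhalf_norm (u t)))"

text \<open>
  Since \<open>H\<^sup>1\<^sup>/\<^sup>2\<close> is separable, strong measurability in time amounts to measurability of
  every Fourier coefficient.
\<close>

definition Linf_Hhalf :: "ereal \<Rightarrow> (real \<Rightarrow> real^3 \<Rightarrow> real^3) set" where
  "Linf_Hhalf T = {u.
     (\<forall>k. (\<lambda>t. fourier (u t) k) \<in> borel_measurable (lebesgue_on (open_times T))) \<and>
     (AE t in lebesgue_on (open_times T). u t \<in> Hhalf) \<and>
     Linf_Hhalf_norm T u < \<infinity>}"

text \<open>
  Derivatives are taken within \<open>S\<close>. They are unique for the sets used here (open sets, and
  space times a half-open time interval, where they are one-sided at time 0).
\<close>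

primrec Ck_on :: "nat \<Rightarrow> 'a::euclidean_space set \<Rightarrow> ('a \<Rightarrow> 'b::real_normed_vector) \<Rightarrow> bool" where
  "Ck_on 0 S f \<longleftrightarrow> continuous_on S f"
| "Ck_on (Suc n) S f \<longleftrightarrow>
     (\<exists>f'. (\<forall>x\<in>S. (f has_derivative f' x) (at x within S)) \<and> (\<forall>v. Ck_on n S (\<lambda>x. f' x v)))"

definition smooth_on :: "'a::euclidean_space set \<Rightarrow> ('a \<Rightarrow> 'b::real_normed_vector) \<Rightarrow> bool" where
  "smooth_on S f \<longleftrightarrow> (\<forall>n. Ck_on n S f)"

definition partial :: "3 \<Rightarrow> (real^3 \<Rightarrow> 'b::real_normed_vector) \<Rightarrow> real^3 \<Rightarrow> 'b" where
  "partial j f x = frechet_derivative f (at x) (axis j 1)"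

definition grad :: "(real^3 \<Rightarrow> real) \<Rightarrow> real^3 \<Rightarrow> real^3" where
  "grad f x = (\<chi> j. partial j f x)"

definition divergence :: "(real^3 \<Rightarrow> real^3) \<Rightarrow> real^3 \<Rightarrow> real" where
  "divergence f x = (\<Sum>j\<in>UNIV. partial j f x $ j)"

definition laplacian :: "(real^3 \<Rightarrow> real^3) \<Rightarrow> real^3 \<Rightarrow> real^3" where
  "laplacian f x = (\<Sum>j\<in>UNIV. partial j (partial j f) x)"

definition div_free :: "(real^3 \<Rightarrow> real^3) \<Rightarrow> bool" where
  "div_free w \<longleftrightarrow> (\<forall>\<eta>. smooth_on UNIV \<eta> \<and> periodic \<eta> \<longrightarrow> pairing w (grad \<eta>) = 0)"

definition test_field :: "ereal \<Rightarrow> (real \<Rightarrow> real^3 \<Rightarrow> real^3) \<Rightarrow> bool" where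
  "test_field T \<phi> \<longleftrightarrow>
     smooth_on (UNIV \<times> halfopen_times T) (\<lambda>(x, t). \<phi> t x) \<and>
     (\<forall>t\<in>halfopen_times T. periodic (\<phi> t) \<and> (\<forall>x. divergence (\<phi> t) x = 0))"

definition weakly_continuous_L2 :: "ereal \<Rightarrow> (real \<Rightarrow> real^3 \<Rightarrow> real^3) \<Rightarrow> bool" where
  "weakly_continuous_L2 T u \<longleftrightarrow>
     (\<forall>t\<in>halfopen_times T. u t \<in> L2_torus) \<and>
     (\<forall>g\<in>L2_torus. continuous_on (halfopen_times T) (\<lambda>t. pairing (u t) g))"

text \<open>The distributional pairing \<open>\<langle>\<nabla>w, \<nabla>\<phi>\<rangle>\<close>.\<close>

definition grad_pairing :: "(real^3 \<Rightarrow> real^3) \<Rightarrow> (real^3 \<Rightarrow> real^3) \<Rightarrow> real" where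
  "grad_pairing w \<phi> = - pairing w (laplacian \<phi>)"

text \<open>The distributional pairing \<open>\<langle>w \<cdot> \<nabla>w, \<phi>\<rangle> = - \<langle>w \<otimes> w, \<nabla>\<phi>\<rangle>\<close>.\<close>

definition convection_pairing :: "(real^3 \<Rightarrow> real^3) \<Rightarrow> (real^3 \<Rightarrow> real^3) \<Rightarrow> real" where
  "convection_pairing w \<phi> =
     - (LINT x|torus. (\<Sum>i\<in>UNIV. \<Sum>j\<in>UNIV. w x $ i * w x $ j * partial i \<phi> x $ j))"

definition NS_solution :: "ereal \<Rightarrow> (real^3 \<Rightarrow> real^3) \<Rightarrow> (real \<Rightarrow> real^3 \<Rightarrow> real^3) \<Rightarrow> bool" where
  "NS_solution T \<psi> u \<longleftrightarrow>
     \<psi> \<in> L2_torus \<and>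
     weakly_continuous_L2 T u \<and>
     (\<forall>t\<in>halfopen_times T. div_free (u t)) \<and>
     (\<forall>\<phi>. test_field T \<phi> \<longrightarrow> (\<forall>t\<in>halfopen_times T.
        pairing (u t) (\<phi> t)
        + (LINT \<tau>|lebesgue_on {0<..<t}.
             - pairing (u \<tau>) (\<lambda>x. vector_derivative (\<lambda>s. \<phi> s x) (at \<tau>))
             + grad_pairing (u \<tau>) (\<phi> \<tau>)
             + convection_pairing (u \<tau>) (\<phi> \<tau>))
        = pairing \<psi> (\<phi> 0)))"

text \<open>\<open>u t\<close> is an \<open>L\<^sup>2\<close> class, so regularity means having a smooth periodic representative.\<close>

definition regular :: "ereal \<Rightarrow> (real \<Rightarrow> real^3 \<Rightarrow> real^3) \<Rightarrow> bool" where
  "regular T u \<longleftrightarrow> (\<exists>v. smooth_on (UNIV \<times> open_times T) (\<lambda>(x, t). v t x) \<and>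
     (\<forall>t\<in>open_times T. periodic (v t) \<and> (AE x in torus. u t x = v t x)))"

end

theory Submission
  imports Defs
begin

text \<open>
  Let \<open>a\<^sub>k(t)\<close> be the norm of the Fourier coefficient at \<open>k\<close>, and \<open>L\<close> the supremum of the
  \<open>H\<^sup>1\<^sup>/\<^sup>2\<close> norm. Testing with divergence-free plane waves turns the equation into differential
  equations for the modes, with damping of order \<open>|k|\<^sup>2\<close> and a forcing bounded by a constant times
  \<open>|k| \<Sum> a\<^sub>l a\<^sub>k\<^sub>-\<^sub>l\<close>; the mean only rotates phases. Suppose that \<open>a\<^sub>k \<le> |k|\<^sup>-\<^sup>3\<^sup>/\<^sup>2 (P \<tau>\<^sup>-\<^sup>2 |k|\<^sup>-\<^sup>3 + Q)\<close>
  from a time \<open>\<tau>\<close> after the start on. In the convolution one of the two frequencies is at least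
  \<open>|k|/2\<close> and not less than the other; the Cauchy-Schwarz inequality against \<open>\<Sum> |l| a\<^sub>l\<^sup>2 \<le> L\<^sup>2\<close> and the
  bound \<open>\<Sum> |l|\<^sup>-\<^sup>1 max(|l|, R)\<^sup>-\<^sup>3 \<le> C/R\<close> for lattice sums reproduce the hypothesis with \<open>P\<close> replaced by
  \<open>C(L + L P)\<close> and \<open>Q\<close> by \<open>C L Q\<close>. For small \<open>L\<close> the iteration removes \<open>Q\<close> and leaves
  \<open>a\<^sub>k(t) \<le> C L t\<^sup>-\<^sup>2 |k|\<^sup>-\<^sup>9\<^sup>/\<^sup>2\<close>. The exponent exceeds 2, so that for large \<open>|k|\<close> the estimate of the theorem
  holds with any constant, provided that \<open>|k|\<close> is large compared with \<open>1/(\<rho>\<^sup>2 L)\<close>. Since this decay is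
  summable over the lattice, every further use of the differential equation gains one power of \<open>|k|\<close>;
  the coefficients and all their time derivatives decay rapidly, and the Fourier series is smooth.
\<close>

section \<open>Sums over the lattice\<close>

text \<open>The space is critical: damping and forcing balance, so a decay |k|^{-3/2} is merely
  reproduced and only the size of L makes the iteration contract. Decay |k|^{-3/2} of both factors
  does not even bound the convolution, since the sum of |l|^{-3/2} |k-l|^{-3/2} diverges
  logarithmically; therefore one factor keeps its energy. The exponent 9/2 is what exp(-x) <= 2/x^2
  with x = |k|^2 t yields for a mode of size L |k|^{-1/2}. The decay obtained is linear in L while
  the claim is quadratic; the missing factor L is bought with one power of |k|. Moreover K may
  depend only on the essential supremum N of the norm, whereas L is a supremum over all times. What
  links them is N <= L and the fact that N = 0 forces L = 0, which rests on continuity in time of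
  every mode. Another obstacle is that weak continuity in L^2 says nothing about the quadratic term.
  The H^{1/2} bound makes the tails of the convolution small uniformly in time, so its coefficients
  are continuous and the integral identity can be differentiated.\<close>

lemma ivec_simps [simp]: "ivec 0 = 0" "ivec (k + l) = ivec k + ivec l" "ivec (k - l) = ivec k - ivec l"
    "ivec (- k) = - ivec k"
  by (simp_all add: ivec_def vec_eq_iff)

lemma ivec_nth [simp]: "ivec k $ i = real_of_int (k $ i)"
  by (simp add: ivec_def)

abbreviation freq :: "int^3 \<Rightarrow> real" where
  "freq k \<equiv> norm (ivec k)"

lemma freq_ge_1: "k \<noteq> 0 \<Longrightarrow> freq k \<ge> 1"
proof -
  assume "k \<noteq> 0"
  then obtain i where i: "k $ i \<noteq> 0" by (auto simp: vec_eq_iff)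
  have "1 \<le> \<bar>ivec k $ i\<bar>" using i by simp
  also have "\<dots> \<le> freq k" using component_le_norm_cart by blast
  finally show ?thesis .
qed

section \<open>Counting lattice points in cubic shells\<close>

definition supnorm :: "int^3 \<Rightarrow> nat" where
  "supnorm j = nat (Max (range (\<lambda>i. \<bar>j $ i\<bar>)))"

lemma abs_le_supnorm: "\<bar>j $ i\<bar> \<le> int (supnorm j)"
proof -
  have "\<bar>j $ i\<bar> \<le> Max (range (\<lambda>i. \<bar>j $ i\<bar>))" by (rule Max_ge) auto
  then show ?thesis unfolding supnorm_def by linarith
qed

lemma supnorm_attained: "\<exists>i. \<bar>j $ i\<bar> = int (supnorm j)"
proof -
  have "Max (range (\<lambda>i. \<bar>j $ i\<bar>)) \<in> range (\<lambda>i. \<bar>j $ i\<bar>)" by (intro Max_in) auto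
  then obtain i where "Max (range (\<lambda>i. \<bar>j $ i\<bar>)) = \<bar>j $ i\<bar>" by blast
  then show ?thesis unfolding supnorm_def by (intro exI[of _ i]) simp
qed

lemma supnorm_le_norm: "real (supnorm j) \<le> freq j"
proof -
  obtain i where "\<bar>j $ i\<bar> = int (supnorm j)" using supnorm_attained by blast
  then have "real (supnorm j) = \<bar>ivec j $ i\<bar>" by (simp flip: of_int_abs)
  also have "\<dots> \<le> freq j" using component_le_norm_cart by blast
  finally show ?thesis .
qed

lemma supnorm_pos: "j \<noteq> 0 \<Longrightarrow> supnorm j \<ge> 1"
proof (rule ccontr)
  assume j: "j \<noteq> 0" "\<not> supnorm j \<ge> 1"
  then have "\<bar>j $ i\<bar> \<le> 0" for i using abs_le_supnorm[of j i] by simp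
  then show False using j by (auto simp: vec_eq_iff)
qed

lemma card_int_box:
  fixes S :: "3 \<Rightarrow> int set"
  assumes "\<And>i. finite (S i)"
  shows "finite {j::int^3. \<forall>i. j $ i \<in> S i}" "card {j::int^3. \<forall>i. j $ i \<in> S i} = (\<Prod>i\<in>UNIV. card (S i))"
proof -
  have b: "bij_betw vec_lambda (Pi\<^sub>E UNIV S) {j::int^3. \<forall>i. j $ i \<in> S i}"
    by (rule bij_betw_byWitness[where f' = vec_nth]) (auto simp: PiE_def Pi_def)
  show "finite {j::int^3. \<forall>i. j $ i \<in> S i}"
    using bij_betw_finite[OF b] finite_PiE[of UNIV S] assms by simp
  show "card {j::int^3. \<forall>i. j $ i \<in> S i} = (\<Prod>i\<in>UNIV. card (S i))"
    using bij_betw_same_card[OF b] card_PiE[of UNIV S] by simp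
qed

text \<open>A shell is covered by three pairs of opposite faces. In a pair one coordinate is n or -n
  and two are free, which makes at most 2 (2n + 1)^2 <= 18 n^2 points.\<close>

lemma card_shell:
  assumes "n \<ge> 1"
  shows "finite {j. supnorm j = n}" "card {j. supnorm j = n} \<le> 54 * n\<^sup>2"
proof -
  let ?S = "\<lambda>i i'. if i' = i then {int n, - int n} else {- int n..int n}"
  let ?B = "\<lambda>i::3. {j::int^3. \<forall>i'. j $ i' \<in> ?S i i'}"
  have fS: "finite (?S i i')" for i i' :: 3 by simp
  have sub: "{j. supnorm j = n} \<subseteq> (\<Union>i. ?B i)"
  proof
    fix j assume "j \<in> {j. supnorm j = n}"
    then have n: "supnorm j = n" by simp
    obtain i where i: "\<bar>j $ i\<bar> = int n" using supnorm_attained[of j] n by auto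
    have "j \<in> ?B i" using i abs_le_supnorm[of j] n by (auto simp: abs_le_iff) (metis minus_le_iff)
    then show "j \<in> (\<Union>i. ?B i)" by blast
  qed
  have cB: "card (?B i) \<le> 18 * n\<^sup>2" for i
  proof -
    have "card (?B i) = (\<Prod>i'\<in>UNIV. card (?S i i'))"
      using card_int_box(2)[of "?S i"] fS by simp
    also have "\<dots> = card (?S i i) * (\<Prod>i'\<in>UNIV - {i}. card (?S i i'))"
      by (rule prod.remove) auto
    also have "(\<Prod>i'\<in>UNIV - {i}. card (?S i i')) = (\<Prod>i'\<in>UNIV - {i}. 2 * n + 1)"
      by (rule prod.cong) auto
    also have "\<dots> = (2 * n + 1)\<^sup>2" by (simp add: card_Diff_subset)
    also have "card (?S i i) * (2 * n + 1)\<^sup>2 \<le> 2 * (3 * n)\<^sup>2"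
      using assms by (intro mult_mono power_mono) (auto simp: card_insert_if)
    finally show ?thesis by (simp add: power_mult_distrib)
  qed
  have fB: "finite (?B i)" for i using card_int_box(1)[of "?S i"] fS by simp
  show "finite {j. supnorm j = n}" by (rule finite_subset[OF sub]) (use fB in auto)
  have "card {j. supnorm j = n} \<le> card (\<Union>i. ?B i)" by (rule card_mono[OF _ sub]) (use fB in auto)
  also have "\<dots> \<le> (\<Sum>i\<in>UNIV. card (?B i))" by (rule card_UN_le) simp
  also have "\<dots> \<le> (\<Sum>i\<in>(UNIV::3 set). 18 * n\<^sup>2)" by (rule sum_mono) (rule cB)
  finally show "card {j. supnorm j = n} \<le> 54 * n\<^sup>2" by simp
qed

text \<open>Replacing the Euclidean norm by the smaller sup norm increases every term and makes it
  constant on shells. Counting the shells leaves a one-dimensional sum with a telescoping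
  majorant.\<close>

lemma lattice_sum:
  assumes R: "R > 0" and F: "finite F" "0 \<notin> F"
  shows "(\<Sum>j\<in>F. 1 / (freq j * max (freq j) R ^ 3)) \<le> 432 / R"
proof -
  define g where "g n = 1 / (real n * max (real n) R ^ 3)" for n
  obtain N where N: "\<forall>j\<in>F. supnorm j \<le> N" using F(1) by (metis finite_nat_set_iff_bounded_le finite_imageI imageI)
  have pos: "supnorm j \<ge> 1" if "j \<in> F" for j using that F(2) supnorm_pos by metis
  have g0: "g n \<ge> 0" for n using R by (auto simp: g_def)
  have "(\<Sum>j\<in>F. 1 / (freq j * max (freq j) R ^ 3)) \<le> (\<Sum>j\<in>F. g (supnorm j))"
  proof (rule sum_mono)
    fix j assume "j \<in> F"
    then have "real (supnorm j) \<ge> 1" using pos by force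
    then show "1 / (freq j * max (freq j) R ^ 3) \<le> g (supnorm j)"
      unfolding g_def using supnorm_le_norm[of j] R
      by (intro divide_left_mono mult_mono power_mono mult_pos_pos zero_less_power) auto
  qed
  also have "\<dots> = (\<Sum>n\<in>{1..N}. \<Sum>j\<in>{j\<in>F. supnorm j = n}. g (supnorm j))"
    by (rule sum.group[symmetric]) (use F N pos in auto)
  also have "\<dots> = (\<Sum>n\<in>{1..N}. real (card {j\<in>F. supnorm j = n}) * g n)"
    by (intro sum.cong) auto
  also have "\<dots> \<le> (\<Sum>n\<in>{1..N}. 432 * (1 / (R + real (n - 1)) - 1 / (R + real n)))"
  proof (rule sum_mono)
    fix n assume "n \<in> {1..N}"
    then have n: "n \<ge> 1" by simp
    have "card {j\<in>F. supnorm j = n} \<le> card {j. supnorm j = n}"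
      by (rule card_mono) (use card_shell(1)[OF n] in auto)
    also have "\<dots> \<le> 54 * n\<^sup>2" by (rule card_shell(2)[OF n])
    finally have "real (card {j\<in>F. supnorm j = n}) \<le> real (54 * n\<^sup>2)" by (rule of_nat_mono)
    then have "real (card {j\<in>F. supnorm j = n}) * g n \<le> 54 * (real n)\<^sup>2 * g n"
      using g0 by (intro mult_right_mono) auto
    also have "\<dots> = 54 * (real n / max (real n) R ^ 3)" using n by (simp add: g_def power2_eq_square)
    \<comment> \<open>The maximum of n and R is at least their mean; with n enlarged to R + n the
      quotient becomes 8/(R + n)^2, and 432 = 54 * 8.\<close>
    also have "\<dots> \<le> 54 * ((R + real n) / ((R + real n) / 2) ^ 3)"
      using n R by (intro mult_left_mono frac_le power_mono) auto
    also have "\<dots> = 432 * (1 / (R + real n)\<^sup>2)"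
    proof -
      have "x / (x / 2) ^ 3 = 8 * (1 / x\<^sup>2)" if "x > 0" for x :: real
        using that by (simp add: field_simps power2_eq_square power3_eq_cube)
      from this[of "R + real n"] show ?thesis using R by simp
    qed
    also have "\<dots> \<le> 432 * (1 / ((R + real (n - 1)) * (R + real n)))"
      using n R by (intro mult_left_mono divide_left_mono) (auto simp: power2_eq_square)
    also have "\<dots> = 432 * (1 / (R + real (n - 1)) - 1 / (R + real n))"
      using n R by (simp add: field_simps of_nat_diff)
    finally show "real (card {j\<in>F. supnorm j = n}) * g n \<le> 432 * (1 / (R + real (n - 1)) - 1 / (R + real n))" .
  qed
  also have "\<dots> = 432 * (1 / R - 1 / (R + real N))"
  proof -
    have "(\<Sum>n\<in>{1..N}. 1 / (R + real (n - 1)) - 1 / (R + real n)) = 1 / R - 1 / (R + real N)"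
      by (induction N) auto
    then show ?thesis by (simp only: sum_distrib_left[symmetric])
  qed
  also have "\<dots> \<le> 432 / R" using R by simp
  finally show ?thesis .
qed

section \<open>Weighted estimates for convolutions\<close>

text \<open>Half-integer powers of |k| become natural powers of \<open>rt k\<close>: |k|^{-3/2} is
  \<open>1 / rt k ^ 3\<close> and |k|^{-9/2} is \<open>1 / rt k ^ 9\<close>.\<close>

definition rt :: "int^3 \<Rightarrow> real" where
  "rt k = sqrt (freq k)"

lemma rt_ge_1: "k \<noteq> 0 \<Longrightarrow> rt k \<ge> 1"
  using freq_ge_1 by (simp add: rt_def)

lemma rt_nonneg [simp]: "rt k \<ge> 0"
  by (simp add: rt_def)

lemma rt_square: "rt k ^ 2 = freq k"
  by (simp add: rt_def)

lemma freq_triangle: "freq k \<le> freq l + freq (k - l)"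
  using norm_triangle_ineq[of "ivec l" "ivec (k - l)"] by simp

text \<open>The reflection l -> k - l exchanges the two factors, so it suffices to estimate sums in
  which l is the lower of the two frequencies.\<close>

lemma convolution_split:
  fixes x :: "int^3 \<Rightarrow> real"
  assumes B: "\<And>F. finite F \<Longrightarrow> (\<And>l. l \<in> F \<Longrightarrow> l \<noteq> 0 \<and> l \<noteq> k \<and> freq l \<le> freq (k - l)) \<Longrightarrow>
      (\<Sum>l\<in>F. x l * x (k - l)) \<le> B"
    and F: "finite F" "0 \<notin> F" "k \<notin> F"
  shows "(\<Sum>l\<in>F. x l * x (k - l)) \<le> 2 * B"
proof -
  let ?F1 = "{l\<in>F. freq l \<le> freq (k - l)}"
  let ?F2 = "{l\<in>F. \<not> freq l \<le> freq (k - l)}"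
  have "(\<Sum>l\<in>F. x l * x (k - l)) = (\<Sum>l\<in>?F1. x l * x (k - l)) + (\<Sum>l\<in>?F2. x l * x (k - l))"
    by (subst sum.union_disjoint[symmetric]) (use F in \<open>auto intro!: sum.cong\<close>)
  also have "(\<Sum>l\<in>?F2. x l * x (k - l)) = (\<Sum>l\<in>(\<lambda>l. k - l) ` ?F2. x l * x (k - l))"
    by (subst sum.reindex) (auto simp: inj_on_def mult.commute)
  also have "\<dots> \<le> B"
    by (rule B) (use F in \<open>auto\<close>)
  also have "(\<Sum>l\<in>?F1. x l * x (k - l)) \<le> B"
    by (rule B) (use F in auto)
  finally show ?thesis by simp
qed

text \<open>For |l| <= |k-l| the triangle inequality gives |k-l| >= max(|l|, |k|/2). The decay is
  spent on \<open>x (k - l)\<close>; after Cauchy-Schwarz against the energy of \<open>x l\<close>,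
  what remains is exactly the sum in \<open>lattice_sum\<close>. The factor 8 in front of P is the
  cube of 2, from R = |k|/2.\<close>

lemma convolution_bound:
  fixes x :: "int^3 \<Rightarrow> real"
  assumes x: "\<And>j. x j \<ge> 0" and L: "L \<ge> 0" and k: "k \<noteq> 0" and PQ: "P \<ge> 0" "Q \<ge> 0"
    and energy: "\<And>F. finite F \<Longrightarrow> 0 \<notin> F \<Longrightarrow> (\<Sum>j\<in>F. freq j * (x j)\<^sup>2) \<le> L\<^sup>2"
    and bound: "\<And>j. j \<noteq> 0 \<Longrightarrow> x j \<le> (P / rt j ^ 6 + Q) / rt j ^ 3"
    and F: "finite F" "0 \<notin> F" "k \<notin> F"
  shows "(\<Sum>l\<in>F. x l * x (k - l)) \<le> 60 * L * (8 * P / rt k ^ 6 + Q) / rt k"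
proof -
  define R where "R = freq k / 2"
  have R: "R > 0" using freq_ge_1[OF k] by (auto simp: R_def)
  define c where "c = 8 * P / rt k ^ 6 + Q"
  have c0: "c \<ge> 0" using PQ by (simp add: c_def)
  have rk6: "rt k ^ 6 = freq k ^ 3" by (simp flip: rt_square)
  have "(\<Sum>l\<in>F. x l * x (k - l)) \<le> 2 * (c * (L * (30 / rt k)))"
  proof (rule convolution_split[OF _ F])
    fix F assume F: "finite F" and FF: "\<And>l. l \<in> F \<Longrightarrow> l \<noteq> 0 \<and> l \<noteq> k \<and> freq l \<le> freq (k - l)"
    define D where "D l = max (freq l) R" for l
    have D0: "D l > 0" for l using R by (simp add: D_def)
    have F0: "0 \<notin> F" using FF by blast
    have b1: "x (k - l) \<le> c / sqrt (D l ^ 3)" if l: "l \<in> F" for l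
    proof -
      have Dl: "D l \<le> freq (k - l)"
        using freq_triangle[of k l] FF[OF l] by (simp add: D_def R_def del: ivec_simps)
      have r6: "rt (k - l) ^ 6 = freq (k - l) ^ 3" by (simp flip: rt_square del: ivec_simps)
      have "R ^ 3 \<le> rt (k - l) ^ 6" unfolding r6
        using Dl R by (intro power_mono) (auto simp: D_def)
      then have "P / rt (k - l) ^ 6 \<le> P / R ^ 3"
        using PQ R by (intro frac_le) auto
      also have "\<dots> = 8 * P / rt k ^ 6" by (simp add: rk6 R_def power_divide)
      finally have 1: "P / rt (k - l) ^ 6 + Q \<le> c" by (simp add: c_def)
      have 2: "sqrt (D l ^ 3) \<le> rt (k - l) ^ 3" unfolding rt_def real_sqrt_power[symmetric]
        using Dl D0[of l] by (intro real_sqrt_le_mono power_mono) (auto simp: less_imp_le)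
      have "x (k - l) \<le> (P / rt (k - l) ^ 6 + Q) / rt (k - l) ^ 3" using bound FF[OF l] by auto
      also have "\<dots> \<le> c / sqrt (D l ^ 3)"
        using 1 2 D0[of l] PQ c0 by (intro frac_le) auto
      finally show ?thesis .
    qed
    have "(\<Sum>l\<in>F. x l * x (k - l)) \<le> (\<Sum>l\<in>F. x l * (c / sqrt (D l ^ 3)))"
      using b1 x by (intro sum_mono mult_left_mono) auto
    also have "\<dots> = c * (\<Sum>l\<in>F. (rt l * x l) * (1 / (rt l * sqrt (D l ^ 3))))"
      unfolding sum_distrib_left using FF rt_ge_1
      by (intro sum.cong refl) (force simp: field_simps)
    also have "(\<Sum>l\<in>F. (rt l * x l) * (1 / (rt l * sqrt (D l ^ 3)))) \<le> L * (30 / rt k)"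
    proof (rule power2_le_imp_le)
      have "(\<Sum>l\<in>F. (rt l * x l) * (1 / (rt l * sqrt (D l ^ 3))))\<^sup>2
          \<le> (\<Sum>l\<in>F. (rt l * x l)\<^sup>2) * (\<Sum>l\<in>F. (1 / (rt l * sqrt (D l ^ 3)))\<^sup>2)"
        by (rule Cauchy_Schwarz_ineq_sum)
      also have "(\<Sum>l\<in>F. (rt l * x l)\<^sup>2) = (\<Sum>l\<in>F. freq l * (x l)\<^sup>2)"
        by (simp add: power_mult_distrib rt_square)
      also have "\<dots> \<le> L\<^sup>2" by (rule energy[OF F F0])
      also have "(\<Sum>l\<in>F. (1 / (rt l * sqrt (D l ^ 3)))\<^sup>2) = (\<Sum>l\<in>F. 1 / (freq l * D l ^ 3))"
        using D0 by (simp add: power_mult_distrib rt_square power_divide less_imp_le)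
      also have "\<dots> \<le> 432 / R" unfolding D_def by (rule lattice_sum[OF R F F0])
      \<comment> \<open>432/R = 864/|k|, and 864 is below 30^2. The two halves of the convolution
        then make 60.\<close>
      also have "432 / R \<le> (30 / rt k)\<^sup>2" by (simp add: R_def power_divide rt_square divide_right_mono)
      also have "L\<^sup>2 * (30 / rt k)\<^sup>2 = (L * (30 / rt k))\<^sup>2" by (simp only: power_mult_distrib)
      finally show "(\<Sum>l\<in>F. (rt l * x l) * (1 / (rt l * sqrt (D l ^ 3))))\<^sup>2 \<le> (L * (30 / rt k))\<^sup>2"
        using D0 by (auto simp: mult_left_mono mult_right_mono sum_nonneg less_imp_le)
    qed (use L in simp)
    finally show "(\<Sum>l\<in>F. x l * x (k - l)) \<le> c * (L * (30 / rt k))"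
      using c0 by (simp add: mult_left_mono)
  qed
  then show ?thesis by (simp add: c_def mult_ac)
qed

text \<open>Each term is multiplied by \<open>rt l * rt (k - l)\<close>, at least R, and split by
  2ab <= a^2 + b^2. Both sums are energies, the second after l -> k - l. Since no decay of x enters,
  the estimate can start the iteration and also control the tails of the nonlinearity.\<close>

lemma convolution_energy:
  fixes x :: "int^3 \<Rightarrow> real"
  assumes x: "\<And>j. x j \<ge> 0" and R: "R > 0"
    and energy: "\<And>F. finite F \<Longrightarrow> 0 \<notin> F \<Longrightarrow> (\<Sum>j\<in>F. freq j * (x j)\<^sup>2) \<le> L\<^sup>2"
    and F: "finite F" "0 \<notin> F" "k \<notin> F" and far: "\<And>l. l \<in> F \<Longrightarrow> R \<le> rt l * rt (k - l)"
  shows "(\<Sum>l\<in>F. x l * x (k - l)) \<le> L\<^sup>2 / R"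
proof -
  have e1: "(\<Sum>l\<in>F. freq l * (x l)\<^sup>2) \<le> L\<^sup>2" using energy F by blast
  have "(\<Sum>l\<in>F. freq (k - l) * (x (k - l))\<^sup>2) = (\<Sum>l\<in>(\<lambda>l. k - l) ` F. freq l * (x l)\<^sup>2)"
    by (subst sum.reindex) (auto simp: inj_on_def)
  also have "\<dots> \<le> L\<^sup>2" by (rule energy) (use F in auto)
  finally have e2: "(\<Sum>l\<in>F. freq (k - l) * (x (k - l))\<^sup>2) \<le> L\<^sup>2" .
  have "(\<Sum>l\<in>F. x l * x (k - l)) \<le> (\<Sum>l\<in>F. (freq l * (x l)\<^sup>2 + freq (k - l) * (x (k - l))\<^sup>2) / (2 * R))"
  proof (rule sum_mono)
    fix l assume "l \<in> F"
    then have "R * (x l * x (k - l)) \<le> (rt l * rt (k - l)) * (x l * x (k - l))"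
      using far x by (intro mult_right_mono) auto
    moreover have "2 * (rt l * x l) * (rt (k - l) * x (k - l)) \<le> (rt l * x l)\<^sup>2 + (rt (k - l) * x (k - l))\<^sup>2"
      by (rule sum_squares_bound)
    ultimately have "x l * x (k - l) * (2 * R) \<le> freq l * (x l)\<^sup>2 + freq (k - l) * (x (k - l))\<^sup>2"
      unfolding power_mult_distrib rt_square by (simp add: mult_ac del: ivec_simps)
    then show "x l * x (k - l) \<le> (freq l * (x l)\<^sup>2 + freq (k - l) * (x (k - l))\<^sup>2) / (2 * R)"
      using R by (simp add: pos_le_divide_eq del: ivec_simps)
  qed
  also have "\<dots> = ((\<Sum>l\<in>F. freq l * (x l)\<^sup>2) + (\<Sum>l\<in>F. freq (k - l) * (x (k - l))\<^sup>2)) / (2 * R)"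
    by (simp add: sum_divide_distrib sum.distrib add_divide_distrib del: ivec_simps)
  also have "\<dots> \<le> (L\<^sup>2 + L\<^sup>2) / (2 * R)" using e1 e2 R by (intro divide_right_mono add_mono) auto
  also have "\<dots> = L\<^sup>2 / R" by simp
  finally show ?thesis .
qed

text \<open>Both frequencies are at least 1, so |k| <= |l| + |k-l| <= 2 |l| |k-l|.\<close>

lemma rt_le_product:
  assumes "l \<noteq> 0" "l \<noteq> k"
  shows "rt k / 2 \<le> rt l * rt (k - l)"
proof -
  have n: "freq l \<ge> 1" "freq (k - l) \<ge> 1"
    by (rule freq_ge_1, use assms in simp)+
  have "freq k \<le> freq l * freq (k - l) + freq l * freq (k - l)"
    using freq_triangle[of k l] mult_left_mono[OF n(2), of "freq l"] mult_right_mono[OF n(1), of "freq (k - l)"] n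
    by linarith
  moreover have "0 \<le> freq l * freq (k - l)" by simp
  ultimately have "rt k \<le> sqrt (4 * (freq l * freq (k - l)))"
    unfolding rt_def by (intro real_sqrt_le_mono) linarith
  then show ?thesis by (simp add: rt_def real_sqrt_mult)
qed

section \<open>Decay from the energy and Duhamel inequalities\<close>

lemma open_times_mono: "t \<in> open_times T \<Longrightarrow> 0 < s \<Longrightarrow> s \<le> t \<Longrightarrow> s \<in> open_times T"
  unfolding open_times_def using le_less_trans[of "ereal s" "ereal t" T] by simp

lemma exp_minus_le_inverse: "x > 0 \<Longrightarrow> exp (- x) \<le> 1 / (x::real)"
  using exp_ge_add_one_self[of x] by (simp add: exp_minus field_simps del: exp_ge_add_one_self)

lemma exp_minus_le_inverse_square: "x > 0 \<Longrightarrow> exp (- x) \<le> 2 / (x::real)\<^sup>2"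
  using exp_lower_Taylor_quadratic[of x] by (simp add: exp_minus field_simps)

text \<open>Only the norms of the modes are kept. The Duhamel inequality asks for a bound M on all
  finite partial convolutions, so no infinite sum occurs; l = 0 and l = k are left out because the
  mean contributes no growth. The constants 3 and 9 come from summing over three components.\<close>

locale lattice_flow =
  fixes a :: "int^3 \<Rightarrow> real \<Rightarrow> real" and T :: ereal and L :: real
  assumes nonneg: "a k t \<ge> 0" and L_nonneg: "L \<ge> 0"
    and energy: "t \<in> open_times T \<Longrightarrow> finite F \<Longrightarrow> 0 \<notin> F \<Longrightarrow> (\<Sum>j\<in>F. freq j * (a j t)\<^sup>2) \<le> L\<^sup>2"
    and duhamel: "k \<noteq> 0 \<Longrightarrow> 0 < s \<Longrightarrow> s < t \<Longrightarrow> t \<in> open_times T \<Longrightarrow>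
      (\<And>\<tau> F. s \<le> \<tau> \<Longrightarrow> \<tau> \<le> t \<Longrightarrow> finite F \<Longrightarrow> 0 \<notin> F \<Longrightarrow> k \<notin> F \<Longrightarrow> (\<Sum>l\<in>F. a l \<tau> * a (k - l) \<tau>) \<le> M) \<Longrightarrow>
      a k t \<le> 3 * exp (- (freq k)\<^sup>2 * (t - s)) * a k s + 9 * M / freq k"
begin

lemma le_energy:
  assumes "t \<in> open_times T" "k \<noteq> 0"
  shows "a k t \<le> L / rt k"
proof -
  have "(rt k * a k t)\<^sup>2 \<le> L\<^sup>2"
    using energy[OF assms(1), of "{k}"] assms(2) by (simp add: power_mult_distrib rt_square)
  then have "rt k * a k t \<le> L" using L_nonneg power2_le_imp_le by blast
  then show ?thesis using rt_ge_1[OF assms(2)] by (simp add: field_simps)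
qed

lemma heat_bound:
  assumes t: "t \<in> open_times T" and k: "k \<noteq> 0" and s: "0 < s" "s < t" and M: "M \<ge> 0"
    and conv: "\<And>\<tau> F. \<tau> \<in> open_times T \<Longrightarrow> s \<le> \<tau> \<Longrightarrow> finite F \<Longrightarrow> 0 \<notin> F \<Longrightarrow> k \<notin> F \<Longrightarrow>
      (\<Sum>l\<in>F. a l \<tau> * a (k - l) \<tau>) \<le> M"
  shows "a k t \<le> 3 * exp (- (rt k ^ 4 * (t - s))) * a k s + 9 * M / rt k ^ 2"
proof -
  have "rt k ^ 4 = (freq k)\<^sup>2" by (simp flip: rt_square)
  then have e: "- (rt k ^ 4 * (t - s)) = - (freq k)\<^sup>2 * (t - s)" by simp
  show ?thesis unfolding e rt_square
  proof (rule duhamel[OF k s t])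
    fix \<tau> F assume "s \<le> \<tau>" "\<tau> \<le> t" "finite F" "0 \<notin> F" "k \<notin> F"
    then show "(\<Sum>l\<in>F. a l \<tau> * a (k - l) \<tau>) \<le> M"
      using conv open_times_mono[OF t, of \<tau>] s by auto
  qed
qed

text \<open>With the energy alone the convolution is at most 2 L^2 |k|^{-1/2}, so the forcing term
  decays like |k|^{-3/2}. The heat factor is estimated by exp(-x) <= 1/x, which gives more decay
  than is kept.\<close>

lemma first_decay:
  assumes t: "t \<in> open_times T" and k: "k \<noteq> 0" and s: "0 < s" "s < t"
  shows "a k t \<le> (3 * L / (t - s) + 18 * L\<^sup>2) / rt k ^ 3"
proof -
  have r: "rt k \<ge> 1" by (rule rt_ge_1[OF k])
  have r0: "rt k > 0" using r by simp
  have "a k t \<le> 3 * exp (- (rt k ^ 4 * (t - s))) * a k s + 9 * (L\<^sup>2 / (rt k / 2)) / rt k ^ 2"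
  proof (rule heat_bound[OF t k s])
    fix \<tau> F assume \<tau>: "\<tau> \<in> open_times T" and F: "finite F" "0 \<notin> F" "k \<notin> F"
    show "(\<Sum>l\<in>F. a l \<tau> * a (k - l) \<tau>) \<le> L\<^sup>2 / (rt k / 2)"
    proof (rule convolution_energy[of "\<lambda>l. a l \<tau>", OF nonneg _ energy[OF \<tau>] F])
      show "rt k / 2 \<le> rt l * rt (k - l)" if "l \<in> F" for l
        by (rule rt_le_product) (use that F in auto)
    qed (use r0 in auto)
  qed (use r0 in simp)
  also have "3 * exp (- (rt k ^ 4 * (t - s))) * a k s \<le> 3 * (1 / (rt k ^ 4 * (t - s))) * (L / rt k)"
    using exp_minus_le_inverse[of "rt k ^ 4 * (t - s)"] le_energy[OF open_times_mono[OF t, of s] k] s r0 nonneg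
    by (intro mult_mono) auto
  also have "\<dots> = 3 * L / (t - s) / rt k ^ 5" using r0 by (simp add: field_simps eval_nat_numeral)
  also have "\<dots> \<le> 3 * L / (t - s) / rt k ^ 3"
    using r L_nonneg s by (intro divide_left_mono power_increasing) auto
  also have "9 * (L\<^sup>2 / (rt k / 2)) / rt k ^ 2 = 18 * L\<^sup>2 / rt k ^ 3"
    by (simp add: eval_nat_numeral)
  finally show ?thesis by (simp add: add_divide_distrib)
qed

text \<open>The value at time s is at most L |k|^{-1/2}, and exp(-x) <= 2/x^2 turns it into
  |k|^{-9/2}. The forcing keeps the two-term shape because \<open>convolution_bound\<close> does;
  540 = 9 * 60 and 4320 = 8 * 540.\<close>

lemma decay_step:
  assumes PQ: "P \<ge> 0" "Q \<ge> 0" and s: "0 < s" "s < t" and t: "t \<in> open_times T" and k: "k \<noteq> 0"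
    and bound: "\<And>\<tau> j. \<tau> \<in> open_times T \<Longrightarrow> s \<le> \<tau> \<Longrightarrow> j \<noteq> 0 \<Longrightarrow> a j \<tau> \<le> (P / rt j ^ 6 + Q) / rt j ^ 3"
  shows "a k t \<le> ((6 * L / (t - s)\<^sup>2 + 4320 * L * P) / rt k ^ 6 + 540 * L * Q) / rt k ^ 3"
proof -
  have r: "rt k \<ge> 1" by (rule rt_ge_1[OF k])
  have r0: "rt k > 0" using r by simp
  have "a k t \<le> 3 * exp (- (rt k ^ 4 * (t - s))) * a k s + 9 * (60 * L * (8 * P / rt k ^ 6 + Q) / rt k) / rt k ^ 2"
  proof (rule heat_bound[OF t k s])
    fix \<tau> F assume "\<tau> \<in> open_times T" "s \<le> \<tau>" "finite F" "0 \<notin> F" "k \<notin> F"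
    then show "(\<Sum>l\<in>F. a l \<tau> * a (k - l) \<tau>) \<le> 60 * L * (8 * P / rt k ^ 6 + Q) / rt k"
      using convolution_bound[of "\<lambda>l. a l \<tau>" L k P Q F] nonneg L_nonneg k PQ energy bound by blast
  qed (use r0 PQ L_nonneg in simp)
  also have "3 * exp (- (rt k ^ 4 * (t - s))) * a k s \<le> 3 * (2 / (rt k ^ 4 * (t - s))\<^sup>2) * (L / rt k)"
  proof (intro mult_mono)
    have "0 < rt k ^ 4 * (t - s)" using s r0 by simp
    then show "exp (- (rt k ^ 4 * (t - s))) \<le> 2 / (rt k ^ 4 * (t - s))\<^sup>2" by (rule exp_minus_le_inverse_square)
    show "a k s \<le> L / rt k" using le_energy[OF open_times_mono[OF t, of s] k] s by simp
  qed (use nonneg in auto)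
  also have "\<dots> = 6 * L / (t - s)\<^sup>2 / rt k ^ 6 / rt k ^ 3" by (simp add: power_mult_distrib eval_nat_numeral)
  also have "9 * (60 * L * (8 * P / rt k ^ 6 + Q) / rt k) / rt k ^ 2 = (540 * L * (8 * P / rt k ^ 6 + Q)) / rt k ^ 3"
    by (simp add: power3_eq_cube power2_eq_square)
  also have "540 * L * (8 * P / rt k ^ 6 + Q) = 4320 * L * P / rt k ^ 6 + 540 * L * Q"
    by (simp add: distrib_left)
  finally show ?thesis by (simp add: add_divide_distrib)
qed

text \<open>
  The step passes from \<open>\<tau>/2\<close> to \<open>\<tau>\<close>, which multiplies \<open>\<tau>\<^sup>-\<^sup>2\<close> only by 4, so the coefficient \<open>48 L\<close>
  is preserved while the other term is halved.
\<close>

lemma decay_iterate: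
  assumes L: "L \<le> 1 / 40000" and t0: "0 < t0"
    and base: "\<And>t k. t \<in> open_times T \<Longrightarrow> t0 \<le> t \<Longrightarrow> k \<noteq> 0 \<Longrightarrow> a k t \<le> Q / rt k ^ 3"
    and Q: "Q \<ge> 0"
  shows "\<tau> > 0 \<Longrightarrow> t \<in> open_times T \<Longrightarrow> t0 + \<tau> \<le> t \<Longrightarrow> k \<noteq> 0 \<Longrightarrow>
    a k t \<le> (48 * L / \<tau>\<^sup>2 / rt k ^ 6 + Q / 2 ^ n) / rt k ^ 3"
proof (induction n arbitrary: \<tau> t k)
  case 0
  have "a k t \<le> Q / rt k ^ 3" using base 0 by auto
  also have "\<dots> \<le> (48 * L / \<tau>\<^sup>2 / rt k ^ 6 + Q) / rt k ^ 3"
    using L_nonneg by (intro divide_right_mono) auto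
  finally show ?case by simp
next
  case (Suc n)
  have "a k t \<le> ((6 * L / (t - (t - \<tau> / 2))\<^sup>2 + 4320 * L * (48 * L / (\<tau> / 2)\<^sup>2)) / rt k ^ 6
      + 540 * L * (Q / 2 ^ n)) / rt k ^ 3"
  proof (rule decay_step)
    fix \<sigma> :: real and j :: "int^3" assume "\<sigma> \<in> open_times T" "t - \<tau> / 2 \<le> \<sigma>" "j \<noteq> 0"
    then show "a j \<sigma> \<le> (48 * L / (\<tau> / 2)\<^sup>2 / rt j ^ 6 + Q / 2 ^ n) / rt j ^ 3"
      by (intro Suc.IH) (use Suc.prems in auto)
  qed (use Suc.prems t0 Q L_nonneg in auto)
  also have "\<dots> \<le> (48 * L / \<tau>\<^sup>2 / rt k ^ 6 + Q / 2 ^ Suc n) / rt k ^ 3"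
  proof (intro divide_right_mono add_mono)
    \<comment> \<open>The threshold for L is fixed here. Replacing \<tau> by \<tau>/2 costs a factor
      4, so 6 becomes 24 and 4320 * 48 becomes 829440, and 829440/40000 is below 24. The other term
      only asks for 540 L <= 1/2.\<close>
    have "6 * L / (t - (t - \<tau> / 2))\<^sup>2 + 4320 * L * (48 * L / (\<tau> / 2)\<^sup>2) = (24 + 829440 * L) * L / \<tau>\<^sup>2"
      using Suc.prems by (simp add: field_simps power2_eq_square)
    also have "\<dots> \<le> 48 * L / \<tau>\<^sup>2"
      using L L_nonneg by (intro divide_right_mono mult_right_mono) auto
    finally show "6 * L / (t - (t - \<tau> / 2))\<^sup>2 + 4320 * L * (48 * L / (\<tau> / 2)\<^sup>2) \<le> 48 * L / \<tau>\<^sup>2" .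
    have "540 * L * Q \<le> 1 / 2 * Q" using L Q by (intro mult_right_mono) auto
    then show "540 * L * (Q / 2 ^ n) \<le> Q / 2 ^ Suc n" by (simp add: field_simps)
  qed auto
  finally show ?case .
qed

text \<open>The base bound holds from time t/2 on, using the preceding interval of length t/4; the
  remaining t/2 is the waiting time of the iteration. In the limit of infinitely many iterations Q
  leaves no trace, and 192 = 4 * 48.\<close>

theorem decay:
  assumes L: "L \<le> 1 / 40000" and t: "t \<in> open_times T" and k: "k \<noteq> 0"
  shows "a k t \<le> 192 * L / t\<^sup>2 / rt k ^ 9"
proof -
  have t0: "t > 0" using t by (simp add: open_times_def)
  have r: "rt k \<ge> 1" by (rule rt_ge_1[OF k])
  define Q where "Q = 3 * L / (t / 4) + 18 * L\<^sup>2"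
  have Q: "Q \<ge> 0" using L_nonneg t0 by (simp add: Q_def)
  have base: "a j s \<le> Q / rt j ^ 3" if s: "s \<in> open_times T" "t / 2 \<le> s" and j: "j \<noteq> 0" for s j
  proof -
    have "a j s \<le> (3 * L / (s - (s - t / 4)) + 18 * L\<^sup>2) / rt j ^ 3"
      by (rule first_decay) (use s j t0 in auto)
    then show ?thesis by (simp add: Q_def)
  qed
  have "t / 2 > 0" "t / 2 + t / 2 \<le> t" using t0 by auto
  then have "a k t \<le> (48 * L / (t / 2)\<^sup>2 / rt k ^ 6 + Q / 2 ^ n) / rt k ^ 3" for n
    using decay_iterate[of "t / 2" Q "t / 2" t k n] L base Q t k by blast
  then have *: "\<forall>\<^sub>F n in sequentially. a k t \<le> (48 * L / (t / 2)\<^sup>2 / rt k ^ 6 + Q * (1 / 2) ^ n) / rt k ^ 3"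
    by (simp add: power_divide)
  have "(\<lambda>n. (48 * L / (t / 2)\<^sup>2 / rt k ^ 6 + Q * (1 / 2) ^ n) / rt k ^ 3)
      \<longlonglongrightarrow> (48 * L / (t / 2)\<^sup>2 / rt k ^ 6 + Q * 0) / rt k ^ 3"
    using r by (intro tendsto_intros LIMSEQ_power_zero) auto
  from tendsto_lowerbound[OF this *] have "a k t \<le> 48 * L / (t / 2)\<^sup>2 / rt k ^ 6 / rt k ^ 3" by simp
  also have "\<dots> = 192 * L / t\<^sup>2 / rt k ^ 9" using t0 r by (simp add: field_simps eval_nat_numeral)
  finally show ?thesis .
qed

text \<open>The factor of higher frequency, at least |k|/2, takes the bound with exponent p; the
  other is summed absolutely, as |l|^{-4} is summable in three dimensions. Division by |k| in the
  Duhamel inequality is the gain of one power, and 7776 = 9 * 2 * 432. The heat term gains two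
  powers, one of which is given away.\<close>

lemma rapid_decay_step:
  assumes B: "B \<ge> 0" and s: "0 < s" "s < t" and t: "t \<in> open_times T" and k: "k \<noteq> 0" and C: "C \<ge> 0"
    and bound: "\<And>\<tau> j. \<tau> \<in> open_times T \<Longrightarrow> s \<le> \<tau> \<Longrightarrow> j \<noteq> 0 \<Longrightarrow> a j \<tau> \<le> B / freq j ^ p"
    and bound4: "\<And>\<tau> j. \<tau> \<in> open_times T \<Longrightarrow> s \<le> \<tau> \<Longrightarrow> j \<noteq> 0 \<Longrightarrow> a j \<tau> \<le> C / freq j ^ 4"
  shows "a k t \<le> (3 / (t - s) + 7776 * 2 ^ p * C) * B / freq k ^ Suc p"
proof -
  have n: "freq k \<ge> 1" by (rule freq_ge_1[OF k])
  define n' where "n' = freq k"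
  have n': "n' \<ge> 1" "n' > 0" using n by (auto simp: n'_def)
  let ?M = "2 * (B * (2 / n') ^ p * (C * 432))"
  have "a k t \<le> 3 * exp (- (rt k ^ 4 * (t - s))) * a k s + 9 * ?M / rt k ^ 2"
  proof (rule heat_bound[OF t k s])
    show "0 \<le> ?M" using B C n' by simp
    fix \<tau> F assume \<tau>: "\<tau> \<in> open_times T" "s \<le> \<tau>" and F: "finite F" "0 \<notin> F" "k \<notin> F"
    show "(\<Sum>l\<in>F. a l \<tau> * a (k - l) \<tau>) \<le> ?M"
    proof (rule convolution_split[OF _ F])
      fix F assume F: "finite F" and FF: "\<And>l. l \<in> F \<Longrightarrow> l \<noteq> 0 \<and> l \<noteq> k \<and> freq l \<le> freq (k - l)"
      have F0: "0 \<notin> F" using FF by blast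
      have "(\<Sum>l\<in>F. a l \<tau> * a (k - l) \<tau>) \<le> (\<Sum>l\<in>F. (C / freq l ^ 4) * (B * (2 / n') ^ p))"
      proof (intro sum_mono mult_mono)
        fix l assume l: "l \<in> F"
        show "a l \<tau> \<le> C / freq l ^ 4" using bound4[OF \<tau>] FF[OF l] by blast
        have h: "n' / 2 \<le> freq (k - l)"
          using freq_triangle[of k l] FF[OF l] by (simp add: n'_def del: ivec_simps)
        have "k - l \<noteq> 0" using FF[OF l] by auto
        then have "a (k - l) \<tau> \<le> B / freq (k - l) ^ p" using bound[OF \<tau>] by blast
        also have "\<dots> \<le> B / (n' / 2) ^ p" using h n' B by (intro divide_left_mono power_mono mult_pos_pos zero_less_power) auto
        also have "\<dots> = B * (2 / n') ^ p" by (simp add: power_divide)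
        finally show "a (k - l) \<tau> \<le> B * (2 / n') ^ p" .
      qed (use C nonneg in auto)
      also have "\<dots> = B * (2 / n') ^ p * (C * (\<Sum>l\<in>F. 1 / freq l ^ 4))"
        by (simp add: sum_distrib_left mult_ac)
      also have "(\<Sum>l\<in>F. 1 / freq l ^ 4) = (\<Sum>j\<in>F. 1 / (freq j * max (freq j) 1 ^ 3))"
        using FF freq_ge_1 by (intro sum.cong refl) (simp add: max_absorb1 eval_nat_numeral)
      also have "\<dots> \<le> 432" using lattice_sum[OF _ F F0, of 1] by simp
      finally show "(\<Sum>l\<in>F. a l \<tau> * a (k - l) \<tau>) \<le> B * (2 / n') ^ p * (C * 432)"
        using B C n' by (simp add: mult_left_mono)
    qed
  qed
  also have "3 * exp (- (rt k ^ 4 * (t - s))) * a k s \<le> 3 * (1 / (n' ^ 2 * (t - s))) * (B / n' ^ p)"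
  proof (intro mult_mono)
    have "rt k ^ 4 = n' ^ 2" unfolding n'_def by (simp flip: rt_square)
    then show "exp (- (rt k ^ 4 * (t - s))) \<le> 1 / (n' ^ 2 * (t - s))"
      using exp_minus_le_inverse[of "rt k ^ 4 * (t - s)"] s n' by simp
    show "a k s \<le> B / n' ^ p" unfolding n'_def by (rule bound) (use open_times_mono[OF t] s k in auto)
  qed (use s nonneg in auto)
  also have "\<dots> = 3 / (t - s) * B / n' ^ Suc p * (1 / n')" using n' s by (simp add: field_simps power2_eq_square)
  also have "\<dots> \<le> 3 / (t - s) * B / n' ^ Suc p" using n' s B by (intro mult_left_le) auto
  also have "9 * ?M / rt k ^ 2 = 7776 * 2 ^ p * C * B / n' ^ Suc p"
    using n' by (simp add: rt_square n'_def[symmetric] power_divide field_simps)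
  finally show ?thesis by (simp add: n'_def add_divide_distrib ring_distribs)
qed

text \<open>Each step needs its hypothesis on an earlier time interval, so the induction ranges over
  all \<rho> and passes from \<rho>/2 to \<rho>. It starts at 4, the first integer exponent summable
  over the lattice, by weakening 9/2.\<close>

theorem rapid_decay:
  assumes L: "L \<le> 1 / 40000" and \<rho>: "\<rho> > 0"
  shows "\<exists>B\<ge>0. \<forall>t\<in>open_times T. \<rho> \<le> t \<longrightarrow> (\<forall>k. k \<noteq> 0 \<longrightarrow> a k t \<le> B / freq k ^ (4 + p))"
  using \<rho>
proof (induction p arbitrary: \<rho>)
  case 0
  have "a k t \<le> 192 * L / \<rho>\<^sup>2 / freq k ^ 4" if "t \<in> open_times T" "\<rho> \<le> t" "k \<noteq> 0" for t k
  proof -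
    have r: "rt k \<ge> 1" by (rule rt_ge_1[OF that(3)])
    have "a k t \<le> 192 * L / t\<^sup>2 / rt k ^ 9" by (rule decay[OF L that(1,3)])
    also have "\<dots> \<le> 192 * L / \<rho>\<^sup>2 / rt k ^ 8"
      using 0 that r L_nonneg by (intro frac_le power_mono power_increasing) (auto intro!: divide_left_mono power_mono)
    also have "rt k ^ 8 = freq k ^ 4" by (simp flip: rt_square)
    finally show ?thesis .
  qed
  then show ?case using 0 L_nonneg by (intro exI[of _ "192 * L / \<rho>\<^sup>2"]) auto
next
  case (Suc p)
  then have "\<rho> / 2 > 0" by simp
  from Suc.IH[OF this] obtain B where B0: "B \<ge> 0"
    and B1: "\<forall>t\<in>open_times T. \<rho> / 2 \<le> t \<longrightarrow> (\<forall>k. k \<noteq> 0 \<longrightarrow> a k t \<le> B / freq k ^ (4 + p))"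
    by (elim exE conjE)
  have B: "B \<ge> 0" "\<And>t k. t \<in> open_times T \<Longrightarrow> \<rho> / 2 \<le> t \<Longrightarrow> k \<noteq> 0 \<Longrightarrow> a k t \<le> B / freq k ^ (4 + p)"
    using B0 B1 by auto
  have B4: "a k t \<le> B / freq k ^ 4" if "t \<in> open_times T" "\<rho> / 2 \<le> t" "k \<noteq> 0" for t k
  proof -
    have n: "freq k \<ge> 1" by (rule freq_ge_1[OF that(3)])
    have "a k t \<le> B / freq k ^ (4 + p)" by (rule B(2)[OF that])
    also have "\<dots> \<le> B / freq k ^ 4" using n B(1)
      by (intro divide_left_mono power_increasing mult_pos_pos zero_less_power) auto
    finally show ?thesis .
  qed
  have "a k t \<le> (3 / (\<rho> / 2) + 7776 * 2 ^ (4 + p) * B) * B / freq k ^ (4 + Suc p)"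
    if "t \<in> open_times T" "\<rho> \<le> t" "k \<noteq> 0" for t k
  proof -
    have "a k t \<le> (3 / (t - (t - \<rho> / 2)) + 7776 * 2 ^ (4 + p) * B) * B / freq k ^ Suc (4 + p)"
      by (rule rapid_decay_step) (use that Suc.prems B B4 in auto)
    then show ?thesis by simp
  qed
  then show ?case using B Suc.prems
    by (intro exI[of _ "(3 / (\<rho> / 2) + 7776 * 2 ^ (4 + p) * B) * B"]) auto
qed

end

section \<open>Fourier coefficients of square-integrable functions\<close>

definition ee :: "int^3 \<Rightarrow> real^3 \<Rightarrow> complex" where
  "ee k x = exp (2 * complex_of_real pi * \<i> * complex_of_real (x \<bullet> ivec k))"

definition coef :: "(real^3 \<Rightarrow> complex) \<Rightarrow> int^3 \<Rightarrow> complex" where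
  "coef f k = (LINT x|torus. f x * ee (- k) x)"

definition sqint :: "(real^3 \<Rightarrow> complex) \<Rightarrow> bool" where
  "sqint f \<longleftrightarrow> f \<in> borel_measurable torus \<and> integrable torus (\<lambda>x. (norm (f x))\<^sup>2)"

lemma ee_add: "ee (k + l) x = ee k x * ee l x"
  by (simp add: ee_def inner_add_right distrib_left exp_add)

lemma ee_0 [simp]: "ee 0 x = 1"
  by (simp add: ee_def)

lemma norm_ee [simp]: "norm (ee k x) = 1"
  by (simp add: ee_def)

lemma ee_minus: "ee (- k) x = cnj (ee k x)"
  by (simp add: ee_def exp_cnj)

lemma ee_cis: "ee k x = cis (2 * pi * (x \<bullet> ivec k))"
  by (simp add: ee_def cis_conv_exp mult_ac)

lemma continuous_ee [continuous_intros]: "continuous_on S (ee k)"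
  unfolding ee_def by (intro continuous_intros)

lemma fourier_eq_coef: "fourier w k $ j = coef (\<lambda>x. of_real (w x $ j)) k"
  by (simp add: fourier_def coef_def ee_def)

lemma space_torus [simp]: "space torus = cbox 0 1"
  by (simp add: torus_def)

lemma emeasure_torus_space: "emeasure torus (cbox 0 1) = 1"
proof -
  have B: "(1::real^3) \<bullet> b = 1" if "b \<in> Basis" for b
    using that by (auto simp: Basis_vec_def inner_axis)
  have "emeasure lborel (cbox 0 (1::real^3)) = 1"
    by (subst emeasure_lborel_cbox) (simp_all add: B)
  then show ?thesis unfolding torus_def by (subst emeasure_restrict_space) auto
qed

lemma finite_measure_torus: "finite_measure torus"
  by (rule finite_measureI) (simp add: emeasure_torus_space)

interpretation torus: finite_measure torus
  by (rule finite_measure_torus)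

lemma continuous_imp_measurable_torus: "continuous_on UNIV f \<Longrightarrow> f \<in> borel_measurable torus"
  unfolding torus_def
  by (rule continuous_imp_measurable_on_sets_lebesgue[OF continuous_on_subset[OF _ subset_UNIV]]) simp_all

lemma measurable_ee [measurable]: "ee k \<in> borel_measurable torus"
  by (intro continuous_imp_measurable_torus continuous_intros)

text \<open>\<open>lborel\<close> on real^3 is the image of the product measure indexed by the basis
  vectors, so the integral factorizes. The indicator of the cube is distributed over the factors,
  and \<open>ix\<close> recovers a coordinate index from its basis vector.\<close>

lemma box_integral_prod:
  fixes h :: "3 \<Rightarrow> real \<Rightarrow> complex"
  assumes h: "\<And>i. continuous_on UNIV (h i)"
  shows "(LINT x|torus. (\<Prod>i\<in>UNIV. h i (x $ i))) = (\<Prod>i\<in>UNIV. LINT s:{0..1}|lborel. h i s)"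
proof -
  interpret P: product_sigma_finite "\<lambda>_::real^3. lborel :: real measure" ..
  define ix :: "real^3 \<Rightarrow> 3" where "ix b = (SOME i. b = axis i 1)" for b
  have ix: "ix (axis i 1) = i" for i by (simp add: ix_def axis_eq_axis)
  define H where "H b s = indicator {0..1} s *\<^sub>R h (ix b) s" for b :: "real^3" and s
  have hm [measurable]: "h i \<in> borel_measurable borel" for i
    using h by (intro borel_measurable_continuous_onI)
  have int: "integrable lborel (H b)" for b
    unfolding H_def by (rule borel_integrable_compact) (auto intro: continuous_on_subset[OF h])
  have Basis: "(Basis :: (real^3) set) = (\<lambda>i. axis i 1) ` UNIV" by (auto simp: Basis_vec_def)
  have inj: "inj (\<lambda>i::3. axis i (1::real))" by (auto simp: inj_on_def axis_eq_axis)
  have prodB: "(\<Prod>b\<in>Basis. f b) = (\<Prod>i\<in>UNIV. f (axis i 1))" for f :: "real^3 \<Rightarrow> complex"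
    unfolding Basis by (subst prod.reindex) (use inj in auto)
  have eq: "indicator (cbox 0 1) x *\<^sub>R (\<Prod>i\<in>UNIV. h i (x $ i)) = (\<Prod>b\<in>Basis. H b (x \<bullet> b))" for x :: "real^3"
  proof (cases "x \<in> cbox 0 1")
    case True
    then have "x $ i \<in> {0..1}" for i by (auto simp: mem_box_cart)
    then show ?thesis using True by (simp add: prodB H_def ix inner_axis)
  next
    case False
    then obtain i where "x $ i \<notin> {0..1}" by (auto simp: mem_box_cart)
    then have "\<exists>i. H (axis i 1) (x \<bullet> axis i 1) = 0" by (intro exI[of _ i]) (auto simp: H_def inner_axis)
    then show ?thesis using False by (simp add: prodB)
  qed
  have "(LINT x|torus. (\<Prod>i\<in>UNIV. h i (x $ i))) = (LINT x|lebesgue. indicator (cbox 0 1) x *\<^sub>R (\<Prod>i\<in>UNIV. h i (x $ i)))"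
    unfolding torus_def by (subst integral_restrict_space) auto
  also have "\<dots> = (LINT x|lborel. indicator (cbox 0 1) x *\<^sub>R (\<Prod>i\<in>UNIV. h i (x $ i)))"
    by (rule integral_completion) measurable
  also have "\<dots> = (LINT x|lborel. (\<Prod>b\<in>Basis. H b (x \<bullet> b)))" by (simp only: eq)
  also have "\<dots> = (LINT f|(\<Pi>\<^sub>M b\<in>Basis. lborel). (\<Prod>b\<in>Basis. H b ((\<Sum>b\<in>Basis. f b *\<^sub>R b) \<bullet> b)))"
    by (subst lborel_eq, subst integral_distr) (auto simp: H_def)
  also have "\<dots> = (LINT f|(\<Pi>\<^sub>M b\<in>Basis. lborel). (\<Prod>b\<in>(Basis::(real^3) set). H b (f b)))"
    by (simp add: inner_sum_left_Basis)
  also have "\<dots> = (\<Prod>b\<in>Basis. integral\<^sup>L lborel (H b))"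
    by (rule P.product_integral_prod) (use int in auto)
  also have "\<dots> = (\<Prod>i\<in>UNIV. LINT s:{0..1}|lborel. h i s)"
    by (simp add: prodB H_def[abs_def] ix set_lebesgue_integral_def)
  finally show ?thesis .
qed

text \<open>The antiderivative exp(c s)/c takes the same value at 0 and at 1, since c is a nonzero
  integer multiple of 2 pi i.\<close>

lemma integral_cis_unit:
  assumes "n \<noteq> 0"
  shows "(LINT s:{0..1}|lborel. cis (2 * pi * (s * real_of_int n))) = 0"
proof -
  define c where "c = 2 * complex_of_real pi * \<i> * of_int n"
  have c: "c \<noteq> 0" "exp c = 1"
    using assms exp_integer_2pi[of "of_int n"] by (simp_all add: c_def mult_ac)
  have cis: "cis (2 * pi * (s * real_of_int n)) = exp (c * of_real s)" for s
    by (simp add: cis_conv_exp c_def mult_ac)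
  have "(LBINT s=ereal 0..ereal 1. exp (c * complex_of_real s)) = exp (c * of_real 1) / c - exp (c * of_real 0) / c"
  proof (rule interval_integral_FTC_finite)
    show "continuous_on {min 0 1..max 0 1} (\<lambda>s. exp (c * complex_of_real s))"
      by (intro continuous_intros)
    fix s :: real
    show "((\<lambda>s. exp (c * complex_of_real s) / c) has_vector_derivative exp (c * complex_of_real s))
        (at s within {min 0 1..max 0 1})"
      by (rule has_vector_derivative_real_field) (use c in \<open>auto intro!: derivative_eq_intros\<close>)
  qed
  then show ?thesis using c(2) by (simp add: cis interval_integral_Icc)
qed

lemma integral_ee: "(LINT x|torus. ee k x) = (if k = 0 then 1 else 0)"
proof (cases "k = 0")
  case True
  then show ?thesis using emeasure_torus_space by (simp add: measure_def)
next
  case False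
  then obtain j where j: "k $ j \<noteq> 0" by (auto simp: vec_eq_iff)
  have "ee k x = (\<Prod>i\<in>UNIV. cis (2 * pi * (x $ i * real_of_int (k $ i))))" for x
    by (simp add: ee_cis cis_conv_exp inner_vec_def sum_distrib_left flip: exp_sum)
  then have "(LINT x|torus. ee k x) = (\<Prod>i\<in>UNIV. LINT s:{0..1}|lborel. cis (2 * pi * (s * real_of_int (k $ i))))"
    by (simp only:) (rule box_integral_prod, intro continuous_intros)
  also have "\<dots> = 0" using integral_cis_unit[OF j] by (auto simp: prod_zero_iff)
  finally show ?thesis using False by simp
qed

section \<open>Closure properties of square-integrable scalar functions\<close>

lemma sqint_measurable: "sqint f \<Longrightarrow> f \<in> borel_measurable torus"
  by (simp add: sqint_def)

lemma sqint_integrable: "sqint f \<Longrightarrow> integrable torus (\<lambda>x. (norm (f x))\<^sup>2)"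
  by (simp add: sqint_def)

lemma sqint_mult:
  assumes "sqint f" "sqint g"
  shows "integrable torus (\<lambda>x. f x * g x)"
proof (rule Bochner_Integration.integrable_bound)
  show "integrable torus (\<lambda>x. (norm (f x))\<^sup>2 + (norm (g x))\<^sup>2)"
    using assms by (intro Bochner_Integration.integrable_add sqint_integrable)
  show "(\<lambda>x. f x * g x) \<in> borel_measurable torus"
    using assms[THEN sqint_measurable] by measurable
  show "AE x in torus. norm (f x * g x) \<le> norm ((norm (f x))\<^sup>2 + (norm (g x))\<^sup>2)"
  proof (rule AE_I2)
    fix x
    have "2 * (norm (f x) * norm (g x)) \<le> (norm (f x))\<^sup>2 + (norm (g x))\<^sup>2"
      using sum_squares_bound[of "norm (f x)" "norm (g x)"] by (simp add: mult.assoc)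
    moreover have "0 \<le> norm (f x) * norm (g x)" by simp
    ultimately show "norm (f x * g x) \<le> norm ((norm (f x))\<^sup>2 + (norm (g x))\<^sup>2)"
      unfolding norm_mult real_norm_def by linarith
  qed
qed

lemma norm_add_square_le: "(norm (a + b))\<^sup>2 \<le> 2 * (norm a)\<^sup>2 + 2 * (norm (b::complex))\<^sup>2"
proof -
  have "(norm (a + b))\<^sup>2 \<le> (norm a + norm b)\<^sup>2" by (intro power_mono norm_triangle_ineq) simp
  also have "\<dots> \<le> 2 * (norm a)\<^sup>2 + 2 * (norm b)\<^sup>2"
    using sum_squares_bound[of "norm a" "norm b"] by (simp add: power2_sum)
  finally show ?thesis .
qed

lemma sqint_add:
  assumes "sqint f" "sqint g"
  shows "sqint (\<lambda>x. f x + g x)"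
  unfolding sqint_def
proof
  show m: "(\<lambda>x. f x + g x) \<in> borel_measurable torus"
    using assms[THEN sqint_measurable] by measurable
  show "integrable torus (\<lambda>x. (norm (f x + g x))\<^sup>2)"
  proof (rule Bochner_Integration.integrable_bound)
    show "integrable torus (\<lambda>x. 2 * (norm (f x))\<^sup>2 + 2 * (norm (g x))\<^sup>2)"
      using assms by (intro Bochner_Integration.integrable_add integrable_mult_right sqint_integrable)
    show "(\<lambda>x. (norm (f x + g x))\<^sup>2) \<in> borel_measurable torus" using m by measurable
  qed (auto intro!: AE_I2 norm_add_square_le)
qed

lemma sqint_cmult: "sqint f \<Longrightarrow> sqint (\<lambda>x. c * f x)"
  using borel_measurable_times[of "\<lambda>_. c" torus f]
  by (simp add: sqint_def norm_mult power_mult_distrib)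

lemma sqint_minus: "sqint f \<Longrightarrow> sqint (\<lambda>x. - f x)"
  using sqint_cmult[of f "-1"] by simp

lemma sqint_diff: "sqint f \<Longrightarrow> sqint g \<Longrightarrow> sqint (\<lambda>x. f x - g x)"
  using sqint_add[of f "\<lambda>x. - g x"] sqint_minus by simp

lemma sqint_bounded:
  assumes "f \<in> borel_measurable torus" "\<And>x. x \<in> cbox 0 1 \<Longrightarrow> norm (f x) \<le> B"
  shows "sqint f"
  unfolding sqint_def
proof
  show "integrable torus (\<lambda>x. (norm (f x))\<^sup>2)"
  proof (rule torus.integrable_const_bound)
    show "AE x in torus. norm ((norm (f x))\<^sup>2) \<le> B\<^sup>2"
      by (rule AE_I2) (use assms(2) in \<open>auto intro!: power_mono\<close>)
    show "(\<lambda>x. (norm (f x))\<^sup>2) \<in> borel_measurable torus" using assms(1) by measurable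
  qed
qed (rule assms(1))

lemma sqint_ee: "sqint (ee k)"
  by (rule sqint_bounded[of _ 1]) simp_all

lemma sqint_sum: "(\<And>k. k \<in> F \<Longrightarrow> sqint (f k)) \<Longrightarrow> sqint (\<lambda>x. \<Sum>k\<in>F. f k x)"
proof (induction F rule: infinite_finite_induct)
  case (insert k F)
  then show ?case by (simp add: sqint_add)
qed (auto intro!: sqint_bounded[of _ 0])

lemma sqint_mult_bounded:
  assumes f: "sqint f" and g: "g \<in> borel_measurable torus" "\<And>x. norm (g x) = 1"
  shows "sqint (\<lambda>x. f x * g x)"
  using sqint_measurable[OF f] sqint_integrable[OF f] g by (simp add: sqint_def norm_mult)

section \<open>Density of trigonometric polynomials in L^2 of the cube\<close>

text \<open>Defined by generation, so that closure under products follows by rule induction; the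
  explicit finite sum is extracted only in \<open>trig_imp_sum\<close>.\<close>

inductive trig :: "(real^3 \<Rightarrow> complex) \<Rightarrow> bool" where
  monomial: "trig (\<lambda>x. c * ee k x)"
| add: "trig f \<Longrightarrow> trig g \<Longrightarrow> trig (\<lambda>x. f x + g x)"

lemma trig_const: "trig (\<lambda>x. c)"
  using trig.monomial[of c 0] by simp

lemma trig_cmult: "trig f \<Longrightarrow> trig (\<lambda>x. c * f x)"
proof (induction rule: trig.induct)
  case (monomial d k)
  then show ?case using trig.monomial[of "c * d" k] by (simp add: mult.assoc)
next
  case (add f g)
  then show ?case using trig.add[OF add.IH] by (simp add: distrib_left)
qed

lemma trig_sum: "(\<And>k. k \<in> F \<Longrightarrow> trig (f k)) \<Longrightarrow> trig (\<lambda>x. \<Sum>k\<in>F. f k x)"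
proof (induction F rule: infinite_finite_induct)
  case (insert k F)
  then show ?case by (simp add: trig.add)
qed (auto intro: trig_const)

lemma trig_mult: "trig f \<Longrightarrow> trig g \<Longrightarrow> trig (\<lambda>x. f x * g x)"
proof (induction rule: trig.induct)
  case (monomial c k)
  then show ?case
  proof (induction rule: trig.induct)
    case (monomial d l)
    then show ?case using trig.monomial[of "c * d" "k + l"] by (simp add: ee_add mult_ac)
  next
    case (add f g)
    then show ?case using trig.add[OF add.IH] by (simp add: distrib_left)
  qed
next
  case (add f1 f2)
  then show ?case using trig.add[OF add.IH(1)[OF add.prems] add.IH(2)[OF add.prems]] by (simp add: distrib_right)
qed

lemma trig_imp_sum:
  assumes "trig f"
  shows "\<exists>F c. finite F \<and> f = (\<lambda>x. \<Sum>k\<in>F. c k * ee k x)"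
  using assms
proof (induction rule: trig.induct)
  case (monomial c k)
  show ?case by (intro exI[of _ "{k}"] exI[of _ "\<lambda>_. c"]) auto
next
  case (add f g)
  then obtain F c G d where *: "finite F" "f = (\<lambda>x. \<Sum>k\<in>F. c k * ee k x)" "finite G" "g = (\<lambda>x. \<Sum>k\<in>G. d k * ee k x)"
    by blast
  have F: "(\<Sum>k\<in>F. c k * ee k x) = (\<Sum>k\<in>F \<union> G. (if k \<in> F then c k else 0) * ee k x)" for x
    using *(1,3) by (intro sum.mono_neutral_cong_left) auto
  have G: "(\<Sum>k\<in>G. d k * ee k x) = (\<Sum>k\<in>F \<union> G. (if k \<in> G then d k else 0) * ee k x)" for x
    using *(1,3) by (intro sum.mono_neutral_cong_left) auto
  show ?case
    by (intro exI[of _ "F \<union> G"] exI[of _ "\<lambda>k. (if k \<in> F then c k else 0) + (if k \<in> G then d k else 0)"])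
      (simp add: * F G distrib_right sum.distrib)
qed

lemma trig_sqint: "trig f \<Longrightarrow> sqint f"
  by (induction rule: trig.induct) (auto intro: sqint_cmult sqint_ee sqint_add)

text \<open>
  The embedding is injective on the open cube. Hence the indicator function of a closed subset of
  the open cube is a limit of continuous functions of the embedding, to which the
  Stone-Weierstrass theorem applies.
\<close>

definition torus_embedding :: "real^3 \<Rightarrow> complex^3" where
  "torus_embedding x = (\<chi> j. cis (2 * pi * x $ j))"

lemma continuous_torus_embedding: "continuous_on S torus_embedding"
  unfolding torus_embedding_def by (intro continuous_intros)

lemma ee_axis: "ee (axis j n) x = cis (2 * pi * (x $ j * n))"
proof -
  have "ivec (axis j n) = axis j (real_of_int n)" by (auto simp: vec_eq_iff axis_def)
  then show ?thesis by (simp add: ee_cis inner_axis)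
qed

text \<open>A real linear functional on complex^3 is a combination of real and imaginary parts of
  the coordinates. Along the embedding these are cosines and sines, hence combinations of
  \<open>ee\<close> at plus and minus a unit vector.\<close>

lemma trig_polynomial:
  assumes "real_polynomial_function g"
  shows "trig (\<lambda>x. complex_of_real (g (torus_embedding x)))"
  using assms
proof (induction rule: real_polynomial_function.induct)
  case (linear f)
  have ax: "axis j c = Re c *\<^sub>R axis j 1 + Im c *\<^sub>R axis j \<i>" for j :: 3 and c
    by (auto simp: vec_eq_iff axis_def complex_eq_iff)
  interpret f: bounded_linear f by fact
  have f_eq: "f z = (\<Sum>j\<in>UNIV. Re (z $ j) * f (axis j 1) + Im (z $ j) * f (axis j \<i>))" for z
  proof -
    have z: "z = (\<Sum>j\<in>UNIV. axis j (z $ j))" by (simp add: vec_eq_iff axis_def if_distrib cong: if_cong)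
    have "f z = (\<Sum>j\<in>UNIV. f (axis j (z $ j)))" by (subst z) (simp add: f.sum)
    also have "\<dots> = (\<Sum>j\<in>UNIV. Re (z $ j) * f (axis j 1) + Im (z $ j) * f (axis j \<i>))"
      by (subst ax) (simp add: f.add f.scaleR)
    finally show ?thesis .
  qed
  have re: "complex_of_real (Re (torus_embedding x $ j)) = (1/2) * ee (axis j 1) x + (1/2) * ee (axis j (-1)) x" for x j
    by (auto simp: torus_embedding_def ee_axis complex_eq_iff)
  have im: "complex_of_real (Im (torus_embedding x $ j)) = (-\<i>/2) * ee (axis j 1) x + (\<i>/2) * ee (axis j (-1)) x" for x j
    by (auto simp: torus_embedding_def ee_axis complex_eq_iff)
  have "trig (\<lambda>x. \<Sum>j\<in>UNIV. f (axis j 1) * complex_of_real (Re (torus_embedding x $ j))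
      + f (axis j \<i>) * complex_of_real (Im (torus_embedding x $ j)))"
    unfolding re im by (intro trig_sum trig.add trig_cmult trig.monomial)
  then show ?case by (simp add: f_eq[of "torus_embedding _"] mult.commute)
next
  case (const c)
  show ?case by (rule trig_const)
next
  case (add f g)
  then show ?case using trig.add by auto
next
  case (mult f g)
  then show ?case using trig_mult by auto
qed

abbreviation square_dist :: "(real^3 \<Rightarrow> complex) \<Rightarrow> (real^3 \<Rightarrow> complex) \<Rightarrow> real" where
  "square_dist f g \<equiv> (LINT x|torus. (norm (f x - g x))\<^sup>2)"

definition L2_approximable :: "(real^3 \<Rightarrow> complex) \<Rightarrow> bool" where
  "L2_approximable f \<longleftrightarrow> (\<forall>\<epsilon>>0. \<exists>p. trig p \<and> square_dist f p < \<epsilon>)"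

text \<open>Density is phrased with squared distances, so |a + b|^2 <= 2 |a|^2 + 2 |b|^2 replaces
  the triangle inequality; the factor 2 is harmless for approximation.\<close>

lemma dist_square_triangle:
  assumes "sqint f" "sqint g" "sqint h"
  shows "square_dist f h
    \<le> 2 * square_dist f g + 2 * square_dist g h"
proof -
  have "square_dist f h \<le> (LINT x|torus. 2 * (norm (f x - g x))\<^sup>2 + 2 * (norm (g x - h x))\<^sup>2)"
  proof (rule integral_mono)
    show "integrable torus (\<lambda>x. (norm (f x - h x))\<^sup>2)"
      "integrable torus (\<lambda>x. 2 * (norm (f x - g x))\<^sup>2 + 2 * (norm (g x - h x))\<^sup>2)"
      by (intro Bochner_Integration.integrable_add integrable_mult_right sqint_integrable sqint_diff assms)+
    show "(norm (f x - h x))\<^sup>2 \<le> 2 * (norm (f x - g x))\<^sup>2 + 2 * (norm (g x - h x))\<^sup>2" for x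
      using norm_add_square_le[of "f x - g x" "g x - h x"] by simp
  qed
  also have "\<dots> = 2 * square_dist f g + 2 * square_dist g h"
    using assms by (subst Bochner_Integration.integral_add) (auto intro!: sqint_integrable sqint_diff)
  finally show ?thesis .
qed

lemma approximable_limit:
  assumes f: "sqint f"
    and g: "\<And>\<epsilon>. \<epsilon> > 0 \<Longrightarrow> \<exists>g. sqint g \<and> L2_approximable g \<and> square_dist f g < \<epsilon>"
  shows "L2_approximable f"
  unfolding L2_approximable_def
proof (intro allI impI)
  fix \<epsilon> :: real assume "\<epsilon> > 0"
  then have e: "\<epsilon> / 4 > 0" by simp
  then obtain g where g: "sqint g" "L2_approximable g" "square_dist f g < \<epsilon> / 4"
    using g by blast
  then obtain p where p: "trig p" "square_dist g p < \<epsilon> / 4"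
    using e unfolding L2_approximable_def by blast
  show "\<exists>p. trig p \<and> square_dist f p < \<epsilon>"
    using dist_square_triangle[OF f g(1) trig_sqint[OF p(1)]] g p by (intro exI[of _ p]) auto
qed

lemma approximable_add:
  assumes "sqint f" "sqint g" "L2_approximable f" "L2_approximable g"
  shows "L2_approximable (\<lambda>x. f x + g x)"
  unfolding L2_approximable_def
proof (intro allI impI)
  fix \<epsilon> :: real assume "\<epsilon> > 0"
  then have e: "\<epsilon> / 4 > 0" by simp
  obtain p where p: "trig p" "square_dist f p < \<epsilon> / 4"
    using e assms unfolding L2_approximable_def by blast
  obtain q where q: "trig q" "square_dist g q < \<epsilon> / 4"
    using e assms unfolding L2_approximable_def by blast
  have "(LINT x|torus. (norm ((f x + g x) - (p x + q x)))\<^sup>2)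
      \<le> 2 * (LINT x|torus. (norm ((f x + g x) - (p x + g x)))\<^sup>2) + 2 * (LINT x|torus. (norm ((p x + g x) - (p x + q x)))\<^sup>2)"
    by (rule dist_square_triangle) (intro assms sqint_add trig_sqint p q)+
  then show "\<exists>p. trig p \<and> (LINT x|torus. (norm (f x + g x - p x))\<^sup>2) < \<epsilon>"
    using p q by (intro exI[of _ "\<lambda>x. p x + q x"]) (auto intro: trig.add)
qed

lemma approximable_cmult:
  assumes "L2_approximable f"
  shows "L2_approximable (\<lambda>x. c * f x)"
  unfolding L2_approximable_def
proof (intro allI impI)
  fix \<epsilon> :: real assume e: "\<epsilon> > 0"
  show "\<exists>p. trig p \<and> (LINT x|torus. (norm (c * f x - p x))\<^sup>2) < \<epsilon>"
  proof (cases "c = 0")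
    case True
    then show ?thesis using e by (intro exI[of _ "\<lambda>x. 0"]) (auto intro: trig_const)
  next
    case False
    then have "\<epsilon> / (norm c)\<^sup>2 > 0" using e by simp
    then obtain p where p: "trig p" "square_dist f p < \<epsilon> / (norm c)\<^sup>2"
      using assms unfolding L2_approximable_def by blast
    have "(norm (c * f x - c * p x))\<^sup>2 = (norm c)\<^sup>2 * (norm (f x - p x))\<^sup>2" for x
      by (simp add: norm_mult power_mult_distrib flip: right_diff_distrib)
    then have "(LINT x|torus. (norm (c * f x - c * p x))\<^sup>2) < \<epsilon>"
      using p(2) False by (simp add: field_simps)
    then show ?thesis using p(1) trig_cmult by blast
  qed
qed

lemma approximable_sum: "(\<And>k. k \<in> F \<Longrightarrow> sqint (f k) \<and> L2_approximable (f k)) \<Longrightarrow> L2_approximable (\<lambda>x. \<Sum>k\<in>F. f k x)"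
proof (induction F rule: infinite_finite_induct)
  case (insert k F)
  then show ?case by (simp add: approximable_add sqint_sum)
qed (auto simp: L2_approximable_def intro!: exI[of _ "\<lambda>x. 0"] trig_const)

lemma dominated_L2_limit:
  fixes f G :: "real^3 \<Rightarrow> complex" and s :: "nat \<Rightarrow> real^3 \<Rightarrow> complex"
  assumes f: "f \<in> borel_measurable torus" and s: "\<And>n. s n \<in> borel_measurable torus"
    and G: "sqint G" and lim: "AE x in torus. (\<lambda>n. s n x) \<longlonglongrightarrow> f x"
    and bound: "\<And>n x. x \<in> cbox 0 1 \<Longrightarrow> norm (s n x) \<le> norm (G x)" "\<And>x. x \<in> cbox 0 1 \<Longrightarrow> norm (f x) \<le> norm (G x)"
  shows "(\<lambda>n. LINT x|torus. (norm (f x - s n x))\<^sup>2) \<longlonglongrightarrow> 0"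
proof -
  have "(\<lambda>n. LINT x|torus. (norm (f x - s n x))\<^sup>2) \<longlonglongrightarrow> (LINT x|torus. 0::real)"
  proof (rule integral_dominated_convergence)
    show "(\<lambda>x. (norm (f x - s n x))\<^sup>2) \<in> borel_measurable torus" for n
      using borel_measurable_diff[OF f s[of n]] by measurable
    show "integrable torus (\<lambda>x. 4 * (norm (G x))\<^sup>2)" using sqint_integrable[OF G] by simp
    show "AE x in torus. (\<lambda>n. (norm (f x - s n x))\<^sup>2) \<longlonglongrightarrow> 0"
      using lim
    proof eventually_elim
      case (elim x)
      have "(\<lambda>n. (norm (f x - s n x))\<^sup>2) \<longlonglongrightarrow> (norm (f x - f x))\<^sup>2"
        by (intro tendsto_intros elim)
      then show ?case by simp
    qed
    show "AE x in torus. norm ((norm (f x - s n x))\<^sup>2) \<le> 4 * (norm (G x))\<^sup>2" for n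
    proof (rule AE_I2)
      fix x assume "x \<in> space torus"
      then have x: "x \<in> cbox 0 1" by simp
      have "norm (f x - s n x) \<le> 2 * norm (G x)"
        using bound(1)[OF x, of n] bound(2)[OF x] norm_triangle_ineq4[of "f x" "s n x"] by linarith
      then have "(norm (f x - s n x))\<^sup>2 \<le> (2 * norm (G x))\<^sup>2" by (intro power_mono) auto
      then show "norm ((norm (f x - s n x))\<^sup>2) \<le> 4 * (norm (G x))\<^sup>2" by (simp add: power_mult_distrib)
    qed
  qed simp
  then show ?thesis by simp
qed

text \<open>Stone-Weierstrass on the compact image of the cube gives uniform approximation, hence
  approximation in L^2, as the cube has measure 1.\<close>

lemma approximable_continuous:
  fixes h :: "complex^3 \<Rightarrow> real"
  assumes h: "continuous_on UNIV h"
  shows "L2_approximable (\<lambda>x. of_real (h (torus_embedding x)))"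
  unfolding L2_approximable_def
proof (intro allI impI)
  fix \<epsilon> :: real assume e: "\<epsilon> > 0"
  let ?S = "torus_embedding ` cbox 0 1"
  define \<delta> where "\<delta> = min 1 (\<epsilon> / 2)"
  have \<delta>: "\<delta> > 0" "\<delta>\<^sup>2 < \<epsilon>"
  proof -
    show "\<delta> > 0" using e by (simp add: \<delta>_def)
    then have "\<delta> * \<delta> \<le> 1 * \<delta>" by (intro mult_right_mono) (auto simp: \<delta>_def)
    then have "\<delta>\<^sup>2 \<le> \<delta>" by (simp add: power2_eq_square)
    also have "\<dots> < \<epsilon>" using e by (simp add: \<delta>_def min_def)
    finally show "\<delta>\<^sup>2 < \<epsilon>" .
  qed
  have "compact ?S" by (intro compact_continuous_image continuous_torus_embedding compact_cbox)
  then obtain g where g: "real_polynomial_function g" "\<And>z. z \<in> ?S \<Longrightarrow> \<bar>h z - g z\<bar> < \<delta>"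
    using Stone_Weierstrass_real_polynomial_function[of ?S h \<delta>] h \<delta> continuous_on_subset by blast
  let ?p = "\<lambda>x. complex_of_real (g (torus_embedding x))"
  let ?h = "\<lambda>x. complex_of_real (h (torus_embedding x))"
  have "(LINT x|torus. (norm (?h x - ?p x))\<^sup>2) \<le> (LINT x|torus. \<delta>\<^sup>2)"
  proof (rule integral_mono')
    show "integrable torus (\<lambda>x. \<delta>\<^sup>2)" by simp
    fix x assume "x \<in> space torus"
    then have "\<bar>h (torus_embedding x) - g (torus_embedding x)\<bar> \<le> \<delta>" using g(2) by fastforce
    then show "(norm (?h x - ?p x))\<^sup>2 \<le> \<delta>\<^sup>2"
      unfolding of_real_diff[symmetric] norm_of_real by (intro power_mono) auto
  qed auto
  also have "\<dots> = \<delta>\<^sup>2" by (simp add: measure_def emeasure_torus_space)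
  finally show "\<exists>p. trig p \<and> (LINT x|torus. (norm (?h x - p x))\<^sup>2) < \<epsilon>"
    using trig_polynomial[OF g(1)] \<delta> by (intro exI[of _ ?p]) auto
qed

lemma approximable_cong:
  assumes "L2_approximable f" "\<And>x. x \<in> cbox 0 1 \<Longrightarrow> f x = g x"
  shows "L2_approximable g"
proof -
  have "square_dist f p = square_dist g p" for p
    by (rule Bochner_Integration.integral_cong) (use assms(2) in auto)
  then show ?thesis using assms(1) by (simp add: L2_approximable_def)
qed

lemma torus_embedding_inj:
  assumes "x \<in> box 0 1" "y \<in> box 0 1" "torus_embedding x = torus_embedding y"
  shows "x = y"
proof -
  have "x $ j = y $ j" for j
  proof -
    have "cis (2 * pi * x $ j) = cis (2 * pi * y $ j)"
      using assms(3) by (simp add: torus_embedding_def vec_eq_iff)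
    then have "sin (2 * pi * x $ j) = sin (2 * pi * y $ j) \<and> cos (2 * pi * x $ j) = cos (2 * pi * y $ j)"
      by (simp add: complex_eq_iff)
    then obtain n :: int where "2 * pi * x $ j = 2 * pi * y $ j + 2 * pi * n"
      using sin_cos_eq_iff[of "2 * pi * x $ j" "2 * pi * y $ j"] by auto
    then have "2 * pi * x $ j = 2 * pi * (y $ j + n)" by (simp add: distrib_left)
    then have n: "x $ j = y $ j + n" by simp
    have "0 < x $ j" "x $ j < 1" "0 < y $ j" "y $ j < 1"
      using assms(1,2) by (auto simp: mem_box_cart)
    then have "real_of_int n < 1" "real_of_int n > -1" using n by linarith+
    then have "n = 0" by linarith
    then show ?thesis using n by simp
  qed
  then show ?thesis by (simp add: vec_eq_iff)
qed

lemma null_boundary: "cbox 0 1 - box 0 (1::real^3) \<in> null_sets lebesgue"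
  using negligible_frontier_interval[of "0::real^3" 1] by (simp add: negligible_iff_null_sets)

lemma AE_torus_interior: "AE x in torus. x \<in> box 0 1"
proof -
  have "AE x in lebesgue. x \<notin> cbox 0 1 - box 0 (1::real^3)" by (rule AE_not_in[OF null_boundary])
  then have "AE x in lebesgue. x \<in> cbox 0 1 \<longrightarrow> x \<in> box 0 (1::real^3)" by eventually_elim auto
  then show ?thesis unfolding torus_def by (subst AE_restrict_space_iff) auto
qed

lemma measurable_indicator_torus:
  "A \<in> sets lebesgue \<Longrightarrow> (\<lambda>x. complex_of_real (indicator A x)) \<in> borel_measurable torus"
  unfolding torus_def
  by (rule measurable_restrict_space1, rule measurable_compose[OF borel_measurable_indicator]) simp_all

lemma sqint_indicator: "A \<in> sets lebesgue \<Longrightarrow> sqint (\<lambda>x. of_real (indicator A x))"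
  by (rule sqint_bounded[of _ 1]) (auto intro: measurable_indicator_torus split: split_indicator)

text \<open>With K the compact image of C, the functions max(0, 1 - n dist(z, K)) decrease to the
  indicator of K. By injectivity, points of the open cube outside C are not mapped into K; the
  faces, where opposite points are identified, form a null set.\<close>

lemma approximable_indicator_closed:
  assumes C: "closed C" "C \<subseteq> box 0 1"
  shows "L2_approximable (\<lambda>x. of_real (indicator C x))"
proof (cases "C = {}")
  case True
  then show ?thesis using trig_const[of 0] by (auto simp: L2_approximable_def intro!: exI[of _ "\<lambda>x. 0"])
next
  case False
  have Cm: "C \<in> sets lebesgue" using C(1) by (simp add: borel_closed)
  let ?K = "torus_embedding ` C"
  let ?h = "\<lambda>n z. max 0 (1 - real n * infdist z ?K)"
  let ?g = "\<lambda>n x. complex_of_real (?h n (torus_embedding x))" and ?one = "\<lambda>x. complex_of_real (indicator C x)"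
  have "compact C" using C bounded_subset[OF bounded_box] by (simp add: compact_eq_bounded_closed)
  then have K: "closed ?K" by (intro compact_imp_closed compact_continuous_image continuous_torus_embedding)
  have hc: "continuous_on S (?h n)" for n S by (intro continuous_intros)
  have hb: "\<bar>?h n z\<bar> \<le> 1" for n z by (auto simp: infdist_nonneg)
  have hm: "(?g n) \<in> borel_measurable torus" for n
    by (intro continuous_imp_measurable_torus continuous_intros continuous_torus_embedding)
  have hs: "sqint (?g n)" for n
    by (rule sqint_bounded[of _ 1]) (use hm[of n] hb[of n] in \<open>simp_all only: norm_of_real\<close>)
  show ?thesis
  proof (rule approximable_limit[OF sqint_indicator[OF Cm]])
    fix \<epsilon> :: real assume e: "\<epsilon> > 0"
    have "(\<lambda>n. square_dist ?one (?g n)) \<longlonglongrightarrow> 0"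
    proof (rule dominated_L2_limit[OF measurable_indicator_torus[OF Cm] hm])
      show "sqint (\<lambda>x. 1)" by (rule sqint_bounded[of _ 1]) auto
      show "norm (?g n x) \<le> norm (1::complex)" for n x
        unfolding norm_of_real using hb[of n] by simp
      show "norm (?one x) \<le> norm (1::complex)" for x
        by (simp split: split_indicator)
      show "AE x in torus. (\<lambda>n. ?g n x) \<longlonglongrightarrow> ?one x"
        using AE_torus_interior
      proof eventually_elim
        case (elim x)
        show ?case
        proof (cases "x \<in> C")
          case True
          then have "infdist (torus_embedding x) ?K = 0" by (intro infdist_zero) auto
          then show ?thesis using True by simp
        next
          case nC: False
          have "torus_embedding x \<notin> ?K" using nC C(2) elim torus_embedding_inj by blast
          then have d: "infdist (torus_embedding x) ?K > 0"
            using in_closed_iff_infdist_zero[OF K] False infdist_nonneg[of "torus_embedding x" ?K]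
            by (metis image_is_empty less_eq_real_def)
          obtain N :: nat where N: "1 / infdist (torus_embedding x) ?K < real N" using reals_Archimedean2 by blast
          have "\<forall>\<^sub>F n in sequentially. ?g n x = ?one x"
            using eventually_ge_at_top[of N]
          proof eventually_elim
            case (elim n)
            have "1 < real N * infdist (torus_embedding x) ?K" using N d by (simp add: field_simps)
            also have "\<dots> \<le> real n * infdist (torus_embedding x) ?K" using elim d by simp
            finally show ?case using nC by simp
          qed
          then show ?thesis by (rule tendsto_eventually)
        qed
      qed
    qed
    then have "\<forall>\<^sub>F n in sequentially. square_dist ?one (?g n) < \<epsilon>"
      by (rule order_tendstoD(2)) (rule e)
    then obtain n where n: "square_dist ?one (?g n) < \<epsilon>"
      using eventually_happens trivial_limit_sequentially by blast
    show "\<exists>g. sqint g \<and> L2_approximable g \<and> square_dist ?one g < \<epsilon>"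
      by (intro exI[of _ "?g n"] conjI hs approximable_continuous hc n)
  qed
qed

text \<open>Inner regularity supplies a closed set inside the part of A in the open cube. The rest
  of A lies on the faces and is null, and the squared distance of two nested indicators is the
  measure of the difference.\<close>

lemma approximable_indicator:
  assumes A: "A \<in> sets lebesgue" "A \<subseteq> cbox 0 1"
  shows "L2_approximable (\<lambda>x. of_real (indicator A x))"
proof (rule approximable_limit[OF sqint_indicator[OF A(1)]])
  fix \<epsilon> :: real assume e: "\<epsilon> > 0"
  have A': "A \<inter> box 0 1 \<in> sets lebesgue" using A(1) by (intro sets.Int) simp_all
  obtain C where C: "closed C" "C \<subseteq> A \<inter> box 0 1" "A \<inter> box 0 1 - C \<in> lmeasurable"
    "emeasure lebesgue (A \<inter> box 0 1 - C) < ennreal \<epsilon>"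
    using sets_lebesgue_inner_closed[OF A' e] by blast
  have Cm: "C \<in> sets lebesgue" using C(1) by (simp add: borel_closed)
  have AC: "A - C \<in> sets lebesgue" using A(1) Cm by auto
  have "emeasure lebesgue (A - C) \<le> emeasure lebesgue ((A \<inter> box 0 1 - C) \<union> (cbox 0 1 - box 0 1))"
    by (rule emeasure_mono) (use A(2) A' Cm null_boundary in \<open>auto intro!: sets.Un sets.Diff simp del: Diff_subset\<close>)
  also have "\<dots> = emeasure lebesgue (A \<inter> box 0 1 - C)"
    by (rule emeasure_Un_null_set[OF sets.Diff[OF A' Cm] null_boundary])
  also have "\<dots> < ennreal \<epsilon>" by (rule C)
  finally have m: "emeasure lebesgue (A - C) < ennreal \<epsilon>" .
  have "(LINT x|torus. (norm (complex_of_real (indicator A x) - complex_of_real (indicator C x)))\<^sup>2)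
      = (LINT x|torus. indicator (A - C) x)"
    by (rule Bochner_Integration.integral_cong) (use C(2) in \<open>auto split: split_indicator\<close>)
  also have "\<dots> = measure torus ((A - C) \<inter> space torus)" by (rule Bochner_Integration.integral_indicator)
  also have "\<dots> = measure lebesgue (A - C)"
    using A(2) unfolding torus_def by (subst measure_restrict_space) (auto intro: arg_cong[where f = "measure lebesgue"])
  also have "\<dots> < \<epsilon>"
  proof -
    have "emeasure lebesgue (A - C) \<noteq> top" using m by auto
    then have "ennreal (measure lebesgue (A - C)) < ennreal \<epsilon>"
      using m emeasure_eq_ennreal_measure[of lebesgue "A - C"] by simp
    then show ?thesis by (simp add: ennreal_less_iff)
  qed
  finally show "\<exists>g. sqint g \<and> L2_approximable g \<and> (LINT x|torus. (norm (complex_of_real (indicator A x) - g x))\<^sup>2) < \<epsilon>"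
    using sqint_indicator[OF Cm] approximable_indicator_closed[OF C(1)] C(2) by blast
qed

text \<open>Simple functions converging pointwise with modulus at most 2 |f| converge in L^2 by
  domination, and each is a finite combination of indicators of its level sets.\<close>

theorem approximable_sqint:
  assumes f: "sqint f"
  shows "L2_approximable f"
proof -
  obtain s where s: "\<And>i. simple_function torus (s i)" "\<And>x. x \<in> space torus \<Longrightarrow> (\<lambda>i. s i x) \<longlonglongrightarrow> f x"
    and b: "\<And>i x. x \<in> space torus \<Longrightarrow> dist (s i x) 0 \<le> 2 * dist (f x) 0"
    using borel_measurable_implies_sequence_metric[OF sqint_measurable[OF f], of 0] by blast
  have sm: "s i \<in> borel_measurable torus" for i using s(1) by (rule borel_measurable_simple_function)
  have set: "s i -` {y} \<inter> space torus \<in> sets lebesgue" for i y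
  proof -
    have "s i -` {y} \<inter> space torus \<in> sets torus" using s(1) by (rule simple_functionD(2))
    then show ?thesis by (simp add: torus_def sets_restrict_space_iff)
  qed
  have sq: "sqint (s i)" for i
  proof -
    have fin: "finite (s i ` space torus)" using s(1) by (rule simple_functionD(1))
    show ?thesis
      by (rule sqint_bounded[OF sm, where B = "Max (norm ` s i ` space torus)"]) (use fin in \<open>auto intro!: Max_ge\<close>)
  qed
  have ap: "L2_approximable (s i)" for i
  proof (rule approximable_cong)
    show "L2_approximable (\<lambda>x. \<Sum>y\<in>s i ` space torus. y * complex_of_real (indicator (s i -` {y} \<inter> space torus) x))"
      by (intro approximable_sum conjI approximable_cmult sqint_cmult approximable_indicator sqint_indicator set) auto
    fix x :: "real^3" assume "x \<in> cbox 0 1"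
    then have "s i x = (\<Sum>y\<in>s i ` space torus. indicator (s i -` {y} \<inter> space torus) x *\<^sub>R y)"
      by (intro simple_function_indicator_representation_banach[OF s(1)]) simp
    also have "\<dots> = (\<Sum>y\<in>s i ` space torus. y * complex_of_real (indicator (s i -` {y} \<inter> space torus) x))"
      by (rule sum.cong) (simp_all only: scaleR_conv_of_real mult.commute)
    finally show "(\<Sum>y\<in>s i ` space torus. y * complex_of_real (indicator (s i -` {y} \<inter> space torus) x)) = s i x"
      by (rule sym)
  qed
  show ?thesis
  proof (rule approximable_limit[OF f])
    fix \<epsilon> :: real assume e: "\<epsilon> > 0"
    have "(\<lambda>n. LINT x|torus. (norm (f x - s n x))\<^sup>2) \<longlonglongrightarrow> 0"
    proof (rule dominated_L2_limit[OF sqint_measurable[OF f] sm])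
      show "sqint (\<lambda>x. 2 * f x)" using f by (rule sqint_cmult)
    qed (use s b in \<open>auto simp: norm_mult\<close>)
    then have "\<forall>\<^sub>F n in sequentially. square_dist f (s n) < \<epsilon>"
      by (rule order_tendstoD(2)) (rule e)
    then obtain n where n: "square_dist f (s n) < \<epsilon>"
      using eventually_happens trivial_limit_sequentially by blast
    then show "\<exists>g. sqint g \<and> L2_approximable g \<and> square_dist f g < \<epsilon>"
      using sq ap by blast
  qed
qed

section \<open>Projection, uniqueness and the convolution theorem for Fourier coefficients\<close>

lemma coef_integrable: "sqint f \<Longrightarrow> integrable torus (\<lambda>x. f x * ee k x)"
  by (rule sqint_mult[OF _ sqint_ee])

lemma integral_ee_ee: "(LINT x|torus. ee k x * ee l x) = (if k + l = 0 then 1 else 0)"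
  by (simp add: integral_ee flip: ee_add)

lemma coef_sum:
  assumes "finite F"
  shows "coef (\<lambda>x. \<Sum>l\<in>F. c l * ee l x) k = (if k \<in> F then c k else 0)"
proof -
  have "coef (\<lambda>x. \<Sum>l\<in>F. c l * ee l x) k = (LINT x|torus. (\<Sum>l\<in>F. c l * (ee l x * ee (- k) x)))"
    by (simp add: coef_def sum_distrib_right mult.assoc)
  also have "\<dots> = (\<Sum>l\<in>F. c l * (if l - k = 0 then 1 else 0))"
    by (subst Bochner_Integration.integral_sum) (auto simp: integral_ee_ee sqint_mult sqint_ee)
  also have "\<dots> = (\<Sum>l\<in>F. if l = k then c l else 0)" by (intro sum.cong) auto
  also have "\<dots> = (if k \<in> F then c k else 0)" using assms by simp
  finally show ?thesis .
qed

lemma coef_diff: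
  assumes "sqint f" "sqint g"
  shows "coef (\<lambda>x. f x - g x) k = coef f k - coef g k"
  using assms by (simp add: coef_def left_diff_distrib coef_integrable)

text \<open>The residual g has vanishing coefficients on F and is therefore orthogonal to h, the
  difference of the two polynomials; the rest is Pythagoras.\<close>

lemma best_approximation:
  assumes f: "sqint f" and F: "finite F"
  shows "(LINT x|torus. (norm (f x - (\<Sum>k\<in>F. coef f k * ee k x)))\<^sup>2)
    \<le> (LINT x|torus. (norm (f x - (\<Sum>k\<in>F. c k * ee k x)))\<^sup>2)"
proof -
  define g where "g x = f x - (\<Sum>k\<in>F. coef f k * ee k x)" for x
  define h where "h x = (\<Sum>k\<in>F. (coef f k - c k) * ee k x)" for x
  have S: "sqint (\<lambda>x. \<Sum>k\<in>F. b k * ee k x)" for b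
    by (intro sqint_sum sqint_cmult sqint_ee)
  have g: "sqint g" unfolding g_def by (intro sqint_diff f S)
  have h: "sqint h" unfolding h_def by (rule S)
  have g0: "coef g k = 0" if "k \<in> F" for k
    unfolding g_def using that by (subst coef_diff[OF f S]) (simp add: coef_sum[OF F])
  have "(LINT x|torus. g x * cnj (h x)) = (LINT x|torus. (\<Sum>k\<in>F. cnj (coef f k - c k) * (g x * ee (- k) x)))"
    by (simp add: h_def sum_distrib_left mult_ac ee_minus)
  also have "\<dots> = (\<Sum>k\<in>F. cnj (coef f k - c k) * coef g k)"
    by (subst Bochner_Integration.integral_sum) (auto simp: coef_def coef_integrable g)
  also have "\<dots> = 0" using g0 by simp
  finally have gh: "(LINT x|torus. g x * cnj (h x)) = 0" .
  have gh_int: "integrable torus (\<lambda>x. g x * cnj (h x))"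
  proof (rule sqint_mult[OF g])
    have "(\<lambda>x. cnj (h x)) \<in> borel_measurable torus"
      by (rule measurable_compose[OF sqint_measurable[OF h]]) (intro borel_measurable_continuous_onI continuous_intros)
    then show "sqint (\<lambda>x. cnj (h x))" using sqint_integrable[OF h] by (simp add: sqint_def)
  qed
  have eq: "(norm (f x - (\<Sum>k\<in>F. c k * ee k x)))\<^sup>2 = (norm (g x))\<^sup>2 + (norm (h x))\<^sup>2 + 2 * Re (g x * cnj (h x))" for x
  proof -
    have *: "f x - (\<Sum>k\<in>F. c k * ee k x) = g x + h x"
      by (simp add: g_def h_def left_diff_distrib sum_subtractf)
    show ?thesis unfolding * cmod_power2 by (simp add: power2_eq_square algebra_simps)
  qed
  have "(LINT x|torus. (norm (f x - (\<Sum>k\<in>F. c k * ee k x)))\<^sup>2)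
      = (LINT x|torus. (norm (g x))\<^sup>2) + (LINT x|torus. (norm (h x))\<^sup>2) + 2 * (LINT x|torus. Re (g x * cnj (h x)))"
    unfolding eq
    by (simp only: Bochner_Integration.integral_add Bochner_Integration.integrable_add integrable_mult_right
        sqint_integrable g h integrable_Re[OF gh_int] integral_mult_right_zero)
  also have "(LINT x|torus. Re (g x * cnj (h x))) = 0" using integral_Re[OF gh_int] gh by simp
  finally show ?thesis unfolding g_def[symmetric] by simp
qed

text \<open>If all coefficients vanish, the best approximation on every finite set is 0, so by
  density the squared norm of f is at most every positive \<epsilon>.\<close>

lemma coef_zero_imp_AE_zero:
  assumes f: "sqint f" and 0: "\<And>k. coef f k = 0"
  shows "AE x in torus. f x = 0"
proof -
  have "(LINT x|torus. (norm (f x))\<^sup>2) \<le> 0"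
  proof (rule field_le_epsilon)
    fix \<epsilon> :: real assume "\<epsilon> > 0"
    then obtain p where p: "trig p" "square_dist f p < \<epsilon>"
      using approximable_sqint[OF f] unfolding L2_approximable_def by blast
    then obtain F c where "finite F" "p = (\<lambda>x. \<Sum>k\<in>F. c k * ee k x)" using trig_imp_sum by blast
    then show "(LINT x|torus. (norm (f x))\<^sup>2) \<le> 0 + \<epsilon>"
      using best_approximation[OF f, of F c] p(2) by (simp add: 0)
  qed
  then have "(LINT x|torus. (norm (f x))\<^sup>2) = 0" by (intro antisym) auto
  then have "AE x in torus. (norm (f x))\<^sup>2 = 0"
    by (subst integral_nonneg_eq_0_iff_AE[symmetric]) (auto intro: sqint_integrable f)
  then show ?thesis by simp
qed

text \<open>The finite sum over F is the k-th coefficient of S g, with S the partial Fourier sum of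
  f. By \<open>best_approximation\<close> S is at least as close to f as one fixed polynomial, for
  every F containing its support; this yields unordered summation.\<close>

theorem coef_mult_has_sum:
  assumes f: "sqint f" and g: "sqint g"
  shows "((\<lambda>l. coef f l * coef g (k - l)) has_sum coef (\<lambda>x. f x * g x) k) UNIV"
  unfolding has_sum_def tendsto_iff
proof (intro allI impI)
  fix \<epsilon> :: real assume e: "\<epsilon> > 0"
  define G where "G = (LINT x|torus. (norm (g x))\<^sup>2)"
  have G: "G \<ge> 0" by (simp add: G_def)
  \<comment> \<open>The product is estimated by ab <= a^2/(2 \<eta>) + \<eta> b^2/2 instead of
    Cauchy-Schwarz for integrals; this choice keeps each summand below half of \<epsilon>.\<close>
  define \<eta> where "\<eta> = \<epsilon> / (G + 1)"
  have \<eta>: "\<eta> > 0" "\<eta> * G < \<epsilon>" using e G by (simp_all add: \<eta>_def field_simps)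
  obtain p where p: "trig p" "square_dist f p < \<eta> * \<epsilon>"
    using approximable_sqint[OF f] \<eta> e unfolding L2_approximable_def by (meson mult_pos_pos)
  then obtain F0 c where F0: "finite F0" "p = (\<lambda>x. \<Sum>k\<in>F0. c k * ee k x)" using trig_imp_sum by blast
  have "dist (\<Sum>l\<in>F. coef f l * coef g (k - l)) (coef (\<lambda>x. f x * g x) k) < \<epsilon>"
    if F: "finite F" "F0 \<subseteq> F" for F
  proof -
    define S where "S x = (\<Sum>l\<in>F. coef f l * ee l x)" for x
    have S: "sqint S" unfolding S_def by (intro sqint_sum sqint_cmult sqint_ee)
    have gk: "sqint (\<lambda>x. g x * ee (- k) x)" by (rule sqint_mult_bounded[OF g]) simp_all
    have "(\<Sum>l\<in>F. coef f l * coef g (k - l)) = (\<Sum>l\<in>F. LINT x|torus. coef f l * (g x * ee (l - k) x))"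
      by (simp add: coef_def)
    also have "\<dots> = (LINT x|torus. (\<Sum>l\<in>F. coef f l * (g x * ee (l - k) x)))"
      by (subst Bochner_Integration.integral_sum) (auto intro: coef_integrable[OF g])
    also have "\<dots> = (LINT x|torus. S x * (g x * ee (- k) x))"
    proof (rule Bochner_Integration.integral_cong)
      fix x
      have "ee (l - k) x = ee l x * ee (- k) x" for l using ee_add[of l "- k" x] by simp
      then show "(\<Sum>l\<in>F. coef f l * (g x * ee (l - k) x)) = S x * (g x * ee (- k) x)"
        unfolding S_def sum_distrib_right by (intro sum.cong) simp_all
    qed simp
    finally have "coef (\<lambda>x. f x * g x) k - (\<Sum>l\<in>F. coef f l * coef g (k - l))
        = (LINT x|torus. (f x - S x) * (g x * ee (- k) x))"
      using sqint_mult[OF f gk] sqint_mult[OF S gk] by (simp add: coef_def left_diff_distrib mult.assoc)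
    also have "norm \<dots> \<le> (LINT x|torus. norm ((f x - S x) * (g x * ee (- k) x)))"
      by (rule integral_norm_bound)
    also have "\<dots> \<le> (LINT x|torus. (1 / (2 * \<eta>)) * (norm (f x - S x))\<^sup>2 + (\<eta> / 2) * (norm (g x))\<^sup>2)"
    proof (rule integral_mono)
      show "integrable torus (\<lambda>x. norm ((f x - S x) * (g x * ee (- k) x)))"
        by (intro integrable_norm sqint_mult sqint_diff f S gk)
      show "integrable torus (\<lambda>x. (1 / (2 * \<eta>)) * (norm (f x - S x))\<^sup>2 + (\<eta> / 2) * (norm (g x))\<^sup>2)"
        by (intro Bochner_Integration.integrable_add integrable_mult_right sqint_integrable sqint_diff f S g)
      fix x
      have "2 * (norm (f x - S x)) * (\<eta> * norm (g x)) \<le> (norm (f x - S x))\<^sup>2 + (\<eta> * norm (g x))\<^sup>2"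
        by (rule sum_squares_bound)
      then have "2 * \<eta> * (norm (f x - S x) * norm (g x)) / (2 * \<eta>) \<le> ((norm (f x - S x))\<^sup>2 + (\<eta> * norm (g x))\<^sup>2) / (2 * \<eta>)"
        using \<eta> by (intro divide_right_mono) (auto simp: mult_ac)
      then show "norm ((f x - S x) * (g x * ee (- k) x)) \<le> (1 / (2 * \<eta>)) * (norm (f x - S x))\<^sup>2 + (\<eta> / 2) * (norm (g x))\<^sup>2"
        using \<eta> by (simp add: norm_mult add_divide_distrib power_mult_distrib power2_eq_square mult_ac)
    qed
    also have "\<dots> = (1 / (2 * \<eta>)) * square_dist f S + (\<eta> / 2) * G"
      unfolding G_def using sqint_integrable[OF sqint_diff[OF f S]] sqint_integrable[OF g]
      by (subst Bochner_Integration.integral_add) auto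
    also have "\<dots> < \<epsilon>"
    proof -
      have "p x = (\<Sum>l\<in>F. (if l \<in> F0 then c l else 0) * ee l x)" for x
        unfolding F0(2) using F by (intro sum.mono_neutral_cong_left) auto
      then have "square_dist f S \<le> square_dist f p"
        unfolding S_def using best_approximation[OF f F(1), of "\<lambda>l. if l \<in> F0 then c l else 0"] by (simp only:)
      then have "square_dist f S < \<eta> * \<epsilon>" using p(2) by linarith
      then have "(1 / (2 * \<eta>)) * square_dist f S < (1 / (2 * \<eta>)) * (\<eta> * \<epsilon>)"
        using \<eta> by (intro mult_strict_left_mono) auto
      also have "\<dots> = \<epsilon> / 2" using \<eta> by simp
      finally show ?thesis using \<eta>(2) by linarith
    qed
    finally show ?thesis by (simp add: dist_norm norm_minus_commute)
  qed
  then show "\<forall>\<^sub>F F in finite_subsets_at_top UNIV. dist (\<Sum>l\<in>F. coef f l * coef g (k - l)) (coef (\<lambda>x. f x * g x) k) < \<epsilon>"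
    unfolding eventually_finite_subsets_at_top using F0(1) by auto
qed

section \<open>Plane waves as test fields\<close>

text \<open>Differentiating a cosine shifts its phase by pi/2 and rescales its amplitude, so the
  induction generalizes over both.\<close>

lemma Ck_on_cos:
  fixes h :: "'a::euclidean_space \<Rightarrow> real" and a :: "'b::real_normed_vector"
  assumes h: "bounded_linear h"
  shows "Ck_on n S (\<lambda>p. cos (h p + \<theta>) *\<^sub>R a)"
proof (induction n arbitrary: \<theta> a)
  case 0
  show ?case using linear_continuous_on[OF h] by (auto intro!: continuous_intros)
next
  case (Suc n)
  let ?f' = "\<lambda>p v. cos (h p + (\<theta> + pi / 2)) *\<^sub>R (h v *\<^sub>R a)"
  have "((\<lambda>p. cos (h p + \<theta>) *\<^sub>R a) has_derivative ?f' p) (at p within S)" for p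
  proof -
    have "((\<lambda>p. cos (h p + \<theta>) *\<^sub>R a) has_derivative (\<lambda>v. (- sin (h p + \<theta>) * h v) *\<^sub>R a)) (at p within S)"
      by (auto intro!: derivative_eq_intros bounded_linear_imp_has_derivative[OF h] simp: mult.commute)
    moreover have "cos (h p + (\<theta> + pi / 2)) = - sin (h p + \<theta>)"
      using cos_add[of "h p + \<theta>" "pi / 2"] by (simp add: add.assoc)
    ultimately show ?thesis by simp
  qed
  then show ?case unfolding Ck_on.simps using Suc by (intro exI[of _ ?f']) blast
qed

lemma bounded_linear_phase: "bounded_linear (\<lambda>x. 2 * pi * (x \<bullet> ivec k))"
  by (intro bounded_linear_const_mult bounded_linear_inner_left)

text \<open>Test fields are real, hence a cosine with a free phase: the phases 0 and pi/2 recover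
  the real and the imaginary part of a complex coefficient. Scalar amplitudes serve for the
  divergence constraint, vector amplitudes for the equation.\<close>

definition wave :: "int^3 \<Rightarrow> real \<Rightarrow> 'b::real_normed_vector \<Rightarrow> real^3 \<Rightarrow> 'b" where
  "wave k \<theta> a x = cos (2 * pi * (x \<bullet> ivec k) + \<theta>) *\<^sub>R a"

lemma wave_smooth: "smooth_on S (wave k \<theta> a)"
  unfolding smooth_on_def wave_def[abs_def] using Ck_on_cos[OF bounded_linear_phase] by blast

lemma wave_smooth_time: "smooth_on S (\<lambda>(x, t::real). wave k \<theta> a x)"
proof -
  have "bounded_linear (\<lambda>p. 2 * pi * (fst p \<bullet> ivec k))"
    using bounded_linear_compose[OF bounded_linear_phase[of k] bounded_linear_fst] by simp
  then show ?thesis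
    unfolding smooth_on_def wave_def case_prod_beta using Ck_on_cos by blast
qed

lemma inner_ivec_Ints: "ivec l \<bullet> ivec k \<in> \<int>"
  by (auto simp: inner_vec_def)

lemma wave_periodic: "periodic (wave k \<theta> a)"
  unfolding periodic_def
proof (intro allI)
  fix x l
  obtain n where n: "ivec l \<bullet> ivec k = of_int n" using inner_ivec_Ints Ints_cases by blast
  have "cos (2 * pi * ((x + ivec l) \<bullet> ivec k) + \<theta>) = cos ((2 * pi * (x \<bullet> ivec k) + \<theta>) + 2 * pi * of_int n)"
    by (simp add: inner_add_left n algebra_simps)
  also have "\<dots> = cos (2 * pi * (x \<bullet> ivec k) + \<theta>)" by (simp add: cos_add)
  finally show "wave k \<theta> a (x + ivec l) = wave k \<theta> a x" by (simp add: wave_def)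
qed

lemma wave_has_derivative:
  "(wave k \<theta> a has_derivative (\<lambda>v. cos (2 * pi * (x \<bullet> ivec k) + (\<theta> + pi / 2)) *\<^sub>R ((2 * pi * (v \<bullet> ivec k)) *\<^sub>R a))) (at x)"
proof -
  have "((\<lambda>p. cos (2 * pi * (p \<bullet> ivec k) + \<theta>) *\<^sub>R a) has_derivative
      (\<lambda>v. (- sin (2 * pi * (x \<bullet> ivec k) + \<theta>) * (2 * pi * (v \<bullet> ivec k))) *\<^sub>R a)) (at x)"
    by (auto intro!: derivative_eq_intros simp: mult_ac)
  moreover have "cos (2 * pi * (x \<bullet> ivec k) + (\<theta> + pi / 2)) = - sin (2 * pi * (x \<bullet> ivec k) + \<theta>)"
    using cos_add[of "2 * pi * (x \<bullet> ivec k) + \<theta>" "pi / 2"] by (simp add: add.assoc)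
  ultimately show ?thesis unfolding wave_def[abs_def] by simp
qed

lemma partial_wave: "partial j (wave k \<theta> a) = wave k (\<theta> + pi / 2) ((2 * pi * real_of_int (k $ j)) *\<^sub>R a)"
proof
  fix x
  show "partial j (wave k \<theta> a) x = wave k (\<theta> + pi / 2) ((2 * pi * real_of_int (k $ j)) *\<^sub>R a) x"
    unfolding partial_def frechet_derivative_at[OF wave_has_derivative, symmetric]
    by (simp add: wave_def inner_axis')
qed

lemma divergence_wave:
  assumes "a \<bullet> ivec k = 0"
  shows "divergence (wave k \<theta> a) x = 0"
proof -
  have "divergence (wave k \<theta> a) x = cos (2 * pi * (x \<bullet> ivec k) + (\<theta> + pi / 2)) * (2 * pi * (a \<bullet> ivec k))"
  proof -
    have ak: "a \<bullet> ivec k = (\<Sum>j\<in>UNIV. a $ j * real_of_int (k $ j))" by (simp add: inner_vec_def)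
    show ?thesis unfolding divergence_def partial_wave wave_def ak sum_distrib_left
      by (intro sum.cong) (simp_all add: mult_ac)
  qed
  then show ?thesis using assms by simp
qed

lemma laplacian_wave: "laplacian (wave k \<theta> a) x = - ((4 * pi\<^sup>2 * (freq k)\<^sup>2) *\<^sub>R wave k \<theta> a x)"
proof -
  have c: "cos (y + (\<theta> + pi / 2 + pi / 2)) = - cos (y + \<theta>)" for y
    using cos_periodic_pi[of "y + \<theta>"] by (simp add: add.assoc)
  have "laplacian (wave k \<theta> a) x
      = (\<Sum>j\<in>UNIV. - (4 * pi\<^sup>2 * (real_of_int (k $ j))\<^sup>2)) *\<^sub>R wave k \<theta> a x"
    unfolding laplacian_def partial_wave scaleR_sum_left
    by (intro sum.cong refl, unfold wave_def c) (simp add: power2_eq_square mult_ac)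
  also have "(\<Sum>j\<in>UNIV. - (4 * pi\<^sup>2 * (real_of_int (k $ j))\<^sup>2)) = - (4 * pi\<^sup>2 * (freq k)\<^sup>2)"
    by (simp add: sum_negf sum_distrib_left power2_norm_eq_inner inner_vec_def power2_eq_square[of "real_of_int _"])
  finally show ?thesis by simp
qed

lemma grad_wave: "grad (wave k \<theta> (1::real)) = wave k (\<theta> + pi / 2) ((2 * pi) *\<^sub>R ivec k)"
  by (rule ext) (simp add: grad_def partial_wave wave_def vec_eq_iff)

lemma test_field_wave:
  assumes "a \<bullet> ivec k = 0"
  shows "test_field T (\<lambda>t. wave k \<theta> a)"
  unfolding test_field_def using assms by (auto intro: wave_smooth_time wave_periodic divergence_wave)

lemma wave_L2: "wave k \<theta> (a::real^3) \<in> L2_torus"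
proof -
  have c: "continuous_on UNIV (wave k \<theta> a)" unfolding wave_def[abs_def] by (intro continuous_intros)
  have "integrable torus (\<lambda>x. (norm (wave k \<theta> a x))\<^sup>2)"
  proof (rule torus.integrable_const_bound)
    show "AE x in torus. norm ((norm (wave k \<theta> a x))\<^sup>2) \<le> (norm a)\<^sup>2"
      by (rule AE_I2) (auto simp: wave_def intro!: power_mono mult_left_le_one_le)
    show "(\<lambda>x. (norm (wave k \<theta> a x))\<^sup>2) \<in> borel_measurable torus"
      by (intro continuous_imp_measurable_torus continuous_intros c)
  qed
  then show ?thesis using continuous_imp_measurable_torus[OF c] by (simp add: L2_torus_def)
qed

lemma L2_torus_component:
  assumes "w \<in> L2_torus"
  shows "sqint (\<lambda>x. of_real (w x $ j))"
  unfolding sqint_def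
proof
  have w: "w \<in> borel_measurable torus" "integrable torus (\<lambda>x. (norm (w x))\<^sup>2)"
    using assms by (auto simp: L2_torus_def)
  show m: "(\<lambda>x. complex_of_real (w x $ j)) \<in> borel_measurable torus"
    by (rule measurable_compose[OF w(1)]) (intro borel_measurable_continuous_onI continuous_intros)
  show "integrable torus (\<lambda>x. (norm (complex_of_real (w x $ j)))\<^sup>2)"
  proof (rule Bochner_Integration.integrable_bound[OF w(2)])
    show "(\<lambda>x. (norm (complex_of_real (w x $ j)))\<^sup>2) \<in> borel_measurable torus" using m by measurable
    show "AE x in torus. norm ((norm (complex_of_real (w x $ j)))\<^sup>2) \<le> norm ((norm (w x))\<^sup>2)"
    proof (rule AE_I2)
      fix x
      show "norm ((norm (complex_of_real (w x $ j)))\<^sup>2) \<le> norm ((norm (w x))\<^sup>2)"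
        unfolding real_norm_def abs_power2
        by (intro power_mono) (simp_all add: component_le_norm_cart)
    qed
  qed
qed

lemma wave_integral:
  assumes "integrable torus (\<lambda>x. complex_of_real (g x))"
  shows "(LINT x|torus. g x * cos (2 * pi * (x \<bullet> ivec k) + \<theta>)) = Re (cis (- \<theta>) * coef (\<lambda>x. of_real (g x)) k)"
    "integrable torus (\<lambda>x. g x * cos (2 * pi * (x \<bullet> ivec k) + \<theta>))"
proof -
  have i: "integrable torus (\<lambda>x. complex_of_real (g x) * ee (- k) x)"
    by (rule Bochner_Integration.integrable_bound[OF assms])
      (use borel_measurable_times[OF borel_measurable_integrable[OF assms] measurable_ee] in \<open>auto simp: norm_mult\<close>)
  have i': "integrable torus (\<lambda>x. cis (- \<theta>) * (complex_of_real (g x) * ee (- k) x))" using i by simp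
  have eq: "g x * cos (2 * pi * (x \<bullet> ivec k) + \<theta>) = Re (cis (- \<theta>) * (complex_of_real (g x) * ee (- k) x))" for x
    by (simp add: ee_cis cos_add algebra_simps)
  show "(LINT x|torus. g x * cos (2 * pi * (x \<bullet> ivec k) + \<theta>)) = Re (cis (- \<theta>) * coef (\<lambda>x. of_real (g x)) k)"
    unfolding eq integral_Re[OF i'] by (simp add: coef_def)
  show "integrable torus (\<lambda>x. g x * cos (2 * pi * (x \<bullet> ivec k) + \<theta>))"
    unfolding eq by (rule integrable_Re[OF i'])
qed

lemma sqint_imp_integrable: "sqint f \<Longrightarrow> integrable torus f"
  using coef_integrable[of f 0] by simp

lemma pairing_wave:
  assumes w: "w \<in> L2_torus"
  shows "pairing w (wave k \<theta> a) = Re (cis (- \<theta>) * (\<Sum>j\<in>UNIV. a $ j * fourier w k $ j))"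
proof -
  have i: "integrable torus (\<lambda>x. complex_of_real (w x $ j))" for j
    by (rule sqint_imp_integrable[OF L2_torus_component[OF w]])
  have "pairing w (wave k \<theta> a) = (LINT x|torus. (\<Sum>j\<in>UNIV. a $ j * (w x $ j * cos (2 * pi * (x \<bullet> ivec k) + \<theta>))))"
    by (simp add: pairing_def wave_def inner_vec_def sum_distrib_left mult_ac)
  also have "\<dots> = (\<Sum>j\<in>UNIV. a $ j * Re (cis (- \<theta>) * coef (\<lambda>x. of_real (w x $ j)) k))"
    using wave_integral[OF i] by (subst Bochner_Integration.integral_sum) simp_all
  also have "\<dots> = Re (cis (- \<theta>) * (\<Sum>j\<in>UNIV. a $ j * fourier w k $ j))"
    by (simp add: fourier_eq_coef sum_distrib_left Re_sum sum.distrib sum_subtractf algebra_simps)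
  finally show ?thesis .
qed

definition product_coef :: "(real^3 \<Rightarrow> real^3) \<Rightarrow> int^3 \<Rightarrow> 3 \<Rightarrow> 3 \<Rightarrow> complex" where
  "product_coef w k i j = coef (\<lambda>x. of_real (w x $ i) * complex_of_real (w x $ j)) k"

lemma product_coef_has_sum:
  assumes "w \<in> L2_torus"
  shows "((\<lambda>l. fourier w l $ i * fourier w (k - l) $ j) has_sum product_coef w k i j) UNIV"
  unfolding product_coef_def fourier_eq_coef
  by (rule coef_mult_has_sum) (rule L2_torus_component[OF assms])+

lemma convection_wave:
  assumes w: "w \<in> L2_torus"
  shows "convection_pairing w (wave k \<theta> a) =
    Re (cis (- \<theta>) * (2 * pi * \<i> * (\<Sum>i\<in>UNIV. \<Sum>j\<in>UNIV. real_of_int (k $ i) * a $ j * product_coef w k i j)))"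
proof -
  have i: "integrable torus (\<lambda>x. complex_of_real (w x $ i * w x $ j))" for i j
    using sqint_mult[OF L2_torus_component[OF w] L2_torus_component[OF w]] by simp
  \<comment> \<open>Differentiating the wave shifts the phase by pi/2, which appears as a factor -i;
    the minus sign of the convection pairing turns it into +i.\<close>
  have c: "cis (- (\<theta> + pi / 2)) = - \<i> * cis (- \<theta>)"
  proof -
    have "cis (- (\<theta> + pi / 2)) = cis (- (pi / 2)) * cis (- \<theta>)"
      unfolding cis_mult by (rule arg_cong[where f = cis]) simp
    also have "cis (- (pi / 2)) = - \<i>" by (simp add: complex_eq_iff)
    finally show ?thesis .
  qed
  let ?c = "\<lambda>i j. 2 * pi * real_of_int (k $ i) * a $ j" and ?w = "\<lambda>x. cos (2 * pi * (x \<bullet> ivec k) + (\<theta> + pi / 2))"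
  have "convection_pairing w (wave k \<theta> a) =
     - (LINT x|torus. (\<Sum>i\<in>UNIV. \<Sum>j\<in>UNIV. ?c i j *
        ((w x $ i * w x $ j) * ?w x)))"
    unfolding convection_pairing_def partial_wave by (simp add: wave_def mult_ac)
  also have "\<dots> = - (\<Sum>i\<in>UNIV. \<Sum>j\<in>UNIV. ?c i j *
      Re (cis (- (\<theta> + pi / 2)) * coef (\<lambda>x. of_real (w x $ i * w x $ j)) k))"
  proof -
    have "(LINT x|torus. (\<Sum>i\<in>UNIV. \<Sum>j\<in>UNIV. ?c i j *
        ((w x $ i * w x $ j) * ?w x)))
      = (\<Sum>i\<in>UNIV. \<Sum>j\<in>UNIV. LINT x|torus. ?c i j *
        ((w x $ i * w x $ j) * ?w x))"
      using wave_integral(2)[OF i] by (simp add: Bochner_Integration.integral_sum)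
    then show ?thesis by (simp only: integral_mult_right_zero wave_integral(1)[OF i])
  qed
  also have "\<dots> = Re (- (\<Sum>i\<in>UNIV. \<Sum>j\<in>UNIV. of_real (?c i j) *
      (cis (- (\<theta> + pi / 2)) * coef (\<lambda>x. of_real (w x $ i * w x $ j)) k)))"
  proof -
    have "Re (complex_of_real r * z) = r * Re z" for r z by simp
    then show ?thesis by (simp only: Re_sum uminus_complex.sel)
  qed
  also have "(- (\<Sum>i\<in>UNIV. \<Sum>j\<in>UNIV. of_real (?c i j) *
      (cis (- (\<theta> + pi / 2)) * coef (\<lambda>x. of_real (w x $ i * w x $ j)) k)))
    = cis (- \<theta>) * (2 * pi * \<i> * (\<Sum>i\<in>UNIV. \<Sum>j\<in>UNIV. real_of_int (k $ i) * a $ j * product_coef w k i j))"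
    unfolding c product_coef_def by (simp add: sum_distrib_left sum_negf mult_ac)
  finally show ?thesis .
qed

section \<open>Differentiating the integral identity and integrating the linear equation\<close>

text \<open>The integrand is continuous for positive times only. Boundedness makes it integrable on
  (0, t); the integral is cut at t/2, and the fundamental theorem is applied on an interval with t
  in its interior.\<close>

lemma derivative_of_integral_identity:
  fixes R h :: "real \<Rightarrow> real"
  assumes id: "\<And>t. t \<in> open_times T \<Longrightarrow> R t + (LINT \<tau>|lebesgue_on {0<..<t}. h \<tau>) = C"
    and cont: "continuous_on (open_times T) h"
    and bnd: "\<And>t. t \<in> open_times T \<Longrightarrow> \<exists>B. \<forall>\<tau>\<in>{0<..<t}. \<bar>h \<tau>\<bar> \<le> B"
    and t: "t \<in> open_times T"
  shows "(R has_real_derivative - h t) (at t)"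
proof -
  have int: "integrable (lebesgue_on {0<..<s}) h" if s: "s \<in> open_times T" for s
  proof -
    obtain B where B: "\<forall>\<tau>\<in>{0<..<s}. \<bar>h \<tau>\<bar> \<le> B" using bnd[OF s] by blast
    have sub: "{0<..<s} \<subseteq> open_times T" using open_times_mono[OF s] by auto
    interpret finite_measure "lebesgue_on {0<..<s}"
      by (rule finite_measureI) (use s in \<open>simp add: emeasure_restrict_space open_times_def\<close>)
    show ?thesis
    proof (rule integrable_const_bound)
      show "AE x in lebesgue_on {0<..<s}. norm (h x) \<le> B" by (rule AE_I2) (use B in auto)
      show "h \<in> borel_measurable (lebesgue_on {0<..<s})"
        by (rule continuous_imp_measurable_on_sets_lebesgue[OF continuous_on_subset[OF cont sub]]) simp
    qed
  qed
  have t0: "t > 0" using t by (simp add: open_times_def)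
  obtain b where b: "t < b" "b \<in> open_times T"
  proof -
    obtain r where "ereal t < ereal r" "ereal r < T"
      using t ereal_dense2[of "ereal t" T] by (auto simp: open_times_def)
    then show ?thesis using t0 that[of r] by (auto simp: open_times_def)
  qed
  define a where "a = t / 2"
  have a: "0 < a" "a < t" using t0 by (auto simp: a_def)
  have ab: "{a..b} \<subseteq> open_times T" using open_times_mono[OF b(2)] a by auto
  have hab: "continuous_on {a..b} h" by (rule continuous_on_subset[OF cont ab])
  have R: "R s = (C - integral {0..a} h) - integral {a..s} h" if s: "s \<in> {a..b}" for s
  proof -
    have so: "s \<in> open_times T" using ab s by auto
    have "(LINT \<tau>|lebesgue_on {0<..<s}. h \<tau>) = integral {0<..<s} h"
      by (rule lebesgue_integral_eq_integral[OF int[OF so]]) simp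
    also have "\<dots> = integral {0..s} h" by (rule integral_open_interval_real[symmetric])
    also have "\<dots> = integral {0..a} h + integral {a..s} h"
    proof (rule Henstock_Kurzweil_Integration.integral_combine[symmetric])
      have "h integrable_on {0<..<s}"
        using int[OF so] by (rule integrable_on_lebesgue_on) simp
      then show "h integrable_on {0..s}" by (simp add: integrable_on_Icc_iff_Ioo)
    qed (use a s in auto)
    finally show ?thesis using id[OF so] by linarith
  qed
  have deriv: "((\<lambda>s. (C - integral {0..a} h) - integral {a..s} h) has_real_derivative (0 - h t)) (at t within {a..b})"
    by (intro DERIV_diff DERIV_const integral_has_real_derivative hab) (use a b in auto)
  have "(R has_real_derivative 0 - h t) (at t within {a..b})"
    by (rule has_field_derivative_transform_within[OF deriv, where d = 1]) (use a b R in auto)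
  moreover have "at t within {a..b} = at t" by (rule at_within_Icc_at) (use a b in auto)
  ultimately show ?thesis by simp
qed

text \<open>The integrating factor exp(\<tau> z) with z = \<kappa> + i \<omega> has modulus
  exp(\<kappa> \<tau>), so the rotation \<omega> costs nothing. The derivative of E f is E g,
  dominated by the derivative of (M/\<kappa>) exp(\<kappa> \<tau>).\<close>

lemma duhamel_bound:
  fixes f g :: "real \<Rightarrow> complex"
  assumes st: "s \<le> t" and \<kappa>: "\<kappa> > 0"
    and f: "\<And>\<tau>. \<tau> \<in> {s..t} \<Longrightarrow> (f has_vector_derivative (- (Complex \<kappa> \<omega>) * f \<tau> + g \<tau>)) (at \<tau>)"
    and g: "\<And>\<tau>. \<tau> \<in> {s..t} \<Longrightarrow> norm (g \<tau>) \<le> M"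
  shows "norm (f t) \<le> exp (- \<kappa> * (t - s)) * norm (f s) + M / \<kappa>"
proof (cases "s = t")
  case True
  have "M \<ge> 0" using order.trans[OF norm_ge_zero g[of t]] st by simp
  then show ?thesis using True \<kappa> by simp
next
  case False
  then have st: "s < t" using st by simp
  define z where "z = Complex \<kappa> \<omega>"
  define E where "E \<tau> = exp (of_real \<tau> * z)" for \<tau> :: real
  have E: "(E has_vector_derivative z * E \<tau>) (at \<tau> within S)" for \<tau> S
    unfolding E_def by (rule has_vector_derivative_real_field) (auto intro!: derivative_eq_intros)
  have nE: "norm (E \<tau>) = exp (\<kappa> * \<tau>)" for \<tau> by (simp add: E_def z_def mult.commute)
  have d: "((\<lambda>\<tau>. E \<tau> * f \<tau>) has_vector_derivative E \<tau> * g \<tau>) (at \<tau> within S)" if "\<tau> \<in> {s..t}" for \<tau> S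
  proof -
    have "((\<lambda>\<tau>. E \<tau> * f \<tau>) has_vector_derivative (E \<tau> * (- z * f \<tau> + g \<tau>) + z * E \<tau> * f \<tau>)) (at \<tau> within S)"
      by (rule has_vector_derivative_mult[OF E]) (use f[OF that] z_def in \<open>auto intro: has_vector_derivative_at_within\<close>)
    then show ?thesis by (simp add: algebra_simps)
  qed
  have "norm (E t * f t - E s * f s) \<le> M / \<kappa> * exp (\<kappa> * t) - M / \<kappa> * exp (\<kappa> * s)"
  proof (rule differentiable_bound_general[OF st])
    show "continuous_on {s..t} (\<lambda>\<tau>. E \<tau> * f \<tau>)"
      by (rule continuous_on_vector_derivative) (use d in blast)
    show "continuous_on {s..t} (\<lambda>\<tau>. M / \<kappa> * exp (\<kappa> * \<tau>))" by (intro continuous_intros)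
    fix \<tau> assume \<tau>: "s < \<tau>" "\<tau> < t"
    show "((\<lambda>\<tau>. E \<tau> * f \<tau>) has_vector_derivative E \<tau> * g \<tau>) (at \<tau>)" using d \<tau> by simp
    show "((\<lambda>\<tau>. M / \<kappa> * exp (\<kappa> * \<tau>)) has_vector_derivative M * exp (\<kappa> * \<tau>)) (at \<tau>)"
      unfolding has_real_derivative_iff_has_vector_derivative[symmetric]
      using \<kappa> by (auto intro!: derivative_eq_intros)
    show "norm (E \<tau> * g \<tau>) \<le> M * exp (\<kappa> * \<tau>)"
      using g[of \<tau>] \<tau> by (simp add: norm_mult nE mult.commute)
  qed
  then have "norm (E t * f t) \<le> norm (E s * f s) + (M / \<kappa> * exp (\<kappa> * t) - M / \<kappa> * exp (\<kappa> * s))"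
    using norm_triangle_ineq2[of "E t * f t" "E s * f s"] by linarith
  moreover have "M \<ge> 0" using order.trans[OF norm_ge_zero g[of t]] st by simp
  ultimately have "exp (\<kappa> * t) * norm (f t) \<le> exp (\<kappa> * s) * norm (f s) + M / \<kappa> * exp (\<kappa> * t)"
    using \<kappa> by (simp add: norm_mult nE) (smt (verit) divide_nonneg_pos exp_ge_zero mult_nonneg_nonneg)
  then have "norm (f t) \<le> (exp (\<kappa> * s) * norm (f s) + M / \<kappa> * exp (\<kappa> * t)) / exp (\<kappa> * t)"
    by (simp add: pos_le_divide_eq mult.commute)
  also have "\<dots> = exp (\<kappa> * s - \<kappa> * t) * norm (f s) + M / \<kappa>" by (simp add: exp_diff add_divide_distrib)
  also have "\<kappa> * s - \<kappa> * t = - \<kappa> * (t - s)" by (simp add: algebra_simps)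
  finally show ?thesis .
qed

text \<open>Reduces the remainder of an unordered sum to finite sums disjoint from F, the form in
  which the convolution estimates are stated.\<close>

lemma has_sum_tail_le:
  fixes f :: "'a \<Rightarrow> 'b::real_normed_vector"
  assumes f: "(f has_sum s) UNIV" and F: "finite F"
    and tail: "\<And>G. finite G \<Longrightarrow> G \<inter> F = {} \<Longrightarrow> norm (sum f G) \<le> B"
  shows "norm (s - sum f F) \<le> B"
proof (rule tendsto_upperbound)
  show "((\<lambda>G. norm (sum f G - sum f F)) \<longlongrightarrow> norm (s - sum f F)) (finite_subsets_at_top UNIV)"
    using f unfolding has_sum_def by (intro tendsto_intros)
  have "norm (sum f G - sum f F) \<le> B" if "finite G" "F \<subseteq> G" for G
  proof -
    have "sum f G - sum f F = sum f (G - F)" using that by (simp add: sum_diff)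
    then show ?thesis using tail[of "G - F"] that by auto
  qed
  then show "\<forall>\<^sub>F G in finite_subsets_at_top UNIV. norm (sum f G - sum f F) \<le> B"
    unfolding eventually_finite_subsets_at_top using F by auto
qed simp

lemma finite_ivec_ball: "finite {l. freq l < R}"
proof -
  obtain n :: nat where n: "R < n" using reals_Archimedean2 by blast
  have "{l. freq l < R} \<subseteq> {l. \<forall>i. l $ i \<in> {- int n..int n}}"
  proof safe
    fix l :: "int^3" and i assume "freq l < R"
    then have "\<bar>ivec l $ i\<bar> < n" using component_le_norm_cart[of "ivec l" i] n by linarith
    then have "\<bar>l $ i\<bar> < int n" by simp
    then show "l $ i \<in> {- int n..int n}" by auto
  qed
  then show ?thesis by (rule finite_subset) (rule card_int_box, simp)
qed

text \<open>Existential form, so that this and the next two lemmas chain as introduction rules in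
  \<open>rate_bounded\<close>.\<close>

lemma norm_bounded_add:
  fixes f g :: "'a \<Rightarrow> complex"
  assumes "\<exists>B. \<forall>x\<in>S. norm (f x) \<le> B" "\<exists>B. \<forall>x\<in>S. norm (g x) \<le> B"
  shows "\<exists>B. \<forall>x\<in>S. norm (f x + g x) \<le> B"
  using assms by (metis norm_triangle_mono)

lemma norm_bounded_cmult:
  fixes f :: "'a \<Rightarrow> complex"
  assumes "\<exists>B. \<forall>x\<in>S. norm (f x) \<le> B"
  shows "\<exists>B. \<forall>x\<in>S. norm (c * f x) \<le> B"
  using assms by (metis norm_mult mult_left_mono norm_ge_zero)

lemma norm_bounded_sum:
  fixes f :: "'i \<Rightarrow> 'a \<Rightarrow> complex"
  assumes "\<And>i. \<exists>B. \<forall>x\<in>S. norm (f i x) \<le> B"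
  shows "\<exists>B. \<forall>x\<in>S. norm (\<Sum>i\<in>I. f i x) \<le> B"
proof (induction I rule: infinite_finite_induct)
  case (insert i I)
  then show ?case using norm_bounded_add[OF assms insert.IH, of i] by simp
qed auto

section \<open>Differential equations for the modes\<close>

text \<open>Row m of the symbol of the Leray projection, the identity minus k k^T / |k|^2. At k = 0
  division by zero yields the identity, the correct projection of the mean.\<close>

definition leray :: "int^3 \<Rightarrow> 3 \<Rightarrow> real^3" where
  "leray k m = (\<chi> j. (if j = m then 1 else 0) - real_of_int (k $ m) * real_of_int (k $ j) / (freq k)\<^sup>2)"

lemma sum_ivec_square: "(\<Sum>j\<in>UNIV. (real_of_int (k $ j))\<^sup>2) = (freq k)\<^sup>2"
  by (simp add: power2_norm_eq_inner inner_vec_def power2_eq_square[of "real_of_int _"])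

lemma leray_orthogonal: "leray k m \<bullet> ivec k = 0"
proof -
  have "leray k m \<bullet> ivec k = (\<Sum>j\<in>UNIV. (if j = m then real_of_int (k $ j) else 0)
      - real_of_int (k $ m) / (freq k)\<^sup>2 * (real_of_int (k $ j))\<^sup>2)"
    unfolding inner_vec_def by (intro sum.cong) (auto simp: leray_def left_diff_distrib power2_eq_square)
  also have "\<dots> = real_of_int (k $ m) - real_of_int (k $ m) / (freq k)\<^sup>2 * (freq k)\<^sup>2"
    by (simp only: sum_subtractf sum_distrib_left[symmetric] sum_ivec_square) simp
  also have "\<dots> = 0" by (cases "freq k = 0") (auto simp: vec_eq_iff)
  finally show ?thesis .
qed

lemma leray_le: "\<bar>leray k m $ j\<bar> \<le> 2"
proof -
  have "\<bar>real_of_int (k $ m) * real_of_int (k $ j)\<bar> \<le> freq k * freq k"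
    unfolding abs_mult using component_le_norm_cart[of "ivec k"] by (intro mult_mono) auto
  then have "\<bar>real_of_int (k $ m) * real_of_int (k $ j) / (freq k)\<^sup>2\<bar> \<le> 1"
    by (cases "ivec k = 0") (auto simp: power2_eq_square divide_le_eq_1)
  moreover have "\<bar>x\<bar> \<le> 1 \<Longrightarrow> \<bar>(if P then 1 else 0) - x\<bar> \<le> 2" for x :: real and P by auto
  ultimately show ?thesis unfolding leray_def vec_lambda_beta by blast
qed

lemma leray_divergence_free:
  fixes z :: "complex^3"
  assumes "(\<Sum>j\<in>UNIV. real_of_int (k $ j) * z $ j) = 0"
  shows "(\<Sum>j\<in>UNIV. leray k m $ j * z $ j) = z $ m"
proof -
  have "(\<Sum>j\<in>UNIV. leray k m $ j * z $ j) = (\<Sum>j\<in>UNIV. (if j = m then z $ j else 0)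
      - complex_of_real (real_of_int (k $ m) / (freq k)\<^sup>2) * (real_of_int (k $ j) * z $ j))"
    by (intro sum.cong) (auto simp: leray_def left_diff_distrib)
  also have "\<dots> = z $ m" by (simp only: sum_subtractf sum_distrib_left[symmetric] assms) simp
  finally show ?thesis .
qed

lemma open_times_subset: "open_times T \<subseteq> halfopen_times T"
  by (auto simp: open_times_def halfopen_times_def)

lemma open_open_times: "open (open_times T)"
proof -
  have "open_times T = {0<..} \<inter> ereal -` {..<T}" by (auto simp: open_times_def)
  then show ?thesis by (auto intro!: open_Int open_vimage continuous_intros)
qed

text \<open>The bound L holds at every positive time, not only at almost every one, because the mode
  equations are used pointwise in time.\<close>

locale hhalf_solution =
  fixes T :: ereal and \<psi> :: "real^3 \<Rightarrow> real^3" and u :: "real \<Rightarrow> real^3 \<Rightarrow> real^3" and L :: real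
  assumes NS: "NS_solution T \<psi> u" and L_nonneg: "L \<ge> 0"
    and Hhalf: "\<And>t. t \<in> open_times T \<Longrightarrow> u t \<in> Hhalf"
    and Hhalf_norm_le: "\<And>t. t \<in> open_times T \<Longrightarrow> Hhalf_norm (u t) \<le> L"
begin

lemma in_L2: "t \<in> halfopen_times T \<Longrightarrow> u t \<in> L2_torus"
  using NS by (auto simp: NS_solution_def weakly_continuous_L2_def)

lemma in_L2_open: "t \<in> open_times T \<Longrightarrow> u t \<in> L2_torus"
  using in_L2 open_times_subset by blast

text \<open>Testing with the gradient of a phase-shifted cosine shows that the real part of every
  rotation of the sum vanishes; two phases a quarter turn apart suffice.\<close>

lemma divergence_free:
  assumes t: "t \<in> halfopen_times T"
  shows "(\<Sum>j\<in>UNIV. real_of_int (k $ j) * fourier (u t) k $ j) = 0"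
proof -
  let ?z = "\<Sum>j\<in>UNIV. complex_of_real (((2 * pi) *\<^sub>R ivec k) $ j) * fourier (u t) k $ j"
  have 0: "Re (cis (- (\<theta> + pi / 2)) * ?z) = 0" for \<theta>
  proof -
    have "pairing (u t) (grad (wave k \<theta> 1)) = 0"
      using NS t wave_smooth[of UNIV k \<theta> 1] wave_periodic[of k \<theta> 1] by (auto simp: NS_solution_def div_free_def)
    then show ?thesis by (simp only: grad_wave pairing_wave[OF in_L2[OF t]])
  qed
  have "Re ?z = 0" using 0[of "- pi / 2"] by simp
  moreover have "Im ?z = 0" using 0[of 0] by (simp add: Re_sum Im_sum)
  ultimately have "?z = 0" by (simp add: complex_eq_iff)
  then have "(2 * complex_of_real pi) * (\<Sum>j\<in>UNIV. real_of_int (k $ j) * fourier (u t) k $ j) = 0"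
    by (simp add: sum_distrib_left mult.assoc)
  then show ?thesis by simp
qed

lemma continuous_pairing: "continuous_on (halfopen_times T) (\<lambda>t. pairing (u t) (wave k \<theta> a))"
  using NS wave_L2[of k \<theta> a] by (auto simp: NS_solution_def weakly_continuous_L2_def)

lemma continuous_fourier: "continuous_on (halfopen_times T) (\<lambda>t. fourier (u t) k $ j)"
proof -
  have ax: "(\<Sum>i\<in>UNIV. complex_of_real (axis j 1 $ i) * z $ i) = z $ j" for z :: "complex^3"
    by (simp add: axis_def if_distrib if_distribR cong: if_cong)
  have re: "pairing (u t) (wave k 0 (axis j 1)) = Re (fourier (u t) k $ j)" if "t \<in> halfopen_times T" for t
    using pairing_wave[OF in_L2[OF that], of k 0 "axis j 1"] by (simp add: ax)
  have im: "pairing (u t) (wave k (pi / 2) (axis j 1)) = Im (fourier (u t) k $ j)" if "t \<in> halfopen_times T" for t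
    using pairing_wave[OF in_L2[OF that], of k "pi / 2" "axis j 1"] by (simp add: ax)
  have "continuous_on (halfopen_times T) (\<lambda>t. Complex (pairing (u t) (wave k 0 (axis j 1))) (pairing (u t) (wave k (pi / 2) (axis j 1))))"
    unfolding Complex_eq by (intro continuous_intros continuous_pairing)
  then show ?thesis by (rule continuous_on_eq) (simp add: re im complex_eq_iff)
qed

lemma energy:
  assumes t: "t \<in> open_times T" and F: "finite F" "0 \<notin> F"
  shows "(\<Sum>k\<in>F. freq k * (norm (fourier (u t) k))\<^sup>2) \<le> L\<^sup>2"
proof -
  let ?f = "\<lambda>k. freq k * (norm (fourier (u t) k))\<^sup>2"
  have s: "?f summable_on (UNIV - {0})" using Hhalf[OF t] by (simp add: Hhalf_def)
  have "sum ?f F \<le> infsum ?f (UNIV - {0})"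
    by (rule finite_sum_le_infsum[OF s]) (use F in auto)
  also have "\<dots> = (Hhalf_norm (u t))\<^sup>2" unfolding Hhalf_norm_def
    by (subst real_sqrt_pow2) (auto intro!: infsum_nonneg)
  also have "\<dots> \<le> L\<^sup>2"
    using Hhalf_norm_le[OF t] by (intro power_mono) (auto simp: Hhalf_norm_def intro!: infsum_nonneg)
  finally show ?thesis .
qed

abbreviation truncation :: "(int^3) set \<Rightarrow> int^3 \<Rightarrow> 3 \<Rightarrow> 3 \<Rightarrow> real \<Rightarrow> complex" where
  "truncation F k i j t \<equiv> \<Sum>l\<in>F. fourier (u t) l $ i * fourier (u t) (k - l) $ j"

lemma product_term_le:
  "norm (truncation F k i j t)
    \<le> (\<Sum>l\<in>F. norm (fourier (u t) l) * norm (fourier (u t) (k - l)))"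
  by (rule order.trans[OF norm_sum]) (auto simp: norm_mult intro!: sum_mono mult_mono Finite_Cartesian_Product.norm_nth_le)

text \<open>Outside F both frequencies are at least R, so \<open>convolution_energy\<close> applies
  with weight R. The bound is independent of t.\<close>

lemma product_truncation:
  assumes t: "t \<in> open_times T" and R: "R > 0" and F: "finite F" "\<And>l. l \<notin> F \<Longrightarrow> R \<le> freq l \<and> R \<le> freq (k - l)"
  shows "norm (product_coef (u t) k i j - (truncation F k i j t)) \<le> L\<^sup>2 / R"
proof (rule has_sum_tail_le[OF product_coef_has_sum[OF in_L2_open[OF t]] F(1)])
  fix G assume G: "finite G" "G \<inter> F = {}"
  have far: "R \<le> freq l \<and> R \<le> freq (k - l)" if "l \<in> G" for l
    using F(2) G(2) that by blast
  then have "0 \<notin> G" "k \<notin> G" using R by force+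
  moreover have "R \<le> rt l * rt (k - l)" if "l \<in> G" for l
    unfolding rt_def real_sqrt_mult[symmetric]
    using mult_mono[of R "freq l" R "freq (k - l)"] far[OF that] R
    by (intro real_le_rsqrt) (simp add: power2_eq_square)
  ultimately have "(\<Sum>l\<in>G. norm (fourier (u t) l) * norm (fourier (u t) (k - l))) \<le> L\<^sup>2 / R"
    by (intro convolution_energy[where x = "\<lambda>l. norm (fourier (u t) l)", OF _ R energy[OF t] G(1)]) auto
  then show "norm (truncation G k i j t) \<le> L\<^sup>2 / R"
    using product_term_le order.trans by blast
qed

lemma continuous_truncation:
  "continuous_on (halfopen_times T) (truncation F k i j)"
  by (intro continuous_intros continuous_fourier)

text \<open>Weak continuity in L^2 does not pass to products. But finite convolution sums are
  continuous since each mode is, and their tails are small uniformly in time by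
  \<open>product_truncation\<close>.\<close>

lemma continuous_product: "continuous_on (open_times T) (\<lambda>t. product_coef (u t) k i j)"
proof (rule uniform_limit_theorem)
  show "\<forall>\<^sub>F F in finite_subsets_at_top UNIV.
      continuous_on (open_times T) (truncation F k i j)"
    using continuous_on_subset[OF continuous_truncation open_times_subset] by simp
  show "uniform_limit (open_times T) (\<lambda>F. truncation F k i j)
      (\<lambda>t. product_coef (u t) k i j) (finite_subsets_at_top UNIV)"
  proof (rule uniform_limitI)
    fix e :: real assume e: "e > 0"
    define R where "R = (L\<^sup>2 + 1) / e"
    have "L\<^sup>2 + 1 > 0" by (intro add_nonneg_pos) auto
    then have R: "R > 0" using e by (simp add: R_def)
    moreover have "L\<^sup>2 < e * R" using e by (simp add: R_def)
    ultimately have R: "R > 0" "L\<^sup>2 / R < e" by (simp_all add: pos_divide_less_eq)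
    \<comment> \<open>The indices at which one of the two frequencies is below R: a ball around 0
      and its reflection under l -> k - l.\<close>
    define F0 where "F0 = {l. freq l < R} \<union> (\<lambda>l. k - l) ` {l. freq l < R}"
    have F0: "finite F0" by (simp add: F0_def finite_ivec_ball)
    have "dist (truncation F k i j t) (product_coef (u t) k i j) < e"
      if F: "finite F" "F0 \<subseteq> F" and t: "t \<in> open_times T" for F t
    proof -
      have out: "R \<le> freq l \<and> R \<le> freq (k - l)" if "l \<notin> F" for l
      proof (rule conjI; rule ccontr)
        assume "\<not> R \<le> freq l"
        then have "l \<in> F0" by (simp add: F0_def)
        then show False using that F(2) by blast
      next
        assume "\<not> R \<le> freq (k - l)"
        then have "k - (k - l) \<in> F0" unfolding F0_def by (intro UnI2 imageI) simp
        then show False using that F(2) by auto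
      qed
      have "norm (product_coef (u t) k i j - (truncation F k i j t)) \<le> L\<^sup>2 / R"
        by (rule product_truncation[OF t R(1) F(1)]) (rule out)
      then show ?thesis using R(2) by (subst dist_commute) (simp only: dist_norm)
    qed
    then show "\<forall>\<^sub>F F in finite_subsets_at_top UNIV. \<forall>t\<in>open_times T.
        dist (truncation F k i j t) (product_coef (u t) k i j) < e"
      unfolding eventually_finite_subsets_at_top using F0 by auto
  qed
qed simp

lemma bounded_before:
  fixes f :: "real \<Rightarrow> complex"
  assumes t: "t \<in> open_times T" and f: "continuous_on (halfopen_times T) f"
  shows "\<exists>B. \<forall>\<tau>\<in>{0<..<t}. norm (f \<tau>) \<le> B"
proof -
  have "{0..t} \<subseteq> halfopen_times T" using t
    by (auto simp: open_times_def halfopen_times_def intro: le_less_trans[of _ "ereal t"])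
  then have "compact (f ` {0..t})"
    by (intro compact_continuous_image continuous_on_subset[OF f]) auto
  then obtain B where "\<forall>z\<in>f ` {0..t}. norm z \<le> B" by (auto dest!: compact_imp_bounded simp: bounded_iff)
  then show ?thesis by (intro exI[of _ B]) auto
qed

text \<open>With R = 1 only l = 0 and l = k must be split off. These terms are products of modes
  continuous up to time 0, and the energy bounds the remainder.\<close>

lemma product_bounded:
  assumes t: "t \<in> open_times T"
  shows "\<exists>B. \<forall>\<tau>\<in>{0<..<t}. norm (product_coef (u \<tau>) k i j) \<le> B"
proof -
  obtain B where B: "\<forall>\<tau>\<in>{0<..<t}. norm (truncation {0, k} k i j \<tau>) \<le> B"
    using bounded_before[OF t continuous_truncation[where F = "{0, k}" and i = i and j = j and k = k]] by (elim exE)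
  have "norm (product_coef (u \<tau>) k i j) \<le> B + L\<^sup>2" if \<tau>: "\<tau> \<in> {0<..<t}" for \<tau>
  proof -
    have "\<tau> \<in> open_times T" using open_times_mono[OF t] \<tau> by auto
    then have "norm (product_coef (u \<tau>) k i j - truncation {0, k} k i j \<tau>) \<le> L\<^sup>2 / 1"
      by (rule product_truncation) (use freq_ge_1[of "k - _"] freq_ge_1 in \<open>auto simp del: ivec_simps\<close>)
    moreover have "norm (truncation {0, k} k i j \<tau>) \<le> B" using B \<tau> by blast
    ultimately show ?thesis
      using norm_triangle_ineq2[of "product_coef (u \<tau>) k i j" "truncation {0, k} k i j \<tau>"] by linarith
  qed
  then show ?thesis by blast
qed

definition rate :: "int^3 \<Rightarrow> real^3 \<Rightarrow> real \<Rightarrow> complex" where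
  "rate k a t = complex_of_real (4 * pi\<^sup>2 * (freq k)\<^sup>2) * (\<Sum>j\<in>UNIV. a $ j * fourier (u t) k $ j)
    + 2 * pi * \<i> * (\<Sum>i\<in>UNIV. \<Sum>j\<in>UNIV. real_of_int (k $ i) * a $ j * product_coef (u t) k i j)"

lemma continuous_rate: "continuous_on (open_times T) (rate k a)"
  unfolding rate_def[abs_def]
  by (intro continuous_intros continuous_product continuous_on_subset[OF continuous_fourier open_times_subset])

lemma rate_bounded:
  assumes t: "t \<in> open_times T"
  shows "\<exists>B. \<forall>\<tau>\<in>{0<..<t}. norm (rate k a \<tau>) \<le> B"
proof -
  note bd = norm_bounded_add norm_bounded_cmult norm_bounded_sum bounded_before[OF t continuous_fourier] product_bounded[OF t]
  show ?thesis unfolding rate_def by (intro bd)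
qed

text \<open>The weak formulation is tested with waves constant in time, for which the term with the
  time derivative of the test field drops out. Each phase gives one real derivative; 0 and pi/2
  together give the complex one.\<close>

lemma mode_derivative:
  assumes t: "t \<in> open_times T" and a: "a \<bullet> ivec k = 0"
  shows "((\<lambda>t. \<Sum>j\<in>UNIV. a $ j * fourier (u t) k $ j) has_vector_derivative - rate k a t) (at t)"
proof -
  let ?U = "\<lambda>t. \<Sum>j\<in>UNIV. a $ j * fourier (u t) k $ j"
  have *: "((\<lambda>t. Re (cis (- \<theta>) * ?U t)) has_real_derivative - Re (cis (- \<theta>) * rate k a t)) (at t)" for \<theta>
  proof (rule derivative_of_integral_identity[OF _ _ _ t])
    fix s assume s: "s \<in> open_times T"
    then have s': "s \<in> halfopen_times T" using open_times_subset by blast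
    have tf: "test_field T (\<lambda>t. wave k \<theta> a)" by (rule test_field_wave[OF a])
    let ?I = "\<lambda>\<tau>. - pairing (u \<tau>) (\<lambda>x. vector_derivative (\<lambda>s. wave k \<theta> a x) (at \<tau>))
          + grad_pairing (u \<tau>) (wave k \<theta> a) + convection_pairing (u \<tau>) (wave k \<theta> a)"
    have eq: "?I \<tau>
        = Re (cis (- \<theta>) * rate k a \<tau>)" if "\<tau> \<in> {0<..<s}" for \<tau>
    proof -
      have "\<tau> \<in> open_times T" using open_times_mono[OF s] that by auto
      then have w: "u \<tau> \<in> L2_torus" by (rule in_L2_open)
      have "pairing (u \<tau>) (\<lambda>x. vector_derivative (\<lambda>s. wave k \<theta> a x) (at \<tau>)) = 0"
        by (simp add: pairing_def vector_derivative_const_at)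
      moreover have "grad_pairing (u \<tau>) (wave k \<theta> a) = 4 * pi\<^sup>2 * (freq k)\<^sup>2 * Re (cis (- \<theta>) * ?U \<tau>)"
      proof -
        have "pairing (u \<tau>) (laplacian (wave k \<theta> a)) = - (4 * pi\<^sup>2 * (freq k)\<^sup>2) * pairing (u \<tau>) (wave k \<theta> a)"
          unfolding pairing_def laplacian_wave by simp
        then show ?thesis by (simp only: grad_pairing_def pairing_wave[OF w]) simp
      qed
      moreover have "Re (cis (- \<theta>) * rate k a \<tau>) = 4 * pi\<^sup>2 * (freq k)\<^sup>2 * Re (cis (- \<theta>) * ?U \<tau>)
          + Re (cis (- \<theta>) * (2 * pi * \<i> * (\<Sum>i\<in>UNIV. \<Sum>j\<in>UNIV. real_of_int (k $ i) * a $ j * product_coef (u \<tau>) k i j)))"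
      proof -
        have "Re (z * (complex_of_real r * v + w)) = r * Re (z * v) + Re (z * w)" for z v w r
          by (simp add: algebra_simps)
        then show ?thesis unfolding rate_def .
      qed
      ultimately show ?thesis by (simp only: convection_wave[OF w])
    qed
    have "pairing (u s) (wave k \<theta> a) + (LINT \<tau>|lebesgue_on {0<..<s}. ?I \<tau>)
        = pairing \<psi> (wave k \<theta> a)"
      using NS tf s' unfolding NS_solution_def by blast
    moreover have "(LINT \<tau>|lebesgue_on {0<..<s}. ?I \<tau>)
        = (LINT \<tau>|lebesgue_on {0<..<s}. Re (cis (- \<theta>) * rate k a \<tau>))"
      by (rule Bochner_Integration.integral_cong) (use eq in auto)
    ultimately show "Re (cis (- \<theta>) * ?U s) + (LINT \<tau>|lebesgue_on {0<..<s}. Re (cis (- \<theta>) * rate k a \<tau>)) = pairing \<psi> (wave k \<theta> a)"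
      by (simp only: pairing_wave[OF in_L2[OF s']])
  next
    show "continuous_on (open_times T) (\<lambda>t. Re (cis (- \<theta>) * rate k a t))"
      by (intro continuous_intros continuous_rate)
  next
    fix s assume s: "s \<in> open_times T"
    obtain B where B: "\<forall>\<tau>\<in>{0<..<s}. norm (rate k a \<tau>) \<le> B" using rate_bounded[OF s] by blast
    have "\<bar>Re (cis (- \<theta>) * rate k a \<tau>)\<bar> \<le> B" if "\<tau> \<in> {0<..<s}" for \<tau>
    proof -
      have "norm (cis (- \<theta>) * rate k a \<tau>) \<le> B" using B that by (simp add: norm_mult)
      then show ?thesis using abs_Re_le_cmod order.trans by blast
    qed
    then show "\<exists>B. \<forall>\<tau>\<in>{0<..<s}. \<bar>Re (cis (- \<theta>) * rate k a \<tau>)\<bar> \<le> B" by blast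
  qed
  have im: "Re (cis (- (pi / 2)) * z) = Im z" for z by simp
  show ?thesis unfolding has_vector_derivative_complex_iff
    using *[of 0] *[of "pi / 2"] unfolding im by simp
qed

text \<open>Row m of the projection is orthogonal to k, hence an admissible amplitude, and it
  reproduces component m of a divergence-free coefficient. The pressure never appears.\<close>

lemma fourier_derivative:
  assumes t: "t \<in> open_times T"
  shows "((\<lambda>t. fourier (u t) k $ m) has_vector_derivative
    - (complex_of_real (4 * pi\<^sup>2 * (freq k)\<^sup>2) * fourier (u t) k $ m
      + 2 * pi * \<i> * (\<Sum>i\<in>UNIV. \<Sum>j\<in>UNIV. real_of_int (k $ i) * leray k m $ j * product_coef (u t) k i j))) (at t)"
proof -
  have eq: "(\<Sum>j\<in>UNIV. leray k m $ j * fourier (u s) k $ j) = fourier (u s) k $ m" if "s \<in> open_times T" for s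
    by (rule leray_divergence_free) (use divergence_free open_times_subset that in blast)
  have "((\<lambda>t. \<Sum>j\<in>UNIV. leray k m $ j * fourier (u t) k $ j) has_vector_derivative - rate k (leray k m) t) (at t)"
    by (rule mode_derivative[OF t leray_orthogonal])
  then have "((\<lambda>t. fourier (u t) k $ m) has_vector_derivative - rate k (leray k m) t) (at t)"
    by (rule has_vector_derivative_transform_within_open[OF _ open_open_times t]) (rule eq)
  then show ?thesis by (simp add: rate_def eq[OF t])
qed

end

lemma convex_open_times: "convex (open_times T)"
  unfolding convex_contains_segment closed_segment_eq_real_ivl
  by (auto simp: open_times_def intro: le_less_trans[of _ "ereal _"])

lemma norm_vec3_le_sum: "norm (z :: complex^3) \<le> (\<Sum>m\<in>UNIV. norm (z $ m))"
  unfolding norm_vec_def by (rule L2_set_le_sum) simp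

section \<open>The mean and the Duhamel inequality for the modes\<close>

context hhalf_solution
begin

text \<open>At k = 0 the viscous and the convective term both carry a factor k, so the derivative
  vanishes on an interval; the value is real because u is.\<close>

lemma mean_constant:
  obtains c :: "3 \<Rightarrow> real" where "\<And>t m. t \<in> open_times T \<Longrightarrow> fourier (u t) 0 $ m = complex_of_real (c m)"
proof -
  have real_mean: "fourier (u t) 0 $ m = complex_of_real (Re (fourier (u t) 0 $ m))" for t m
    by (simp add: fourier_eq_coef coef_def)
  have "\<exists>z. \<forall>t\<in>open_times T. fourier (u t) 0 $ m = z" for m
  proof -
    have "((\<lambda>t. fourier (u t) 0 $ m) has_vector_derivative 0) (at t within open_times T)" if "t \<in> open_times T" for t
      using fourier_derivative[OF that, of 0 m] by (simp add: has_vector_derivative_at_within)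
    from has_vector_derivative_zero_constant[OF convex_open_times this] show ?thesis by blast
  qed
  then have "\<forall>m. \<exists>z. \<forall>t\<in>open_times T. fourier (u t) 0 $ m = z" by blast
  from choice[OF this] obtain z where z: "fourier (u t) 0 $ m = z m" if "t \<in> open_times T" for t m by blast
  have "fourier (u t) 0 $ m = complex_of_real (Re (z m))" if "t \<in> open_times T" for t m
    using real_mean[of t m] z[OF that] by simp
  then show ?thesis using that[of "\<lambda>m. Re (z m)"] by blast
qed

text \<open>
  Of the two terms of the nonlinearity that contain the mean, one vanishes because the field is
  divergence free and the other is the transport by the mean: it only rotates the phase of the mode.
\<close>

lemma mode_duhamel:
  assumes k: "k \<noteq> 0" and s: "0 < s" "s < t" and t: "t \<in> open_times T"
    and conv: "\<And>\<tau> F. s \<le> \<tau> \<Longrightarrow> \<tau> \<le> t \<Longrightarrow> finite F \<Longrightarrow> 0 \<notin> F \<Longrightarrow> k \<notin> F \<Longrightarrow>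
      (\<Sum>l\<in>F. norm (fourier (u \<tau>) l) * norm (fourier (u \<tau>) (k - l))) \<le> M"
  shows "norm (fourier (u t) k $ m) \<le> exp (- (freq k)\<^sup>2 * (t - s)) * norm (fourier (u s) k $ m) + 3 * M / freq k"
proof -
  obtain c where c: "fourier (u t) 0 $ m = complex_of_real (c m)" if "t \<in> open_times T" for t m
    using mean_constant by blast
  have n: "freq k \<ge> 1" by (rule freq_ge_1[OF k])
  have M: "M \<ge> 0" using conv[of t "{}"] s by simp
  define \<kappa> where "\<kappa> = 4 * pi\<^sup>2 * (freq k)\<^sup>2"
  define \<omega> where "\<omega> = 2 * pi * (\<Sum>i\<in>UNIV. real_of_int (k $ i) * c i)"
  define S where "S \<tau> i j = fourier (u \<tau>) 0 $ i * fourier (u \<tau>) k $ j + fourier (u \<tau>) k $ i * fourier (u \<tau>) 0 $ j" for \<tau> i j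
  define W where "W i j = complex_of_real (real_of_int (k $ i) * leray k m $ j)" for i j
  define g where "g \<tau> = - (complex_of_real (2 * pi) * \<i> * (\<Sum>i\<in>UNIV. \<Sum>j\<in>UNIV. W i j * (product_coef (u \<tau>) k i j - S \<tau> i j)))" for \<tau>
  have \<kappa>: "\<kappa> > 0" unfolding \<kappa>_def using n by (intro mult_pos_pos zero_less_power) auto
  \<comment> \<open>The forcing is 2 pi times a sum of nine terms, each at most 2 |k| M: entries of
    the projection are at most 2, and product coefficients without the mean are at most M.\<close>
  have "norm (fourier (u t) k $ m) \<le> exp (- \<kappa> * (t - s)) * norm (fourier (u s) k $ m) + (36 * pi * freq k * M) / \<kappa>"
  proof (rule duhamel_bound[OF less_imp_le[OF s(2)] \<kappa>])
    fix \<tau> assume \<tau>: "\<tau> \<in> {s..t}"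
    then have \<tau>': "\<tau> \<in> open_times T" using open_times_mono[OF t] s by auto
    have split: "(\<Sum>i\<in>UNIV. \<Sum>j\<in>UNIV. W i j * (A i * B j))
        = (\<Sum>i\<in>UNIV. complex_of_real (real_of_int (k $ i)) * A i) * (\<Sum>j\<in>UNIV. complex_of_real (leray k m $ j) * B j)"
      for A B :: "3 \<Rightarrow> complex"
      unfolding sum_product W_def by (intro sum.cong refl) simp
    have div: "(\<Sum>i\<in>UNIV. complex_of_real (real_of_int (k $ i)) * fourier (u \<tau>) k $ i) = 0"
      using divergence_free[of \<tau> k] \<tau>' open_times_subset by auto
    have "(\<Sum>i\<in>UNIV. \<Sum>j\<in>UNIV. W i j * S \<tau> i j)
        = (\<Sum>i\<in>UNIV. complex_of_real (real_of_int (k $ i)) * fourier (u \<tau>) 0 $ i) * fourier (u \<tau>) k $ m"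
      unfolding S_def distrib_left sum.distrib split div leray_divergence_free[OF div] by simp
    also have "(\<Sum>i\<in>UNIV. complex_of_real (real_of_int (k $ i)) * fourier (u \<tau>) 0 $ i) = complex_of_real (\<omega> / (2 * pi))"
      by (simp add: c[OF \<tau>'] \<omega>_def)
    finally have SS: "(\<Sum>i\<in>UNIV. \<Sum>j\<in>UNIV. W i j * S \<tau> i j) = complex_of_real (\<omega> / (2 * pi)) * fourier (u \<tau>) k $ m" .
    define Q where "Q = (\<Sum>i\<in>UNIV. \<Sum>j\<in>UNIV. W i j * product_coef (u \<tau>) k i j)"
    have g: "g \<tau> = - (complex_of_real (2 * pi) * \<i> * (Q - complex_of_real (\<omega> / (2 * pi)) * fourier (u \<tau>) k $ m))"
      unfolding g_def Q_def SS[symmetric] by (simp add: right_diff_distrib sum_subtractf)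
    have "- (Complex \<kappa> \<omega>) * fourier (u \<tau>) k $ m + g \<tau>
        = - (complex_of_real \<kappa> * fourier (u \<tau>) k $ m + complex_of_real (2 * pi) * \<i> * Q)"
      unfolding g Complex_eq by (simp add: algebra_simps)
    then show "((\<lambda>t. fourier (u t) k $ m) has_vector_derivative - (Complex \<kappa> \<omega>) * fourier (u \<tau>) k $ m + g \<tau>) (at \<tau>)"
      using fourier_derivative[OF \<tau>', of k m] by (simp only: Q_def W_def \<kappa>_def)
    have trunc: "norm (product_coef (u \<tau>) k i j - S \<tau> i j) \<le> M" for i j
    proof -
      have "norm (product_coef (u \<tau>) k i j - (\<Sum>l\<in>{0, k}. fourier (u \<tau>) l $ i * fourier (u \<tau>) (k - l) $ j)) \<le> M"
      proof (rule has_sum_tail_le[OF product_coef_has_sum[OF in_L2_open[OF \<tau>']]])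
        fix G assume "finite G" "G \<inter> {0, k} = {}"
        then have "(\<Sum>l\<in>G. norm (fourier (u \<tau>) l) * norm (fourier (u \<tau>) (k - l))) \<le> M"
          using conv[of \<tau> G] \<tau> by auto
        then show "norm (\<Sum>l\<in>G. fourier (u \<tau>) l $ i * fourier (u \<tau>) (k - l) $ j) \<le> M"
          using product_term_le order.trans by blast
      qed simp
      then show ?thesis using k by (simp add: S_def)
    qed
    have W: "norm (W i j) \<le> 2 * freq k" for i j
    proof -
      have "norm (W i j) = \<bar>ivec k $ i\<bar> * \<bar>leray k m $ j\<bar>" by (simp add: W_def norm_mult)
      also have "\<dots> \<le> freq k * 2"
        by (intro mult_mono component_le_norm_cart leray_le) auto
      finally show ?thesis by simp
    qed
    have "norm (\<Sum>i\<in>UNIV. \<Sum>j\<in>UNIV. W i j * (product_coef (u \<tau>) k i j - S \<tau> i j))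
        \<le> (\<Sum>i\<in>(UNIV::3 set). \<Sum>j\<in>(UNIV::3 set). 2 * freq k * M)"
    proof (intro order.trans[OF norm_sum] sum_mono)
      fix i j :: 3
      show "norm (W i j * (product_coef (u \<tau>) k i j - S \<tau> i j)) \<le> 2 * freq k * M"
        unfolding norm_mult by (intro mult_mono W trunc) auto
    qed
    then have "norm (g \<tau>) \<le> 2 * pi * (18 * freq k * M)"
      by (simp add: g_def norm_mult mult_ac)
    then show "norm (g \<tau>) \<le> 36 * pi * freq k * M" by simp
  qed
  also have "36 * pi * freq k * M / \<kappa> = 9 * M / (pi * freq k)"
    using n by (simp add: \<kappa>_def power2_eq_square)
  also have "9 * M / (pi * freq k) \<le> 9 * M / (3 * freq k)"
    using n M pi_gt3 by (intro divide_left_mono mult_right_mono mult_pos_pos) auto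
  also have "9 * M / (3 * freq k) = 3 * M / freq k" by simp
  also have "exp (- \<kappa> * (t - s)) \<le> exp (- (freq k)\<^sup>2 * (t - s))"
  proof -
    have "(freq k)\<^sup>2 \<le> \<kappa>"
    proof -
      have "1 \<le> pi\<^sup>2" using pi_gt3 by (intro one_le_power) auto
      then show ?thesis unfolding \<kappa>_def by (simp add: mult_le_cancel_right1)
    qed
    then show ?thesis using s by (simp add: mult_right_mono)
  qed
  finally show ?thesis by (simp add: mult_right_mono)
qed

lemma flow: "lattice_flow (\<lambda>k t. norm (fourier (u t) k)) T L"
proof
  fix k :: "int^3" and s t M :: real
  assume *: "k \<noteq> 0" "0 < s" "s < t" "t \<in> open_times T"
    "\<And>\<tau> F. s \<le> \<tau> \<Longrightarrow> \<tau> \<le> t \<Longrightarrow> finite F \<Longrightarrow> 0 \<notin> F \<Longrightarrow> k \<notin> F \<Longrightarrow>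
      (\<Sum>l\<in>F. norm (fourier (u \<tau>) l) * norm (fourier (u \<tau>) (k - l))) \<le> M"
  let ?e = "exp (- (freq k)\<^sup>2 * (t - s))"
  have "norm (fourier (u t) k) \<le> (\<Sum>m\<in>UNIV. norm (fourier (u t) k $ m))" by (rule norm_vec3_le_sum)
  also have "\<dots> \<le> (\<Sum>m\<in>(UNIV::3 set). ?e * norm (fourier (u s) k) + 3 * M / freq k)"
  proof (rule sum_mono)
    fix m :: 3
    have "norm (fourier (u t) k $ m) \<le> ?e * norm (fourier (u s) k $ m) + 3 * M / freq k"
      by (rule mode_duhamel[OF *])
    also have "\<dots> \<le> ?e * norm (fourier (u s) k) + 3 * M / freq k"
      by (intro add_right_mono mult_left_mono Finite_Cartesian_Product.norm_nth_le) simp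
    finally show "norm (fourier (u t) k $ m) \<le> ?e * norm (fourier (u s) k) + 3 * M / freq k" .
  qed
  also have "\<dots> = 3 * ?e * norm (fourier (u s) k) + 9 * M / freq k" by simp
  finally show "norm (fourier (u t) k) \<le> 3 * ?e * norm (fourier (u s) k) + 9 * M / freq k" .
qed (use energy L_nonneg in auto)

lemma fourier_decay:
  assumes "L \<le> 1 / 40000" "t \<in> open_times T" "k \<noteq> 0"
  shows "norm (fourier (u t) k) \<le> 192 * L / t\<^sup>2 / rt k ^ 9"
  by (rule lattice_flow.decay[OF flow assms])

text \<open>The mode k = 0 lies outside the decay estimate but is constant in time, so it fits a
  bound with weight 1 + |k|.\<close>

lemma fourier_rapid_decay:
  assumes L: "L \<le> 1 / 40000" and \<rho>: "\<rho> > 0"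
  shows "\<exists>B. \<forall>t\<in>open_times T. \<rho> \<le> t \<longrightarrow> (\<forall>k. (1 + freq k) ^ p * norm (fourier (u t) k $ m) \<le> B)"
proof -
  from lattice_flow.rapid_decay[OF flow L \<rho>, of p] obtain B where B: "B \<ge> 0" and
    dec: "\<forall>t\<in>open_times T. \<rho> \<le> t \<longrightarrow> (\<forall>k. k \<noteq> 0 \<longrightarrow> norm (fourier (u t) k) \<le> B / freq k ^ (4 + p))"
    by (elim exE conjE)
  obtain c where c: "fourier (u t) 0 $ m = complex_of_real (c m)" if "t \<in> open_times T" for t m
    using mean_constant by blast
  have "(1 + freq k) ^ p * norm (fourier (u t) k $ m) \<le> 2 ^ p * B + \<bar>c m\<bar>"
    if t: "t \<in> open_times T" "\<rho> \<le> t" for t k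
  proof (cases "k = 0")
    case True
    then show ?thesis using c[OF t(1)] B by simp
  next
    case False
    have n: "freq k \<ge> 1" by (rule freq_ge_1[OF False])
    have "norm (fourier (u t) k $ m) \<le> norm (fourier (u t) k)" by (rule Finite_Cartesian_Product.norm_nth_le)
    also have "\<dots> \<le> B / freq k ^ (4 + p)" using dec t False by blast
    also have "\<dots> \<le> B / freq k ^ p"
      using n B by (intro divide_left_mono power_increasing mult_pos_pos zero_less_power) auto
    finally have "(1 + freq k) ^ p * norm (fourier (u t) k $ m) \<le> (2 * freq k) ^ p * (B / freq k ^ p)"
      using n by (intro mult_mono power_mono) auto
    also have "\<dots> = 2 ^ p * B"
    proof -
      have "freq k ^ p \<noteq> 0" using n by auto
      then show ?thesis by (simp add: power_mult_distrib del: power_eq_0_iff)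
    qed
    finally show ?thesis by simp
  qed
  then show ?thesis by blast
qed

end

section \<open>Smoothness of rapidly decaying Fourier series\<close>

text \<open>Unlike |k| this is positive at k = 0 and satisfies \<open>weight_le_mult\<close>, which
  transfers polynomial decay from the factors to a convolution.\<close>

definition weight :: "int^3 \<Rightarrow> real" where
  "weight k = 1 + freq k"

lemma weight_ge_1: "weight k \<ge> 1" and weight_pos: "weight k > 0"
  by (simp_all add: weight_def add_pos_nonneg)

lemma weight_le_mult: "weight k \<le> weight l * weight (k - l)"
proof -
  have "weight k \<le> weight l + freq (k - l)"
    using freq_triangle[of k l] by (simp add: weight_def del: ivec_simps)
  also have "\<dots> \<le> weight l + weight l * freq (k - l)"
    using weight_ge_1[of l] by (simp add: mult_le_cancel_right1)
  also have "\<dots> = weight l * weight (k - l)" by (simp add: weight_def distrib_left del: ivec_simps)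
  finally show ?thesis .
qed

lemma weight_summable: "(\<lambda>k. 1 / weight k ^ 4) summable_on UNIV"
proof (rule nonneg_bdd_above_summable_on)
  have "(\<Sum>k\<in>F. 1 / weight k ^ 4) \<le> 433" if F: "finite F" for F
  proof -
    have "(\<Sum>k\<in>F. 1 / weight k ^ 4) \<le> (\<Sum>k\<in>insert 0 (F - {0}). 1 / weight k ^ 4)"
      by (rule sum_mono2) (use F weight_pos in \<open>auto simp: less_imp_le\<close>)
    also have "\<dots> = 1 + (\<Sum>k\<in>F - {0}. 1 / weight k ^ 4)"
      using F by (subst sum.insert) (auto simp: weight_def)
    also have "(\<Sum>k\<in>F - {0}. 1 / weight k ^ 4) \<le> (\<Sum>k\<in>F - {0}. 1 / (freq k * max (freq k) 1 ^ 3))"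
    proof (rule sum_mono)
      fix k assume "k \<in> F - {0}"
      then have n: "freq k \<ge> 1" using freq_ge_1 by auto
      then have "freq k * max (freq k) 1 ^ 3 = freq k ^ 4"
        by (simp add: max_absorb1 eval_nat_numeral)
      also have "\<dots> \<le> weight k ^ 4" by (intro power_mono) (auto simp: weight_def)
      finally show "1 / weight k ^ 4 \<le> 1 / (freq k * max (freq k) 1 ^ 3)"
        using n by (intro divide_left_mono mult_pos_pos zero_less_power) (auto intro: weight_pos)
    qed
    also have "\<dots> \<le> 432" using lattice_sum[of 1 "F - {0}"] F by simp
    finally show ?thesis by simp
  qed
  then show "bdd_above (sum (\<lambda>k. 1 / weight k ^ 4) ` {F. F \<subseteq> UNIV \<and> finite F})"
    by (intro bdd_aboveI[of _ 433]) auto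
qed (simp add: weight_pos less_imp_le)

lemma dominated_summable:
  fixes f :: "int^3 \<Rightarrow> 'b::banach"
  assumes "\<And>k. norm (f k) \<le> B / weight k ^ 4"
  shows "f abs_summable_on UNIV" "f summable_on UNIV" "norm (infsum f UNIV) \<le> B * (\<Sum>\<^sub>\<infinity>k. 1 / weight k ^ 4)"
proof -
  have s: "(\<lambda>k. B * (1 / weight k ^ 4)) summable_on UNIV"
    by (rule summable_on_cmult_right[OF weight_summable])
  show a: "f abs_summable_on UNIV"
    by (rule Infinite_Sum.abs_summable_on_comparison_test'[OF s]) (use assms in simp)
  show "f summable_on UNIV" by (rule abs_summable_summable[OF a])
  have "norm (infsum f UNIV) \<le> (\<Sum>\<^sub>\<infinity>k. norm (f k))" by (rule norm_infsum_bound[OF a])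
  also have "\<dots> \<le> (\<Sum>\<^sub>\<infinity>k. B * (1 / weight k ^ 4))"
    by (rule infsum_mono[OF a s]) (use assms in simp)
  also have "\<dots> = B * (\<Sum>\<^sub>\<infinity>k. 1 / weight k ^ 4)" by (rule infsum_cmult_right')
  finally show "norm (infsum f UNIV) \<le> B * (\<Sum>\<^sub>\<infinity>k. 1 / weight k ^ 4)" .
qed

lemma continuous_on_dominated_infsum:
  fixes f :: "int^3 \<Rightarrow> 'a::topological_space \<Rightarrow> 'b::banach"
  assumes "\<And>k. continuous_on S (f k)" "\<And>k x. x \<in> S \<Longrightarrow> norm (f k x) \<le> B / weight k ^ 4"
  shows "continuous_on S (\<lambda>x. \<Sum>\<^sub>\<infinity>k. f k x)"
proof (rule uniform_limit_theorem)
  have "(\<lambda>k. B * (1 / weight k ^ 4)) summable_on UNIV"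
    by (rule summable_on_cmult_right[OF weight_summable])
  then show "uniform_limit S (\<lambda>F x. \<Sum>k\<in>F. f k x) (\<lambda>x. \<Sum>\<^sub>\<infinity>k. f k x) (finite_subsets_at_top UNIV)"
    by (intro Weierstrass_m_test_general[where M = "\<lambda>k. B * (1 / weight k ^ 4)"]) (use assms(2) in auto)
  show "\<forall>\<^sub>F F in finite_subsets_at_top UNIV. continuous_on S (\<lambda>x. \<Sum>k\<in>F. f k x)"
    by (intro always_eventually allI continuous_on_sum assms(1))
qed simp

text \<open>Balls are a sequence cofinal among the finite sets. Through them theorems on sequences,
  such as dominated convergence and differentiation of limits, apply to unordered sums.\<close>

lemma filterlim_ivec_ball:
  "filterlim (\<lambda>n. {k. freq k < real n}) (finite_subsets_at_top UNIV) sequentially"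
  unfolding filterlim_finite_subsets_at_top
proof (intro allI impI)
  fix X :: "(int^3) set" assume X: "finite X \<and> X \<subseteq> UNIV"
  obtain N :: nat where N: "Max (insert 0 ((\<lambda>k. freq k) ` X)) < N" using reals_Archimedean2 by blast
  have "\<forall>k\<in>X. freq k < N" using N X by auto
  then show "\<forall>\<^sub>F n in sequentially. finite {k. freq k < real n} \<and> X \<subseteq> {k. freq k < real n} \<and> {k. freq k < real n} \<subseteq> UNIV"
    by (intro eventually_sequentiallyI[of N]) (auto simp: finite_ivec_ball intro: less_le_trans)
qed

text \<open>The derivatives of the partial sums over balls converge uniformly, as their tails are
  bounded by those of the summable majorant \<open>M\<close>; the theorem on derivatives of
  sequences identifies the derivative of the limit.\<close>

lemma has_derivative_dominated_infsum:
  fixes f :: "int^3 \<Rightarrow> 'a::real_normed_vector \<Rightarrow> 'b::banach"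
  assumes S: "open S" "convex S" and x: "x \<in> S"
    and der: "\<And>k x. x \<in> S \<Longrightarrow> (f k has_derivative f' k x) (at x)"
    and bound': "\<And>k x h. x \<in> S \<Longrightarrow> norm (f' k x h) \<le> B / weight k ^ 4 * norm h"
    and bound: "\<And>k x. x \<in> S \<Longrightarrow> norm (f k x) \<le> B / weight k ^ 4"
  shows "((\<lambda>x. \<Sum>\<^sub>\<infinity>k. f k x) has_derivative (\<lambda>h. \<Sum>\<^sub>\<infinity>k. f' k x h)) (at x)"
proof -
  define E where "E n = {k. freq k < real n}" for n
  have E: "filterlim E (finite_subsets_at_top UNIV) sequentially"
    using filterlim_ivec_ball unfolding E_def .
  have fE: "finite (E n)" for n by (simp add: E_def finite_ivec_ball)
  define M where "M k = B * (1 / weight k ^ 4)" for k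
  have M: "M summable_on UNIV" unfolding M_def by (rule summable_on_cmult_right[OF weight_summable])
  have M0: "M k \<ge> 0" for k using order.trans[OF norm_ge_zero bound[OF x, of k]] by (simp add: M_def)
  have "((\<lambda>n. sum M (E n)) \<longlonglongrightarrow> infsum M UNIV)"
    using filterlim_compose[OF _ E] has_sum_infsum[OF M] unfolding has_sum_def by blast
  then have tail: "\<forall>\<^sub>F n in sequentially. infsum M UNIV - sum M (E n) < e" if "e > 0" for e
  proof -
    assume "(\<lambda>n. sum M (E n)) \<longlonglongrightarrow> infsum M UNIV"
    from order_tendstoD(1)[OF this, of "infsum M UNIV - e"] that
    have "\<forall>\<^sub>F n in sequentially. infsum M UNIV - e < sum M (E n)" by simp
    then show ?thesis by eventually_elim linarith
  qed
  have sum': "(\<lambda>k. f' k y h) summable_on UNIV" if "y \<in> S" for y h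
    by (rule dominated_summable(2)[where B = "B * norm h"]) (use bound'[OF that, of _ h] in simp)
  have sumf: "(\<lambda>k. f k y) summable_on UNIV" if "y \<in> S" for y
    by (rule dominated_summable(2)) (rule bound[OF that])
  have lim: "(\<lambda>n. \<Sum>k\<in>E n. f k y) \<longlonglongrightarrow> (\<Sum>\<^sub>\<infinity>k. f k y)" if "y \<in> S" for y
    using filterlim_compose[OF _ E] has_sum_infsum[OF sumf[OF that]] unfolding has_sum_def by blast
  have "\<exists>g. \<forall>y\<in>S. (\<lambda>n. \<Sum>k\<in>E n. f k y) \<longlonglongrightarrow> g y \<and> (g has_derivative (\<lambda>h. \<Sum>\<^sub>\<infinity>k. f' k y h)) (at y within S)"
  proof (rule has_derivative_sequence[where f = "\<lambda>n y. \<Sum>k\<in>E n. f k y" and f' = "\<lambda>n y h. \<Sum>k\<in>E n. f' k y h"])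
    show "convex S" by (rule S)
    show "x \<in> S" by (rule x)
    show "(\<lambda>n. \<Sum>k\<in>E n. f k x) \<longlonglongrightarrow> (\<Sum>\<^sub>\<infinity>k. f k x)" by (rule lim[OF x])
    show "((\<lambda>y. \<Sum>k\<in>E n. f k y) has_derivative (\<lambda>h. \<Sum>k\<in>E n. f' k y h)) (at y within S)" if "y \<in> S" for n y
      by (rule has_derivative_sum) (rule has_derivative_at_withinI[OF der[OF that]])
    fix e :: real assume "e > 0"
    from tail[OF this] show "\<forall>\<^sub>F n in sequentially. \<forall>y\<in>S. \<forall>h. norm ((\<Sum>k\<in>E n. f' k y h) - (\<Sum>\<^sub>\<infinity>k. f' k y h)) \<le> e * norm h"
    proof eventually_elim
      case (elim n)
      show ?case
      proof (intro ballI allI)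
        fix y h assume y: "y \<in> S"
        have "norm ((\<Sum>\<^sub>\<infinity>k. f' k y h) - (\<Sum>k\<in>E n. f' k y h)) \<le> e * norm h"
        proof (rule has_sum_tail_le[OF has_sum_infsum[OF sum'[OF y]] fE])
          fix G assume G: "finite G" "G \<inter> E n = {}"
          have "norm (\<Sum>k\<in>G. f' k y h) \<le> (\<Sum>k\<in>G. M k * norm h)"
            by (intro order.trans[OF norm_sum] sum_mono) (use bound'[OF y] in \<open>simp add: M_def\<close>)
          also have "\<dots> = sum M G * norm h" by (rule sum_distrib_right[symmetric])
          also have "sum M G \<le> e"
          proof -
            have "sum M G + sum M (E n) = sum M (G \<union> E n)"
              by (rule sum.union_disjoint[symmetric]) (use G fE in auto)
            also have "\<dots> \<le> infsum M UNIV"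
              by (rule finite_sum_le_infsum[OF M]) (use G fE M0 in auto)
            finally show ?thesis using elim by linarith
          qed
          finally show "norm (\<Sum>k\<in>G. f' k y h) \<le> e * norm h" by (simp add: mult_right_mono)
        qed
        then show "norm ((\<Sum>k\<in>E n. f' k y h) - (\<Sum>\<^sub>\<infinity>k. f' k y h)) \<le> e * norm h"
          by (simp add: norm_minus_commute)
      qed
    qed
  qed
  then obtain g where g: "\<And>y. y \<in> S \<Longrightarrow> (\<lambda>n. \<Sum>k\<in>E n. f k y) \<longlonglongrightarrow> g y"
    "(g has_derivative (\<lambda>h. \<Sum>\<^sub>\<infinity>k. f' k x h)) (at x within S)" using x by blast
  have eq: "g y = (\<Sum>\<^sub>\<infinity>k. f k y)" if "y \<in> S" for y
    using LIMSEQ_unique[OF g(1)[OF that] lim[OF that]] .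
  have "(g has_derivative (\<lambda>h. \<Sum>\<^sub>\<infinity>k. f' k x h)) (at x)"
    using g(2) by (simp only: at_within_open[OF x S(1)])
  then show ?thesis by (rule has_derivative_transform_within_open[OF _ S(1) x]) (rule eq)
qed

text \<open>
  Uniformity in time is only required away from time 0, where no smoothness is claimed.
\<close>

definition rapid :: "real set \<Rightarrow> (int^3 \<Rightarrow> real \<Rightarrow> complex) \<Rightarrow> bool" where
  "rapid S c \<longleftrightarrow> (\<forall>\<rho>>0. \<forall>p. \<exists>B. \<forall>t\<in>S. \<rho> \<le> t \<longrightarrow> (\<forall>k. weight k ^ p * norm (c k t) \<le> B))"

text \<open>Regularity of order n in time: all derivatives up to order n decay rapidly and the last
  one is continuous. The recursion on the derivative family makes the closure properties
  inductive.\<close>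

primrec smooth_family :: "nat \<Rightarrow> real set \<Rightarrow> (int^3 \<Rightarrow> real \<Rightarrow> complex) \<Rightarrow> bool" where
  "smooth_family 0 S c \<longleftrightarrow> rapid S c \<and> (\<forall>k. continuous_on S (c k))"
| "smooth_family (Suc n) S c \<longleftrightarrow> rapid S c \<and>
    (\<exists>d. (\<forall>k. \<forall>t\<in>S. (c k has_vector_derivative d k t) (at t)) \<and> smooth_family n S d)"

lemma smooth_family_rapid: "smooth_family n S c \<Longrightarrow> rapid S c"
  by (cases n) auto

lemma smooth_family_Suc: "smooth_family (Suc n) S c \<Longrightarrow> smooth_family n S c"
proof (induction n arbitrary: c)
  case 0
  then show ?case
    by (auto intro!: continuous_at_imp_continuous_on dest: has_vector_derivative_continuous)
next
  case (Suc n)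
  then show ?case by (metis smooth_family.simps(2))
qed

lemma rapidD:
  assumes "rapid S c" "\<rho> > 0"
  obtains B where "B \<ge> 0" "\<And>t k. t \<in> S \<Longrightarrow> \<rho> \<le> t \<Longrightarrow> norm (c k t) \<le> B / weight k ^ p"
proof -
  obtain B where B: "\<forall>t\<in>S. \<rho> \<le> t \<longrightarrow> (\<forall>k. weight k ^ p * norm (c k t) \<le> B)"
    using assms unfolding rapid_def by blast
  have "norm (c k t) \<le> \<bar>B\<bar> / weight k ^ p" if "t \<in> S" "\<rho> \<le> t" for t k
  proof -
    have "weight k ^ p * norm (c k t) \<le> B" using B that by blast
    then have "weight k ^ p * norm (c k t) \<le> \<bar>B\<bar>" by linarith
    then show ?thesis using weight_pos by (simp add: pos_le_divide_eq mult.commute)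
  qed
  then show ?thesis using that[of "\<bar>B\<bar>"] by simp
qed

lemma rapidI:
  assumes "\<And>\<rho> p. \<rho> > 0 \<Longrightarrow> \<exists>B. \<forall>t\<in>S. \<rho> \<le> t \<longrightarrow> (\<forall>k. norm (c k t) \<le> B / weight k ^ p)"
  shows "rapid S c"
  unfolding rapid_def
proof (intro allI impI)
  fix \<rho> :: real and p assume "\<rho> > 0"
  then obtain B where "\<forall>t\<in>S. \<rho> \<le> t \<longrightarrow> (\<forall>k. norm (c k t) \<le> B / weight k ^ p)" using assms by blast
  then show "\<exists>B. \<forall>t\<in>S. \<rho> \<le> t \<longrightarrow> (\<forall>k. weight k ^ p * norm (c k t) \<le> B)"
    using weight_pos by (intro exI[of _ B]) (simp add: pos_le_divide_eq mult.commute)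
qed

lemma rapid_add:
  assumes "rapid S c" "rapid S d"
  shows "rapid S (\<lambda>k t. c k t + d k t)"
proof (rule rapidI)
  fix \<rho> :: real and p assume \<rho>: "\<rho> > 0"
  obtain B where B: "\<And>t k. t \<in> S \<Longrightarrow> \<rho> \<le> t \<Longrightarrow> norm (c k t) \<le> B / weight k ^ p" using rapidD[OF assms(1) \<rho>] by blast
  obtain C where C: "\<And>t k. t \<in> S \<Longrightarrow> \<rho> \<le> t \<Longrightarrow> norm (d k t) \<le> C / weight k ^ p" using rapidD[OF assms(2) \<rho>] by blast
  have "norm (c k t + d k t) \<le> (B + C) / weight k ^ p" if "t \<in> S" "\<rho> \<le> t" for t k
    unfolding add_divide_distrib using B[OF that] C[OF that] by (rule norm_triangle_mono)
  then show "\<exists>B. \<forall>t\<in>S. \<rho> \<le> t \<longrightarrow> (\<forall>k. norm (c k t + d k t) \<le> B / weight k ^ p)" by blast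
qed

lemma rapid_multiplier:
  assumes "rapid S c" and m: "\<And>k. norm (m k) \<le> C * weight k ^ q"
  shows "rapid S (\<lambda>k t. m k * c k t)"
proof (rule rapidI)
  fix \<rho> :: real and p assume \<rho>: "\<rho> > 0"
  obtain B where B: "B \<ge> 0" "\<And>t k. t \<in> S \<Longrightarrow> \<rho> \<le> t \<Longrightarrow> norm (c k t) \<le> B / weight k ^ (p + q)" using rapidD[OF assms(1) \<rho>] by blast
  have "norm (m k * c k t) \<le> (C * B) / weight k ^ p" if "t \<in> S" "\<rho> \<le> t" for t k
  proof -
    have "norm (m k * c k t) \<le> (C * weight k ^ q) * (B / weight k ^ (p + q))"
      unfolding norm_mult using m[of k] order.trans[OF norm_ge_zero m[of k]] B(2)[OF that, of k] by (intro mult_mono) auto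
    also have "\<dots> = (C * B) / weight k ^ p" using weight_pos[of k] by (simp add: power_add)
    finally show ?thesis .
  qed
  then show "\<exists>B. \<forall>t\<in>S. \<rho> \<le> t \<longrightarrow> (\<forall>k. norm (m k * c k t) \<le> B / weight k ^ p)" by blast
qed

text \<open>Four extra powers on the first factor make the sum over l converge; the p common powers
  combine by \<open>weight_le_mult\<close> into a power of \<open>weight k\<close>.\<close>

lemma convolution_term_bound:
  assumes "norm (a l) \<le> B / weight l ^ (p + 4)" "norm (b (k - l)) \<le> C / weight (k - l) ^ p" "B \<ge> 0" "C \<ge> 0"
  shows "norm (a l * b (k - l) :: complex) \<le> (B * C / weight k ^ p) / weight l ^ 4"
proof -
  have "norm (a l * b (k - l)) \<le> (B / weight l ^ (p + 4)) * (C / weight (k - l) ^ p)"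
    unfolding norm_mult using assms by (intro mult_mono) (auto simp: weight_pos less_imp_le)
  also have "\<dots> = (B * C / (weight l * weight (k - l)) ^ p) / weight l ^ 4"
    by (simp add: power_add power_mult_distrib mult_ac)
  also have "\<dots> \<le> (B * C / weight k ^ p) / weight l ^ 4"
    using assms weight_le_mult[of k l] weight_pos
    by (intro divide_right_mono divide_left_mono power_mono mult_pos_pos zero_less_power) (auto simp: less_imp_le)
  finally show ?thesis .
qed

abbreviation conv :: "(int^3 \<Rightarrow> real \<Rightarrow> complex) \<Rightarrow> (int^3 \<Rightarrow> real \<Rightarrow> complex) \<Rightarrow> int^3 \<Rightarrow> real \<Rightarrow> complex" where
  "conv c d k t \<equiv> \<Sum>\<^sub>\<infinity>l. c l t * d (k - l) t"

lemma rapid_convolution: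
  assumes "rapid S c" "rapid S d"
  shows "rapid S (\<lambda>k t. conv c d k t)"
proof (rule rapidI)
  fix \<rho> :: real and p assume \<rho>: "\<rho> > 0"
  obtain B where B: "B \<ge> 0" "\<And>t k. t \<in> S \<Longrightarrow> \<rho> \<le> t \<Longrightarrow> norm (c k t) \<le> B / weight k ^ (p + 4)" using rapidD[OF assms(1) \<rho>] by blast
  obtain C where C: "C \<ge> 0" "\<And>t k. t \<in> S \<Longrightarrow> \<rho> \<le> t \<Longrightarrow> norm (d k t) \<le> C / weight k ^ p" using rapidD[OF assms(2) \<rho>] by blast
  have "norm (conv c d k t) \<le> (B * C * (\<Sum>\<^sub>\<infinity>k. 1 / weight k ^ 4)) / weight k ^ p" if t: "t \<in> S" "\<rho> \<le> t" for t k
  proof -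
    have "norm (conv c d k t) \<le> (B * C / weight k ^ p) * (\<Sum>\<^sub>\<infinity>k. 1 / weight k ^ 4)"
      by (rule dominated_summable(3))
        (rule convolution_term_bound[where a = "\<lambda>l. c l t" and b = "\<lambda>l. d l t", OF B(2)[OF t] C(2)[OF t] B(1) C(1)])
    then show ?thesis by (simp add: mult_ac)
  qed
  then show "\<exists>B. \<forall>t\<in>S. \<rho> \<le> t \<longrightarrow> (\<forall>k. norm (conv c d k t) \<le> B / weight k ^ p)" by blast
qed

lemma smooth_family_add: "smooth_family n S c \<Longrightarrow> smooth_family n S d \<Longrightarrow> smooth_family n S (\<lambda>k t. c k t + d k t)"
proof (induction n arbitrary: c d)
  case 0
  then show ?case by (auto intro: rapid_add continuous_intros)
next
  case (Suc n)
  obtain c' where c': "\<forall>k. \<forall>t\<in>S. (c k has_vector_derivative c' k t) (at t)" "smooth_family n S c'" using Suc.prems(1) by auto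
  obtain d' where d': "\<forall>k. \<forall>t\<in>S. (d k has_vector_derivative d' k t) (at t)" "smooth_family n S d'" using Suc.prems(2) by auto
  have "\<forall>k. \<forall>t\<in>S. ((\<lambda>t. c k t + d k t) has_vector_derivative c' k t + d' k t) (at t)"
    using c'(1) d'(1) by (auto intro: has_vector_derivative_add)
  then show ?case using Suc.IH[OF c'(2) d'(2)] rapid_add Suc.prems[THEN smooth_family_rapid]
    unfolding smooth_family.simps by (intro conjI exI[of _ "\<lambda>k t. c' k t + d' k t"]) auto
qed

lemma smooth_family_multiplier:
  assumes m: "\<And>k. norm (m k) \<le> C * weight k ^ q"
  shows "smooth_family n S c \<Longrightarrow> smooth_family n S (\<lambda>k t. m k * c k t)"
proof (induction n arbitrary: c)
  case 0
  then show ?case using m by (auto intro: rapid_multiplier continuous_intros)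
next
  case (Suc n)
  obtain c' where c': "\<forall>k. \<forall>t\<in>S. (c k has_vector_derivative c' k t) (at t)" "smooth_family n S c'" using Suc.prems(1) by auto
  have "\<forall>k. \<forall>t\<in>S. ((\<lambda>t. m k * c k t) has_vector_derivative m k * c' k t) (at t)"
    using c'(1) by (auto intro: has_vector_derivative_mult_right)
  then show ?case using Suc.IH[OF c'(2)] rapid_multiplier[OF smooth_family_rapid[OF Suc.prems] m]
    unfolding smooth_family.simps by (intro conjI exI[of _ "\<lambda>k t. m k * c' k t"]) auto
qed

lemma smooth_family_sum:
  "finite I \<Longrightarrow> I \<noteq> {} \<Longrightarrow> (\<And>i. i \<in> I \<Longrightarrow> smooth_family n S (c i)) \<Longrightarrow> smooth_family n S (\<lambda>k t. \<Sum>i\<in>I. c i k t)"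
proof (induction I rule: finite_ne_induct)
  case (insert i I)
  then show ?case by (simp add: smooth_family_add)
qed simp

text \<open>\<open>rapid\<close> is uniform only on times bounded away from 0. Continuity and
  differentiability at t are local, so they are proved on this window, where one majorant
  exists.\<close>

lemma positive_time_window:
  fixes t :: real
  assumes "open S" "convex S" "t \<in> S" "t > 0"
  shows "open (S \<inter> {t/2<..})" "convex (S \<inter> {t/2<..})" "t \<in> S \<inter> {t/2<..}"
  using assms by (auto intro!: convex_Int convex_real_interval)

lemma convolution_terms_dominated:
  assumes "rapid S c" "rapid S d" "\<rho> > 0"
  shows "\<exists>B\<ge>0. \<forall>s\<in>S \<inter> {\<rho><..}. \<forall>k l. norm (c l s * d (k - l) s) \<le> B / weight l ^ 4"
proof -
  obtain B where B: "B \<ge> 0" "\<And>s k. s \<in> S \<Longrightarrow> \<rho> \<le> s \<Longrightarrow> norm (c k s) \<le> B / weight k ^ (0 + 4)" using rapidD[OF assms(1,3)] by blast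
  obtain C where C: "C \<ge> 0" "\<And>s k. s \<in> S \<Longrightarrow> \<rho> \<le> s \<Longrightarrow> norm (d k s) \<le> C / weight k ^ 0" using rapidD[OF assms(2,3)] by blast
  have "norm (c l s * d (k - l) s) \<le> (B * C) / weight l ^ 4" if "s \<in> S \<inter> {\<rho><..}" for s k l
    using convolution_term_bound[where a = "\<lambda>l. c l s" and b = "\<lambda>l. d l s" and p = 0, OF B(2) C(2) B(1) C(1)] that by simp
  then show ?thesis using B(1) C(1) by (intro exI[of _ "B * C"]) auto
qed

text \<open>Termwise product rule: the derivative family is the sum of the convolutions of c' with d
  and of c with d', to which the induction hypothesis applies.\<close>

lemma smooth_family_convolution:
  assumes S: "open S" "convex S" "S \<subseteq> {0<..}"
  shows "smooth_family n S c \<Longrightarrow> smooth_family n S d \<Longrightarrow> smooth_family n S (\<lambda>k t. conv c d k t)"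
proof (induction n arbitrary: c d)
  case 0
  then have cd: "rapid S c" "rapid S d" "\<And>k. continuous_on S (c k)" "\<And>k. continuous_on S (d k)" by auto
  have "continuous_on S (\<lambda>t. conv c d k t)" for k
  proof (rule continuous_at_imp_continuous_on, rule ballI)
    fix t assume t: "t \<in> S"
    then have t0: "t > 0" using S(3) by auto
    note W = positive_time_window[OF S(1,2) t t0]
    have t2: "t / 2 > 0" using t0 by simp
    from convolution_terms_dominated[OF cd(1,2) t2] obtain B where B: "B \<ge> 0"
      "\<forall>s\<in>S \<inter> {t/2<..}. \<forall>k l. norm (c l s * d (k - l) s) \<le> B / weight l ^ 4" by (elim exE conjE)
    have "continuous_on (S \<inter> {t/2<..}) (\<lambda>t. conv c d k t)"
    proof (rule continuous_on_dominated_infsum)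
      show "continuous_on (S \<inter> {t/2<..}) (\<lambda>t. c l t * d (k - l) t)" for l
        by (intro continuous_intros continuous_on_subset[OF cd(3)] continuous_on_subset[OF cd(4)]) auto
    qed (rule B(2)[rule_format])
    then show "isCont (\<lambda>t. conv c d k t) t"
      using W by (simp add: continuous_on_eq_continuous_at)
  qed
  then show ?case using rapid_convolution[OF cd(1,2)] by simp
next
  case (Suc n)
  obtain c' where c': "\<And>k t. t \<in> S \<Longrightarrow> (c k has_vector_derivative c' k t) (at t)" "smooth_family n S c'" using Suc.prems(1) by auto
  obtain d' where d': "\<And>k t. t \<in> S \<Longrightarrow> (d k has_vector_derivative d' k t) (at t)" "smooth_family n S d'" using Suc.prems(2) by auto
  note r = Suc.prems(1)[THEN smooth_family_rapid] Suc.prems(2)[THEN smooth_family_rapid]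
    c'(2)[THEN smooth_family_rapid] d'(2)[THEN smooth_family_rapid]
  let ?e = "\<lambda>k t. (conv c' d k t) + (conv c d' k t)"
  have "((\<lambda>t. conv c d k t) has_vector_derivative ?e k t) (at t)" if t: "t \<in> S" for k t
  proof -
    have t0: "t > 0" using t S(3) by auto
    note W = positive_time_window[OF S(1,2) t t0]
    have t2: "t / 2 > 0" using t0 by simp
    from convolution_terms_dominated[OF r(1,2) t2] obtain B1 where B1: "B1 \<ge> 0"
      "\<forall>s\<in>S \<inter> {t/2<..}. \<forall>k l. norm (c l s * d (k - l) s) \<le> B1 / weight l ^ 4" by (elim exE conjE)
    from convolution_terms_dominated[OF r(3,2) t2] obtain B2 where B2: "B2 \<ge> 0"
      "\<forall>s\<in>S \<inter> {t/2<..}. \<forall>k l. norm (c' l s * d (k - l) s) \<le> B2 / weight l ^ 4" by (elim exE conjE)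
    from convolution_terms_dominated[OF r(1,4) t2] obtain B3 where B3: "B3 \<ge> 0"
      "\<forall>s\<in>S \<inter> {t/2<..}. \<forall>k l. norm (c l s * d' (k - l) s) \<le> B3 / weight l ^ 4" by (elim exE conjE)
    let ?B = "B1 + B2 + B3"
    let ?D = "\<lambda>l s. c' l s * d (k - l) s + c l s * d' (k - l) s"
    have "((\<lambda>t. conv c d k t) has_derivative (\<lambda>h. \<Sum>\<^sub>\<infinity>l. h *\<^sub>R ?D l t)) (at t)"
    proof (rule has_derivative_dominated_infsum[OF W, where B = ?B])
      fix l s assume s: "s \<in> S \<inter> {t/2<..}"
      then have "s \<in> S" by simp
      from has_vector_derivative_mult[OF c'(1)[OF this] d'(1)[OF this]]
      have "((\<lambda>t. c l t * d (k - l) t) has_vector_derivative ?D l s) (at s)" by (simp add: add.commute)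
      then show "((\<lambda>t. c l t * d (k - l) t) has_derivative (\<lambda>h. h *\<^sub>R ?D l s)) (at s)"
        by (simp add: has_vector_derivative_def)
      have "norm (c l s * d (k - l) s) \<le> B1 / weight l ^ 4" by (rule B1(2)[rule_format, OF s])
      also have "\<dots> \<le> ?B / weight l ^ 4" using B2(1) B3(1) by (intro divide_right_mono) (auto simp: weight_pos less_imp_le)
      finally show "norm (c l s * d (k - l) s) \<le> ?B / weight l ^ 4" .
      have "norm (?D l s) \<le> B2 / weight l ^ 4 + B3 / weight l ^ 4"
        by (rule norm_triangle_mono[OF B2(2)[rule_format, OF s] B3(2)[rule_format, OF s]])
      also have "\<dots> \<le> ?B / weight l ^ 4" unfolding add_divide_distrib[symmetric]
        using B1(1) by (intro divide_right_mono) (auto simp: weight_pos less_imp_le)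
      finally have D: "norm (?D l s) \<le> ?B / weight l ^ 4" .
      show "norm (h *\<^sub>R ?D l s) \<le> ?B / weight l ^ 4 * norm h" for h :: real
        unfolding norm_scaleR using mult_right_mono[OF D abs_ge_zero[of h]] by (simp add: mult.commute)
    qed
    moreover have "(\<Sum>\<^sub>\<infinity>l. h *\<^sub>R ?D l t) = h *\<^sub>R ?e k t" for h :: real
    proof -
      have "(\<Sum>\<^sub>\<infinity>l. h *\<^sub>R ?D l t) = h *\<^sub>R (\<Sum>\<^sub>\<infinity>l. ?D l t)" by (rule infsum_scaleR_right)
      also have "(\<Sum>\<^sub>\<infinity>l. ?D l t) = ?e k t"
        by (rule infsum_add) (use dominated_summable(2)[OF B2(2)[rule_format, OF W(3)]] dominated_summable(2)[OF B3(2)[rule_format, OF W(3)]] in auto)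
      finally show ?thesis .
    qed
    ultimately show ?thesis by (simp add: has_vector_derivative_def)
  qed
  moreover have "smooth_family n S ?e"
    by (rule smooth_family_add[OF Suc.IH[OF c'(2) smooth_family_Suc[OF Suc.prems(2)]]
          Suc.IH[OF smooth_family_Suc[OF Suc.prems(1)] d'(2)]])
  ultimately show ?case using rapid_convolution[OF r(1,2)] unfolding smooth_family.simps
    by (intro conjI exI[of _ ?e]) auto
qed

section \<open>Joint smoothness of Fourier series in space and time\<close>

lemma Ck_on_bounded_linear:
  assumes g: "bounded_linear g"
  shows "Ck_on n S f \<Longrightarrow> Ck_on n S (\<lambda>x. g (f x))"
proof (induction n arbitrary: f)
  case 0
  then show ?case using bounded_linear.continuous_on[OF g] by simp
next
  case (Suc n)
  then obtain f' where f': "\<forall>x\<in>S. (f has_derivative f' x) (at x within S)" "\<forall>v. Ck_on n S (\<lambda>x. f' x v)" by auto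
  have "\<forall>x\<in>S. ((\<lambda>x. g (f x)) has_derivative (\<lambda>v. g (f' x v))) (at x within S)"
    using bounded_linear.has_derivative[OF g] f'(1) by blast
  moreover have "\<forall>v. Ck_on n S (\<lambda>x. g (f' x v))" using Suc.IH f'(2) by blast
  ultimately show ?case by auto
qed

lemma Ck_on_add: "Ck_on n S f \<Longrightarrow> Ck_on n S g \<Longrightarrow> Ck_on n S (\<lambda>x. f x + g x)"
proof (induction n arbitrary: f g)
  case 0
  then show ?case by (simp add: continuous_on_add)
next
  case (Suc n)
  obtain f' where f': "\<forall>x\<in>S. (f has_derivative f' x) (at x within S)" "\<forall>v. Ck_on n S (\<lambda>x. f' x v)" using Suc.prems(1) by auto
  obtain g' where g': "\<forall>x\<in>S. (g has_derivative g' x) (at x within S)" "\<forall>v. Ck_on n S (\<lambda>x. g' x v)" using Suc.prems(2) by auto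
  have "\<forall>x\<in>S. ((\<lambda>x. f x + g x) has_derivative (\<lambda>v. f' x v + g' x v)) (at x within S)"
    using f'(1) g'(1) by (auto intro: has_derivative_add)
  moreover have "\<forall>v. Ck_on n S (\<lambda>x. f' x v + g' x v)" using Suc.IH f'(2) g'(2) by blast
  ultimately show ?case by auto
qed

lemma Ck_on_sum:
  "finite I \<Longrightarrow> I \<noteq> {} \<Longrightarrow> (\<And>i. i \<in> I \<Longrightarrow> Ck_on n S (f i)) \<Longrightarrow> Ck_on n S (\<lambda>x. \<Sum>i\<in>I. f i x)"
proof (induction I rule: finite_ne_induct)
  case (insert i I)
  then show ?case by (simp add: Ck_on_add)
qed simp

definition ee_slope :: "real^3 \<Rightarrow> int^3 \<Rightarrow> complex" where
  "ee_slope y k = \<i> * complex_of_real (2 * pi * (y \<bullet> ivec k))"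

lemma ee_has_derivative: "(ee k has_derivative (\<lambda>y. ee_slope y k * ee k x)) (at x)"
proof -
  have "bounded_linear (\<lambda>y. ee_slope y k)" unfolding ee_slope_def
    by (rule bounded_linear_compose[OF bounded_linear_mult_right
          bounded_linear_compose[OF bounded_linear_of_real bounded_linear_phase]])
  then have "((\<lambda>y. ee_slope y k) has_derivative (\<lambda>y. ee_slope y k)) (at x)"
    by (rule bounded_linear_imp_has_derivative)
  from has_derivative_compose[OF this DERIV_exp[unfolded has_field_derivative_def]]
  have "((\<lambda>x. exp (ee_slope x k)) has_derivative (\<lambda>y. exp (ee_slope x k) * ee_slope y k)) (at x)" .
  moreover have "ee k = (\<lambda>x. exp (ee_slope x k))" by (rule ext) (simp add: ee_def ee_slope_def mult_ac)
  ultimately show ?thesis by (simp add: mult.commute)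
qed

lemma norm_ee_slope_le: "norm (ee_slope y k) \<le> 2 * pi * norm y * weight k"
proof -
  have "\<bar>y \<bullet> ivec k\<bar> \<le> norm y * freq k" by (rule Cauchy_Schwarz_ineq2)
  also have "\<dots> \<le> norm y * weight k" by (intro mult_left_mono) (auto simp: weight_def)
  finally show ?thesis by (simp add: ee_slope_def norm_mult abs_mult)
qed

text \<open>The derivative in a direction (y, h) is a series of the same kind, with coefficients h
  c_k' + 2 pi i (y . k) c_k, a smooth family of one order less. Joint smoothness thus reduces to
  multipliers and time derivatives of the coefficients.\<close>

lemma Ck_on_series:
  assumes S: "open S" "convex S" "S \<subseteq> {0<..}"
  shows "smooth_family n S c \<Longrightarrow> Ck_on n (UNIV \<times> S) (\<lambda>p. \<Sum>\<^sub>\<infinity>k. c k (snd p) * ee k (fst p))"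
proof (induction n arbitrary: c)
  case 0
  then have c: "rapid S c" "\<And>k. continuous_on S (c k)" by auto
  have "isCont (\<lambda>p. \<Sum>\<^sub>\<infinity>k. c k (snd p) * ee k (fst p)) p" if p: "p \<in> UNIV \<times> S" for p
  proof -
    define t where "t = snd p"
    have t: "t \<in> S" "t > 0" using p S(3) by (auto simp: t_def)
    note W = positive_time_window[OF S(1,2) t]
    have t2: "t / 2 > 0" using t by simp
    obtain B where B: "\<And>s k. s \<in> S \<Longrightarrow> t / 2 \<le> s \<Longrightarrow> norm (c k s) \<le> B / weight k ^ 4" using rapidD[OF c(1) t2] by blast
    have "continuous_on (UNIV \<times> (S \<inter> {t/2<..})) (\<lambda>p. \<Sum>\<^sub>\<infinity>k. c k (snd p) * ee k (fst p))"
    proof (rule continuous_on_dominated_infsum)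
      show "continuous_on (UNIV \<times> (S \<inter> {t/2<..})) (\<lambda>p. c k (snd p) * ee k (fst p))" for k
        by (intro continuous_intros continuous_on_compose2[OF c(2)] continuous_on_compose2[OF continuous_ee[of UNIV]]) auto
      show "norm (c k (snd p) * ee k (fst p)) \<le> B / weight k ^ 4" if "p \<in> UNIV \<times> (S \<inter> {t/2<..})" for k p
        using B[of "snd p" k] that by (auto simp: norm_mult)
    qed
    moreover have "p \<in> UNIV \<times> (S \<inter> {t/2<..})" using W(3) by (cases p) (auto simp: t_def)
    moreover have "open ((UNIV :: (real^3) set) \<times> (S \<inter> {t/2<..}))" using W(1) by (intro open_Times) auto
    ultimately show ?thesis using continuous_on_eq_continuous_at by blast
  qed
  then show ?case by (simp add: continuous_at_imp_continuous_on)
next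
  case (Suc n)
  obtain d where d: "\<And>k t. t \<in> S \<Longrightarrow> (c k has_vector_derivative d k t) (at t)" "smooth_family n S d" using Suc.prems by auto
  note rc = smooth_family_rapid[OF Suc.prems] and rd = smooth_family_rapid[OF d(2)]
  define f' where "f' k p v = (complex_of_real (snd v) * d k (snd p) + ee_slope (fst v) k * c k (snd p)) * ee k (fst p)"
    for k and p v :: "(real^3) \<times> real"
  have "((\<lambda>p. \<Sum>\<^sub>\<infinity>k. c k (snd p) * ee k (fst p)) has_derivative (\<lambda>v. \<Sum>\<^sub>\<infinity>k. f' k p v)) (at p)"
    if p: "p \<in> UNIV \<times> S" for p
  proof -
    define t where "t = snd p"
    have t: "t \<in> S" "t > 0" using p S(3) by (auto simp: t_def)
    note W = positive_time_window[OF S(1,2) t]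
    have t2: "t / 2 > 0" using t by simp
    \<comment> \<open>Five powers: the factor k from the spatial derivative uses one, and four are
      needed for summability.\<close>
    obtain B where B: "B \<ge> 0" "\<And>s k. s \<in> S \<Longrightarrow> t / 2 \<le> s \<Longrightarrow> norm (c k s) \<le> B / weight k ^ 5" using rapidD[OF rc t2] by blast
    obtain C where C: "C \<ge> 0" "\<And>s k. s \<in> S \<Longrightarrow> t / 2 \<le> s \<Longrightarrow> norm (d k s) \<le> C / weight k ^ 4" using rapidD[OF rd t2] by blast
    let ?B = "B + C + 2 * pi * B"
    show ?thesis
    proof (rule has_derivative_dominated_infsum[where S = "UNIV \<times> (S \<inter> {t/2<..})" and B = ?B])
      show "open (UNIV \<times> (S \<inter> {t/2<..}))" "convex (UNIV \<times> (S \<inter> {t/2<..}))"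
        using W by (auto intro: open_Times convex_Times)
      show "p \<in> UNIV \<times> (S \<inter> {t/2<..})" using W(3) by (cases p) (auto simp: t_def)
      fix k and q :: "(real^3) \<times> real" assume "q \<in> UNIV \<times> (S \<inter> {t/2<..})"
      then have q: "snd q \<in> S" "t / 2 \<le> snd q" by auto
      have 1: "((\<lambda>p. c k (snd p)) has_derivative (\<lambda>v. snd v *\<^sub>R d k (snd q))) (at q)"
        using has_derivative_compose[OF has_derivative_snd[OF has_derivative_ident] d(1)[OF q(1), unfolded has_vector_derivative_def]] .
      have 2: "((\<lambda>p. ee k (fst p)) has_derivative (\<lambda>v. ee_slope (fst v) k * ee k (fst q))) (at q)"
        using has_derivative_compose[OF has_derivative_fst[OF has_derivative_ident] ee_has_derivative] .
      from has_derivative_mult[OF 1 2]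
      show "((\<lambda>p. c k (snd p) * ee k (fst p)) has_derivative f' k q) (at q)"
        by (rule has_derivative_eq_rhs) (simp add: f'_def fun_eq_iff scaleR_conv_of_real algebra_simps)
      have w: "B / weight k ^ 5 \<le> B / weight k ^ 4"
        using B(1) weight_ge_1[of k] weight_pos[of k] by (intro divide_left_mono power_increasing mult_pos_pos zero_less_power) auto
      have "norm (c k (snd q)) \<le> B / weight k ^ 4" using B(2)[OF q, of k] w by linarith
      also have "\<dots> \<le> ?B / weight k ^ 4" using B(1) C(1) by (intro divide_right_mono) (auto simp: weight_pos less_imp_le)
      finally show "norm (c k (snd q) * ee k (fst q)) \<le> ?B / weight k ^ 4" by (simp add: norm_mult)
      fix v :: "(real^3) \<times> real"
      have "norm (f' k q v) \<le> norm (complex_of_real (snd v) * d k (snd q)) + norm (ee_slope (fst v) k * c k (snd q))"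
        unfolding f'_def norm_mult[of _ "ee k _"] norm_ee mult_1_right by (rule norm_triangle_ineq)
      also have "norm (complex_of_real (snd v) * d k (snd q)) \<le> norm v * (C / weight k ^ 4)"
        unfolding norm_mult using C(2)[OF q, of k] norm_snd_le[of "snd v" "fst v"] by (intro mult_mono) auto
      also have "norm (ee_slope (fst v) k * c k (snd q)) \<le> (2 * pi * norm v * weight k) * (B / weight k ^ 5)"
      proof -
        have "norm (ee_slope (fst v) k) \<le> 2 * pi * norm (fst v) * weight k" by (rule norm_ee_slope_le)
        also have "\<dots> \<le> 2 * pi * norm v * weight k"
          using norm_fst_le[of "fst v" "snd v"] weight_pos[of k] by (intro mult_right_mono mult_left_mono) auto
        finally show ?thesis unfolding norm_mult
          using B(2)[OF q, of k] weight_pos[of k] by (intro mult_mono) auto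
      qed
      also have "(2 * pi * norm v * weight k) * (B / weight k ^ 5) = norm v * (2 * pi * B / weight k ^ 4)"
        using weight_pos[of k] by (simp add: eval_nat_numeral)
      also have "norm v * (C / weight k ^ 4) + norm v * (2 * pi * B / weight k ^ 4) = (C + 2 * pi * B) / weight k ^ 4 * norm v"
        by (simp add: add_divide_distrib distrib_left distrib_right mult.commute)
      also have "\<dots> \<le> ?B / weight k ^ 4 * norm v"
        using B(1) by (intro mult_right_mono divide_right_mono) (auto simp: weight_pos less_imp_le)
      finally show "norm (f' k q v) \<le> ?B / weight k ^ 4 * norm v" by simp
    qed
  qed
  then have D: "\<forall>p\<in>UNIV \<times> S. ((\<lambda>p. \<Sum>\<^sub>\<infinity>k. c k (snd p) * ee k (fst p)) has_derivative (\<lambda>v. \<Sum>\<^sub>\<infinity>k. f' k p v)) (at p within UNIV \<times> S)"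
    using has_derivative_at_withinI by blast
  have "Ck_on n (UNIV \<times> S) (\<lambda>p. \<Sum>\<^sub>\<infinity>k. f' k p v)" for v
  proof -
    have "smooth_family n S (\<lambda>k t. complex_of_real (snd v) * d k t + ee_slope (fst v) k * c k t)"
    proof (rule smooth_family_add)
      show "smooth_family n S (\<lambda>k t. complex_of_real (snd v) * d k t)"
        by (rule smooth_family_multiplier[where C = "\<bar>snd v\<bar>" and q = 0]) (use d(2) in auto)
      show "smooth_family n S (\<lambda>k t. ee_slope (fst v) k * c k t)"
        by (rule smooth_family_multiplier[where C = "2 * pi * norm (fst v)" and q = 1])
          (use norm_ee_slope_le smooth_family_Suc[OF Suc.prems] in auto)
    qed
    from Suc.IH[OF this] show ?thesis unfolding f'_def .
  qed
  then show ?case unfolding Ck_on.simps using D by (intro exI[of _ "\<lambda>p v. \<Sum>\<^sub>\<infinity>k. f' k p v"]) blast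
qed

text \<open>Dominated convergence permits termwise integration along balls, and the coefficient of
  the partial sums is eventually \<open>c l\<close>.\<close>

lemma series_coef:
  assumes c: "\<And>k. norm (c k) \<le> B / weight k ^ 4"
  shows "sqint (\<lambda>x. \<Sum>\<^sub>\<infinity>k. c k * ee k x)" "coef (\<lambda>x. \<Sum>\<^sub>\<infinity>k. c k * ee k x) l = c l"
proof -
  define E where "E n = {k. freq k < real n}" for n
  have E: "filterlim E (finite_subsets_at_top UNIV) sequentially"
    using filterlim_ivec_ball unfolding E_def .
  have fE: "finite (E n)" for n by (simp add: E_def finite_ivec_ball)
  let ?F = "\<lambda>x. \<Sum>\<^sub>\<infinity>k. c k * ee k x"
  let ?Z = "\<Sum>\<^sub>\<infinity>k. 1 / weight k ^ 4"
  have b: "norm (c k * ee k x) \<le> B / weight k ^ 4" for k x using c by (simp add: norm_mult)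
  have Fb: "norm (?F x) \<le> B * ?Z" for x by (rule dominated_summable(3)[OF b])
  have "continuous_on UNIV ?F"
    by (rule continuous_on_dominated_infsum) (auto intro!: continuous_intros b)
  then have Fm: "?F \<in> borel_measurable torus" by (rule continuous_imp_measurable_torus)
  show sq: "sqint ?F" by (rule sqint_bounded[OF Fm Fb])
  have S: "sqint (\<lambda>x. \<Sum>k\<in>E n. c k * ee k x)" for n by (intro sqint_sum sqint_cmult sqint_ee)
  have M: "(\<lambda>k. B * (1 / weight k ^ 4)) summable_on UNIV"
    by (rule summable_on_cmult_right[OF weight_summable])
  have B0: "B / weight k ^ 4 \<ge> 0" for k using order.trans[OF norm_ge_zero c] .
  have "(\<lambda>n. LINT x|torus. (\<Sum>k\<in>E n. c k * ee k x) * ee (- l) x) \<longlonglongrightarrow> (LINT x|torus. ?F x * ee (- l) x)"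
  proof (rule integral_dominated_convergence)
    show "(\<lambda>x. ?F x * ee (- l) x) \<in> borel_measurable torus" using coef_integrable[OF sq] by (rule borel_measurable_integrable)
    show "(\<lambda>x. (\<Sum>k\<in>E n. c k * ee k x) * ee (- l) x) \<in> borel_measurable torus" for n
      using coef_integrable[OF S] by (rule borel_measurable_integrable)
    show "integrable torus (\<lambda>x. B * ?Z)" by simp
    show "AE x in torus. (\<lambda>n. (\<Sum>k\<in>E n. c k * ee k x) * ee (- l) x) \<longlonglongrightarrow> ?F x * ee (- l) x"
    proof (rule AE_I2)
      fix x
      have "((\<lambda>k. c k * ee k x) has_sum ?F x) UNIV"
        by (rule has_sum_infsum[OF dominated_summable(2)[OF b]])
      from filterlim_compose[OF this[unfolded has_sum_def] E]
      have "(\<lambda>n. \<Sum>k\<in>E n. c k * ee k x) \<longlonglongrightarrow> ?F x" .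
      then show "(\<lambda>n. (\<Sum>k\<in>E n. c k * ee k x) * ee (- l) x) \<longlonglongrightarrow> ?F x * ee (- l) x"
        by (intro tendsto_intros)
    qed
    show "AE x in torus. norm ((\<Sum>k\<in>E n. c k * ee k x) * ee (- l) x) \<le> B * ?Z" for n
    proof (rule AE_I2)
      fix x
      have "norm (\<Sum>k\<in>E n. c k * ee k x) \<le> (\<Sum>k\<in>E n. B * (1 / weight k ^ 4))"
        by (rule order.trans[OF norm_sum sum_mono]) (use b in auto)
      also have "\<dots> \<le> (\<Sum>\<^sub>\<infinity>k. B * (1 / weight k ^ 4))"
        by (rule finite_sum_le_infsum[OF M fE]) (use B0 in auto)
      also have "\<dots> = B * ?Z" by (rule infsum_cmult_right')
      finally show "norm ((\<Sum>k\<in>E n. c k * ee k x) * ee (- l) x) \<le> B * ?Z" by (simp add: norm_mult)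
    qed
  qed
  then have "(\<lambda>n. coef (\<lambda>x. \<Sum>k\<in>E n. c k * ee k x) l) \<longlonglongrightarrow> coef ?F l" by (simp add: coef_def)
  then have lim: "(\<lambda>n. if l \<in> E n then c l else 0) \<longlonglongrightarrow> coef ?F l" by (simp add: coef_sum[OF fE])
  have "\<forall>\<^sub>F n in sequentially. (if l \<in> E n then c l else 0) = c l"
  proof -
    obtain N :: nat where "freq l < N" using reals_Archimedean2 by blast
    then show ?thesis by (intro eventually_sequentiallyI[of N]) (auto simp: E_def)
  qed
  from LIMSEQ_unique[OF lim tendsto_eventually[OF this]] show "coef ?F l = c l" .
qed

lemma ee_periodic: "ee k (x + ivec l) = ee k x"
proof -
  obtain n where n: "ivec l \<bullet> ivec k = of_int n" using inner_ivec_Ints Ints_cases by blast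
  have "2 * pi * ((x + ivec l) \<bullet> ivec k) = 2 * pi * (x \<bullet> ivec k) + 2 * pi * of_int n"
    by (simp add: inner_add_left n distrib_left)
  then show ?thesis unfolding ee_cis by (simp flip: cis_mult)
qed

section \<open>Smoothness of the solution and the essential supremum of its norm\<close>

context hhalf_solution
begin

text \<open>Decay in k is known to all orders, so the induction only has to gain time derivatives:
  the equation expresses each through polynomial multipliers of modes and of their convolutions. All
  components occur on the right-hand side, hence m is generalized.\<close>

lemma smooth_family_fourier:
  assumes L: "L \<le> 1 / 40000"
  shows "smooth_family n (open_times T) (\<lambda>k t. fourier (u t) k $ m)"
proof (induction n arbitrary: m)
  case 0
  have "rapid (open_times T) (\<lambda>k t. fourier (u t) k $ m)"
    unfolding rapid_def weight_def using fourier_rapid_decay[OF L] by blast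
  then show ?case using continuous_on_subset[OF continuous_fourier open_times_subset] by simp
next
  case (Suc n)
  define P where "P i j k t = (\<Sum>\<^sub>\<infinity>l. fourier (u t) l $ i * fourier (u t) (k - l) $ j)" for i j k t
  define d where "d k t = - complex_of_real (4 * pi\<^sup>2 * (freq k)\<^sup>2) * fourier (u t) k $ m
      + (\<Sum>i\<in>UNIV. \<Sum>j\<in>UNIV. - (complex_of_real (2 * pi) * \<i> * complex_of_real (real_of_int (k $ i) * leray k m $ j)) * P i j k t)" for k t
  have "((\<lambda>t. fourier (u t) k $ m) has_vector_derivative d k t) (at t)" if t: "t \<in> open_times T" for k t
  proof -
    have P: "product_coef (u t) k i j = P i j k t" for i j
      unfolding P_def by (rule infsumI[OF product_coef_has_sum[OF in_L2_open[OF t]], symmetric])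
    show ?thesis using fourier_derivative[OF t, of k m]
      by (simp add: P d_def sum_distrib_left sum_negf mult.assoc)
  qed
  moreover have "smooth_family n (open_times T) d"
    unfolding d_def
  proof (intro smooth_family_add smooth_family_sum)
    show "smooth_family n (open_times T) (\<lambda>k t. - complex_of_real (4 * pi\<^sup>2 * (freq k)\<^sup>2) * fourier (u t) k $ m)"
    proof (rule smooth_family_multiplier[where C = "4 * pi\<^sup>2" and q = 2, OF _ Suc])
      show "norm (- complex_of_real (4 * pi\<^sup>2 * (freq k)\<^sup>2)) \<le> 4 * pi\<^sup>2 * weight k ^ 2" for k
        unfolding norm_minus_cancel norm_of_real by (auto simp: abs_mult weight_def intro!: mult_left_mono power_mono)
    qed
    fix i j :: 3
    have "smooth_family n (open_times T) (P i j)" unfolding P_def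
      by (rule smooth_family_convolution[OF open_open_times convex_open_times _ Suc Suc]) (auto simp: open_times_def)
    then show "smooth_family n (open_times T)
        (\<lambda>k t. - (complex_of_real (2 * pi) * \<i> * complex_of_real (real_of_int (k $ i) * leray k m $ j)) * P i j k t)"
    proof (rule smooth_family_multiplier[where C = "4 * pi" and q = 1, rotated])
      fix k
      have "\<bar>ivec k $ i\<bar> * \<bar>leray k m $ j\<bar> \<le> weight k * 2"
        using component_le_norm_cart[of "ivec k" i] leray_le[of k m j] by (intro mult_mono) (auto simp: weight_def)
      then show "norm (- (complex_of_real (2 * pi) * \<i> * complex_of_real (real_of_int (k $ i) * leray k m $ j))) \<le> 4 * pi * weight k ^ 1"
        by (simp add: norm_mult abs_mult)
    qed
  qed simp_all
  ultimately show ?case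
    using smooth_family_rapid[OF Suc] unfolding smooth_family.simps by blast
qed

text \<open>The real part of the Fourier series is the representative. The series and u(t) have the
  same coefficients and agree almost everywhere by uniqueness; real parts are needed only because
  the series is complex-valued.\<close>

lemma regular:
  assumes L: "L \<le> 1 / 40000"
  shows "regular T u"
proof -
  define F where "F j p = (\<Sum>\<^sub>\<infinity>k. fourier (u (snd p)) k $ j * ee k (fst p))" for j and p :: "(real^3) \<times> real"
  define v :: "real \<Rightarrow> real^3 \<Rightarrow> real^3" where "v t x = (\<Sum>j\<in>UNIV. Re (F j (x, t)) *\<^sub>R axis j 1)" for t x
  have vj: "v t x $ j = Re (F j (x, t))" for t x j
    by (simp add: v_def axis_def if_distrib cong: if_cong)
  have sub: "open_times T \<subseteq> {0<..}" by (auto simp: open_times_def)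
  have "Ck_on n (UNIV \<times> open_times T) (\<lambda>p. \<Sum>j\<in>UNIV. Re (F j p) *\<^sub>R axis j (1::real))" for n
  proof (rule Ck_on_sum)
    fix j :: 3
    have "bounded_linear (\<lambda>z. Re z *\<^sub>R (axis j 1 :: real^3))"
      by (rule bounded_linear_compose[OF bounded_linear_scaleR_left bounded_linear_Re])
    moreover have "Ck_on n (UNIV \<times> open_times T) (F j)" unfolding F_def
      by (rule Ck_on_series[OF open_open_times convex_open_times sub smooth_family_fourier[OF L]])
    ultimately show "Ck_on n (UNIV \<times> open_times T) (\<lambda>p. Re (F j p) *\<^sub>R (axis j 1 :: real^3))"
      by (rule Ck_on_bounded_linear)
  qed simp_all
  then have "smooth_on (UNIV \<times> open_times T) (\<lambda>(x, t). v t x)"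
    unfolding smooth_on_def v_def by (simp add: case_prod_unfold)
  moreover have "periodic (v t) \<and> (AE x in torus. u t x = v t x)" if t: "t \<in> open_times T" for t
  proof
    show "periodic (v t)" by (simp add: periodic_def v_def F_def ee_periodic)
    have t0: "t > 0" using t by (simp add: open_times_def)
    have "AE x in torus. u t x $ j = v t x $ j" for j
    proof -
      obtain B where B: "\<And>s k. s \<in> open_times T \<Longrightarrow> t \<le> s \<Longrightarrow> norm (fourier (u s) k $ j) \<le> B / weight k ^ 4"
        using rapidD[OF smooth_family_rapid[OF smooth_family_fourier[OF L, of 0 j]] t0] by blast
      note s = series_coef[where c = "\<lambda>k. fourier (u t) k $ j", OF B[OF t order.refl]]
      note w = L2_torus_component[OF in_L2_open[OF t], of j]
      have "AE x in torus. complex_of_real (u t x $ j) - (\<Sum>\<^sub>\<infinity>k. fourier (u t) k $ j * ee k x) = 0"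
        by (rule coef_zero_imp_AE_zero[OF sqint_diff[OF w s(1)]])
          (simp add: coef_diff[OF w s(1)] s(2) fourier_eq_coef[symmetric])
      then show ?thesis
      proof eventually_elim
        case (elim x)
        then have "F j (x, t) = complex_of_real (u t x $ j)" by (simp add: F_def)
        then show ?case by (simp add: vj)
      qed
    qed
    then have "AE x in torus. \<forall>j. u t x $ j = v t x $ j" by (simp add: AE_all_countable)
    then show "AE x in torus. u t x = v t x" by (simp add: vec_eq_iff)
  qed
  ultimately show ?thesis unfolding regular_def by blast
qed

text \<open>The essential supremum of a nonmeasurable function is infinite by convention, so its
  finiteness forces measurability.\<close>

lemma measurable_Hhalf_norm:
  assumes "u \<in> Linf_Hhalf T"
  shows "(\<lambda>t. ereal (Hhalf_norm (u t))) \<in> borel_measurable (lebesgue_on (open_times T))"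
proof (rule ccontr)
  assume "\<not> ?thesis"
  then have "Linf_Hhalf_norm T u = \<infinity>"
    by (simp add: Linf_Hhalf_norm_def esssup_non_measurable top_ereal_def)
  then show False using assms by (simp add: Linf_Hhalf_def)
qed

lemma Linf_norm_le:
  assumes "u \<in> Linf_Hhalf T"
  shows "Linf_Hhalf_norm T u \<le> ereal L"
  unfolding Linf_Hhalf_norm_def
  by (rule esssup_I[OF measurable_Hhalf_norm[OF assms]]) (auto intro!: AE_I2 Hhalf_norm_le)

text \<open>A vanishing essential supremum kills the modes at almost every time only; continuity of
  each mode extends this to every time. It excludes N = 0 together with L > 0, where a K that
  divides by N would be useless.\<close>

lemma Linf_norm_nonpos:
  assumes u: "u \<in> Linf_Hhalf T" and N: "Linf_Hhalf_norm T u \<le> 0" and t: "t \<in> open_times T"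
  shows "Hhalf_norm (u t) = 0"
proof -
  have "AE s in lebesgue_on (open_times T). ereal (Hhalf_norm (u s)) \<le> Linf_Hhalf_norm T u"
    unfolding Linf_Hhalf_norm_def by (rule esssup_AE)
  then have "AE s in lebesgue_on (open_times T). Hhalf_norm (u s) \<le> 0"
    by eventually_elim (use N in \<open>auto dest: order.trans simp flip: zero_ereal_def\<close>)
  then have AE0: "AE s in lebesgue. s \<in> open_times T \<longrightarrow> Hhalf_norm (u s) \<le> 0"
    using open_open_times by (subst (asm) AE_restrict_space_iff) auto
  have zero: "fourier (u s) k $ j = 0" if s: "s \<in> open_times T" "Hhalf_norm (u s) \<le> 0" and k: "k \<noteq> 0" for s k j
  proof -
    let ?f = "\<lambda>k. freq k * (norm (fourier (u s) k))\<^sup>2"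
    have sm: "?f summable_on (UNIV - {0})" using Hhalf[OF s(1)] by (simp add: Hhalf_def)
    have "sum ?f {k} \<le> infsum ?f (UNIV - {0})"
      by (rule finite_sum_le_infsum[OF sm]) (use k in auto)
    also have "\<dots> \<le> 0" using s(2) by (simp add: Hhalf_norm_def)
    finally have "freq k * (norm (fourier (u s) k))\<^sup>2 \<le> 0" by simp
    then have "fourier (u s) k = 0" using freq_ge_1[OF k] by (auto simp: mult_le_0_iff)
    then show ?thesis by simp
  qed
  have "fourier (u t) k $ j = 0" if k: "k \<noteq> 0" for k j
  proof (rule ccontr)
    assume nz: "fourier (u t) k $ j \<noteq> 0"
    define U where "U = open_times T \<inter> (\<lambda>s. fourier (u s) k $ j) -` (- {0})"
    have "open U" unfolding U_def
      by (rule continuous_open_preimage[OF continuous_on_subset[OF continuous_fourier open_times_subset] open_open_times]) auto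
    moreover have "AE s \<in> U in lebesgue. s \<in> {}"
      using AE0 by eventually_elim (use zero k in \<open>auto simp: U_def\<close>)
    moreover have "t \<in> U" using nz t by (simp add: U_def)
    ultimately have "t \<in> {}" by (intro mem_closed_if_AE_lebesgue_open[of U "{}"]) auto
    then show False by simp
  qed
  then have "fourier (u t) k = 0" if "k \<noteq> 0" for k using that by (simp add: vec_eq_iff)
  then have "(\<Sum>\<^sub>\<infinity>k\<in>UNIV - {0}. freq k * (norm (fourier (u t) k))\<^sup>2) = 0"
    by (intro infsum_0) auto
  then show ?thesis by (simp add: Hhalf_norm_def)
qed

end

text \<open>The surplus power of |k| is traded for a factor L: from |k| >= 192/(\<rho>^2 N) and N <=
  L follows 192/(\<rho>^2 |k|) <= L. The resulting L^2/|k|^2 lies below the claim, since 2 (4 + sqrt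
  2) >= 1 and the denominator is in (0, 1].\<close>

lemma decay_constant_bound:
  assumes L: "0 < L" "L \<le> 1 / 40000" and n: "n \<ge> 192 / (\<rho>\<^sup>2 * N)" "n \<ge> 1" and N: "0 < N" "N \<le> L" and \<rho>: "0 < \<rho>" "\<rho> < t"
  shows "192 * L / t\<^sup>2 / n ^ 3 \<le> ((2 * (4 + sqrt 2) * L\<^sup>2) / (1 - 2 * 1 * L)) / n\<^sup>2"
proof -
  have "192 * L / t\<^sup>2 / n ^ 3 \<le> 192 * L / \<rho>\<^sup>2 / n ^ 3"
    using L n \<rho> by (intro divide_right_mono divide_left_mono power_mono mult_pos_pos) auto
  also have "\<dots> = (192 / \<rho>\<^sup>2 / n) * L / n\<^sup>2" using n by (simp add: eval_nat_numeral)
  also have "\<dots> \<le> L * L / n\<^sup>2"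
  proof (intro divide_right_mono mult_right_mono)
    have "192 / \<rho>\<^sup>2 = 192 / (\<rho>\<^sup>2 * N) * N" using N by simp
    also have "\<dots> \<le> n * N" using n(1) N by (intro mult_right_mono) auto
    also have "\<dots> \<le> n * L" using n N by (intro mult_left_mono) auto
    finally show "192 / \<rho>\<^sup>2 / n \<le> L" using n(2) pos_divide_le_eq[of n "192 / \<rho>\<^sup>2" L] by (simp add: mult.commute)
  qed (use L n in auto)
  also have "\<dots> \<le> ((2 * (4 + sqrt 2) * L\<^sup>2) / (1 - 2 * 1 * L)) / n\<^sup>2"
  proof (rule divide_right_mono)
    have "L * L * (1 - 2 * 1 * L) \<le> L * L * 1" using L by (intro mult_left_mono) auto
    also have "\<dots> \<le> 2 * (4 + sqrt 2) * L\<^sup>2" by (simp add: power2_eq_square mult_le_cancel_right1)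
    finally show "L * L \<le> (2 * (4 + sqrt 2) * L\<^sup>2) / (1 - 2 * 1 * L)"
      using L by (simp add: pos_le_divide_eq)
  qed simp
  finally show ?thesis .
qed

section \<open>The theorem\<close>

lemma Hhalf_norm_nonneg: "Hhalf_norm w \<ge> 0"
  by (auto simp: Hhalf_norm_def intro!: infsum_nonneg)

lemma open_times_nonempty:
  assumes "0 < T"
  shows "open_times T \<noteq> {}"
proof -
  obtain r where "ereal 0 < ereal r" "ereal r < T"
    using assms ereal_dense2[of "ereal 0" T] by (auto simp: zero_ereal_def)
  then show ?thesis by (auto simp: open_times_def)
qed

lemma small_solution:
  assumes T: "0 < T" and u: "u \<in> Linf_Hhalf T" and NS: "NS_solution T \<psi> u"
    and small: "\<forall>t\<in>open_times T. u t \<in> Hhalf \<and> Hhalf_norm (u t) < 1 / 40000"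
    and L0: "sqrt L\<^sub>0 = (SUP t\<in>open_times T. Hhalf_norm (u t))"
  shows "regular T u"
    and "0 < \<rho> \<Longrightarrow> max 1 (192 / (\<rho>\<^sup>2 * real_of_ereal (Linf_Hhalf_norm T u))) \<le> freq k \<Longrightarrow>
      t \<in> open_times T \<Longrightarrow> \<rho> < t \<Longrightarrow>
      norm (fourier (u t) k) \<le> ((2 * (4 + sqrt 2) * L\<^sub>0) / (1 - 2 * 1 * sqrt L\<^sub>0)) / (freq k)\<^sup>2"
proof -
  define L where "L = sqrt L\<^sub>0"
  have ne: "open_times T \<noteq> {}" by (rule open_times_nonempty[OF T])
  have bdd: "bdd_above ((\<lambda>t. Hhalf_norm (u t)) ` open_times T)"
    by (rule bdd_aboveI[of _ "1 / 40000"]) (use small in \<open>auto intro: less_imp_le\<close>)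
  have le: "Hhalf_norm (u t) \<le> L" if "t \<in> open_times T" for t
    unfolding L_def L0 by (rule cSUP_upper[OF that bdd])
  have L: "L \<le> 1 / 40000"
    unfolding L_def L0 by (rule cSUP_least[OF ne]) (use small in \<open>auto intro: less_imp_le\<close>)
  have Lnn: "L \<ge> 0"
  proof -
    obtain t where "t \<in> open_times T" using ne by blast
    then show ?thesis using le[of t] Hhalf_norm_nonneg[of "u t"] by linarith
  qed
  have L_square: "L\<^sup>2 = L\<^sub>0" using Lnn by (simp add: L_def)
  interpret hhalf_solution T \<psi> u L
    by unfold_locales (use NS Lnn small le in auto)
  show "regular T u" by (rule regular[OF L])
  assume \<rho>: "0 < \<rho>" "\<rho> < t"
    and K: "max 1 (192 / (\<rho>\<^sup>2 * real_of_ereal (Linf_Hhalf_norm T u))) \<le> freq k" and t: "t \<in> open_times T"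
  have n: "freq k \<ge> 1" "192 / (\<rho>\<^sup>2 * real_of_ereal (Linf_Hhalf_norm T u)) \<le> freq k" using K by simp_all
  then have k: "k \<noteq> 0" by auto
  have "norm (fourier (u t) k) \<le> 192 * L / t\<^sup>2 / rt k ^ 9" by (rule fourier_decay[OF L t k])
  also have "\<dots> \<le> 192 * L / t\<^sup>2 / rt k ^ 6"
    using rt_ge_1[OF k] Lnn by (intro divide_left_mono power_increasing mult_pos_pos zero_less_power) auto
  also have "rt k ^ 6 = freq k ^ 3" by (simp flip: rt_square)
  also have "192 * L / t\<^sup>2 / freq k ^ 3 \<le> ((2 * (4 + sqrt 2) * L\<^sup>2) / (1 - 2 * 1 * L)) / (freq k)\<^sup>2"
  \<comment> \<open>For L = 0 both sides vanish. Otherwise N is positive and the quotient in K has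
    its intended meaning.\<close>
  proof (cases "L = 0")
    case False
    then have L0': "L > 0" using Lnn by simp
    have "Linf_Hhalf_norm T u > 0"
    proof (rule ccontr)
      assume "\<not> Linf_Hhalf_norm T u > 0"
      then have "Hhalf_norm (u t) = 0" if "t \<in> open_times T" for t
        using Linf_norm_nonpos[OF u _ that] by simp
      then have "L = 0" unfolding L_def L0 using ne by simp
      then show False using False by simp
    qed
    then have "0 < real_of_ereal (Linf_Hhalf_norm T u) \<and> real_of_ereal (Linf_Hhalf_norm T u) \<le> L"
      using Linf_norm_le[OF u] by (cases "Linf_Hhalf_norm T u") auto
    then show ?thesis by (intro decay_constant_bound[OF L0' L n(2) n(1) _ _ \<rho>]) auto
  qed simp
  finally show "norm (fourier (u t) k) \<le> ((2 * (4 + sqrt 2) * L\<^sub>0) / (1 - 2 * 1 * sqrt L\<^sub>0)) / (freq k)\<^sup>2"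
    unfolding L_def[symmetric] unfolding L_square .
qed

theorem theorem4:
  shows "\<exists>c>0. \<exists>\<delta>>0. \<exists>K :: ereal \<Rightarrow> real \<Rightarrow> real. \<exists>\<epsilon>>0.
    \<forall>(T::ereal) (\<psi> :: real^3 \<Rightarrow> real^3) (u :: real \<Rightarrow> real^3 \<Rightarrow> real^3) (L\<^sub>0::real).
      0 < T \<and> u \<in> Linf_Hhalf T \<and> NS_solution T \<psi> u \<and>
      (\<forall>t\<in>open_times T. u t \<in> Hhalf \<and> Hhalf_norm (u t) < \<delta>) \<and>
      sqrt L\<^sub>0 = (SUP t\<in>open_times T. Hhalf_norm (u t)) \<longrightarrow>
      (\<forall>\<rho>>0. \<forall>(k :: int^3) t.
         norm (ivec k) \<ge> K (Linf_Hhalf_norm T u) \<rho> \<and> t \<in> open_times T \<and> t > \<rho> \<longrightarrow>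
         norm (fourier (u t) k)
           \<le> ((2 * (4 + sqrt 2) * L\<^sub>0) / (1 - 2 * c * sqrt L\<^sub>0)) / (norm (ivec k))\<^sup>2) \<and>
      (L\<^sub>0 < \<epsilon> \<longrightarrow> regular T u)"
proof -
  \<comment> \<open>A function of N and \<rho> alone, fixed before the solution. The maximum with 1
    excludes k = 0, also for N = 0, where the quotient is 0 by convention.\<close>
  let ?K = "\<lambda>N \<rho>. max 1 (192 / (\<rho>\<^sup>2 * real_of_ereal N))"
  show ?thesis
    by (rule exI[of _ "1::real"], rule conjI, simp, rule exI[of _ "1 / 40000 :: real"], rule conjI, simp,
        rule exI[of _ ?K], rule exI[of _ "1::real"], rule conjI, simp)
      (intro allI impI conjI; elim conjE; rule small_solution; assumption)
qed

end
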